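(* Let $T_*>0$, let $H\colon(0,T_*]\times\mathbb{R}^d\times\mathbb{R}^d\to\mathbb{R}$, and let $\mathcal{L}$ be a Lévy operator with triplet $(A,0,\mu)$ and heat kernel $p_t$. Assume: (1) $p_t\in C_b^\infty(\mathbb{R}^d)$ and there exist $\alpha\in(1,2]$ and $c_0>0$ such that $\int_{\mathbb{R}^d}|Dp_t(y)|\,dy\le c_0t^{-1/\alpha}$ for all $t\in(0,T_*]$; (2) $H$ is continuous and there are $r\ge1$, $H_0,L>0$ such that for all $t\in(0,T_* )$ and $x,p,q\in\mathbb{R}^d$, $$|H(t,x,0)|\le H_0,\qquad |H(t,x,p)-H(t,x,q)|\le L(1+|p|^2+|q|^2)^{\frac{r-1}{2}}|p-q|;$$ (3) $u_0\in C_b^\delta(\mathbb{R}^d)$ for some $\delta\in[0,1)$ satisfying: $\delta=0$ if $r\in[1,\alpha)$; $\delta\in(0,1)$ if $r=\alpha$; $\delta\in\big(\frac{r-\alpha}{r-1},1\big)$ if $r\in(\alpha,\infty)$. Then there is $T\in(0,T_*]$ for which there exists a unique mild solution $u\in C((0,T];C_b^1(\mathbb{R}^d))$ of $$\partial_tu-\mathcal{L}u-H(t,x,Du)=0\ \text{ in }(0,T]\times\mathbb{R}^d,\qquad u(0,x)=u_0(x),$$ and $\|Du(t,\cdot)\|_\infty=O(t^{-(1-\delta)/\alpha})$ as $t\to0$.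
   Context: Lévy operator: $A$ is a nonnegative definite real symmetric $d\times d$ matrix, $\mu\ge 0$ is a Borel measure on $\mathbb{R}^d\setminus\{0\}$ with $\int(1\wedge|z|^2)\,d\mu(z)<\infty$, and $$\mathcal{L}\varphi(x)=\operatorname{div}(AD\varphi(x))+\int_{\mathbb{R}^d}\big[\varphi(x+z)-\varphi(x)-\mathbf{1}_{|z|<1}D\varphi(x)\cdot z\big]\,d\mu(z).$$ Heat kernel: $p_t$, $t>0$, are the probability measures with $\int e^{-i\xi\cdot x}p_t(dx)=e^{-t\psi(\xi)}$, where $\psi(\xi)=\xi\cdot A\xi+\int(1-e^{i\xi\cdot z}+i\xi\cdot z\mathbf{1}_{|z|<1})\,d\mu(z)$; they are assumed absolutely continuous with density again denoted $p_t$. Semigroup: $P_t\varphi=p_t*\varphi$. $C_b^n(\mathbb{R}^d)$, $n\in\{0,1,\dots\}$: functions with bounded continuous derivatives up to order $n$, with norm $\sum_{j\le n}\max_{|\kappa|=j}\|\partial^\kappa\varphi\|_\infty$. For $\delta\in(0,1)$, $C_b^\delta(\mathbb{R}^d)$ is the space of bounded $\delta$-Hölder continuous functions. $D$ is the spatial gradient. Mild solution: $u\in C((0,T];C_b^1(\mathbb{R}^d))$ such that for all $t\in(0,T]$, $x\in\mathbb{R}^d$, $$u(t,x)=P_t[u_0](x)+\int_0^tP_{t-s}\big[H(s,\cdot,Du(s,\cdot))\big](x)\,ds.$$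
   Formalization: Uniqueness is proved among mild solutions that also satisfy ‖Du(t,·)‖_∞ = O(t^{-(1-δ)/α}); among all mild solutions it fails, e.g. L = Laplacian, H = |p|², u_0 = 0 has both u = 0 and u = log(1+p_t). *)

theory Defs
  imports "HOL-Analysis.Analysis" "HOL-Probability.Probability" "HOL-Library.Landau_Symbols"
begin

section \<open>Derivatives and function spaces\<close>

definition dpartial :: "'d::finite \<Rightarrow> (real^'d \<Rightarrow> real) \<Rightarrow> real^'d \<Rightarrow> real" where
  "dpartial i f x = frechet_derivative f (at x) (axis i 1)"

definition grad :: "(real^'d::finite \<Rightarrow> real) \<Rightarrow> real^'d \<Rightarrow> real^'d" where
  "grad f x = (\<chi> i. dpartial i f x)"

text \<open>
  Derivatives of order \<open>j\<close> are indexed by lists of coordinates of length \<open>j\<close> rather than by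
  multi-indices \<open>\<kappa>\<close> with \<open>|\<kappa>| = j\<close>. As mixed partial derivatives of the functions in \<open>Cb n\<close> up to
  order \<open>n\<close> commute, lists with the same entries give the same derivative, so neither the space
  nor the norm below is affected.
\<close>

definition derivs :: "'d::finite list \<Rightarrow> (real^'d \<Rightarrow> real) \<Rightarrow> real^'d \<Rightarrow> real" where
  "derivs is f = foldr dpartial is f"

definition Cb :: "nat \<Rightarrow> (real^'d::finite \<Rightarrow> real) set" where
  "Cb n = {f.
     (\<forall>is. length is < n \<longrightarrow> (\<forall>x. derivs is f differentiable at x)) \<and>
     (\<forall>is. length is \<le> n \<longrightarrow> continuous_on UNIV (derivs is f) \<and> bounded (range (derivs is f)))}"

definition Cb_infinity :: "(real^'d::finite \<Rightarrow> real) set" where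
  "Cb_infinity = (\<Inter>n. Cb n)"

text \<open>Meaningful for bounded functions only: \<open>SUP\<close> is the supremum in the reals.\<close>

definition sup_norm :: "('a \<Rightarrow> 'b::real_normed_vector) \<Rightarrow> real" where
  "sup_norm f = (SUP x. norm (f x))"

definition Cb_norm :: "nat \<Rightarrow> (real^'d::finite \<Rightarrow> real) \<Rightarrow> real" where
  "Cb_norm n f = (\<Sum>j\<le>n. MAX is\<in>{is. length is = j}. sup_norm (derivs is f))"

text \<open>
  The scale of bounded Hoelder functions for exponents in \<open>[0,1)\<close>; at exponent 0 it is
  the space of bounded continuous functions, not that of all bounded functions.
\<close>

definition Cb_Hoelder :: "real \<Rightarrow> (real^'d::finite \<Rightarrow> real) set" where
  "Cb_Hoelder \<delta> = (if \<delta> = 0 then Cb 0 else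
     {f. bounded (range f) \<and> (\<exists>K. \<forall>x y. \<bar>f x - f y\<bar> \<le> K * dist x y powr \<delta>)})"

section \<open>Levy operators and heat kernels\<close>

text \<open>A measure on \<open>\<real>\<^sup>d - {0}\<close> is identified with its extension by zero to \<open>\<real>\<^sup>d\<close>.\<close>

definition levy_measure :: "(real^'d::finite) measure \<Rightarrow> bool" where
  "levy_measure \<mu> \<longleftrightarrow> sets \<mu> = sets borel \<and> emeasure \<mu> {0} = 0 \<and>
     (\<integral>\<^sup>+ z. ennreal (min 1 ((norm z)\<^sup>2)) \<partial>\<mu>) < \<infinity>"

text \<open>The triplet \<open>(A, 0, \<mu>)\<close> with vanishing drift.\<close>

definition levy_triplet :: "real^'d^'d \<Rightarrow> (real^'d::finite) measure \<Rightarrow> bool" where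
  "levy_triplet A \<mu> \<longleftrightarrow>
     transpose A = A \<and> (\<forall>\<xi>. 0 \<le> \<xi> \<bullet> (A *v \<xi>)) \<and> levy_measure \<mu>"

text \<open>
  The operator itself is recorded for reference: mild solutions involve it only through its heat
  kernel, which is determined by the symbol, \<open>\<L> exp (\<i> \<xi> \<bullet> x) = - \<psi> \<xi> exp (\<i> \<xi> \<bullet> x)\<close>.
\<close>

definition levy_operator ::
  "real^'d^'d \<Rightarrow> (real^'d::finite) measure \<Rightarrow> (real^'d \<Rightarrow> real) \<Rightarrow> real^'d \<Rightarrow> real" where
  "levy_operator A \<mu> \<phi> x =
     (\<Sum>i\<in>UNIV. dpartial i (\<lambda>y. (A *v grad \<phi> y) $ i) x) +
     (LINT z|\<mu>. \<phi> (x + z) - \<phi> x - indicator (ball 0 1) z * (grad \<phi> x \<bullet> z))"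

definition levy_symbol ::
  "real^'d^'d \<Rightarrow> (real^'d::finite) measure \<Rightarrow> real^'d \<Rightarrow> complex" where
  "levy_symbol A \<mu> \<xi> = of_real (\<xi> \<bullet> (A *v \<xi>)) +
     (LINT z|\<mu>. 1 - exp (\<i> * of_real (\<xi> \<bullet> z))
                + \<i> * of_real (\<xi> \<bullet> z) * indicator (ball 0 1) z)"

text \<open>\<open>p t\<close> is the Lebesgue density of the heat kernel at time \<open>t\<close>; only \<open>t > 0\<close> matters.\<close>

definition heat_kernel ::
  "real^'d^'d \<Rightarrow> (real^'d::finite) measure \<Rightarrow> (real \<Rightarrow> real^'d \<Rightarrow> real) \<Rightarrow> bool" where
  "heat_kernel A \<mu> p \<longleftrightarrow> (\<forall>t>0.
     p t \<in> borel_measurable borel \<and> (\<forall>x. 0 \<le> p t x) \<and>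
     prob_space (density lborel (\<lambda>x. ennreal (p t x))) \<and>
     (\<forall>\<xi>. (LINT x|density lborel (\<lambda>x. ennreal (p t x)). exp (- \<i> * of_real (\<xi> \<bullet> x)))
          = exp (- of_real t * levy_symbol A \<mu> \<xi>)))"

definition semigroup_of ::
  "(real \<Rightarrow> real^'d::finite \<Rightarrow> real) \<Rightarrow> real \<Rightarrow> (real^'d \<Rightarrow> real) \<Rightarrow> real^'d \<Rightarrow> real" where
  "semigroup_of p t \<phi> x = (LINT y|lborel. p t (x - y) * \<phi> y)"

section \<open>Mild solutions\<close>

text \<open>\<open>u \<in> C((0,T]; C\<^sub>b\<^sup>n)\<close>\<close>

definition continuous_into_Cb ::
  "nat \<Rightarrow> real \<Rightarrow> (real \<Rightarrow> real^'d::finite \<Rightarrow> real) \<Rightarrow> bool" where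
  "continuous_into_Cb n T u \<longleftrightarrow> (\<forall>t\<in>{0<..T}. u t \<in> Cb n \<and>
     ((\<lambda>s. Cb_norm n (\<lambda>x. u s x - u t x)) \<longlongrightarrow> 0) (at t within {0<..T}))"

text \<open>
  Integrability in \<open>s\<close> is part of the definition since the Bochner integral of a
  non-integrable function is 0 by convention. The values \<open>u t\<close> for \<open>t\<close> outside \<open>(0,T]\<close> are irrelevant;
  the initial condition is encoded in the Duhamel formula.
\<close>

definition mild_solution ::
  "(real \<Rightarrow> real^'d::finite \<Rightarrow> real) \<Rightarrow> (real \<Rightarrow> real^'d \<Rightarrow> real^'d \<Rightarrow> real) \<Rightarrow>
   (real^'d \<Rightarrow> real) \<Rightarrow> real \<Rightarrow> (real \<Rightarrow> real^'d \<Rightarrow> real) \<Rightarrow> bool" where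
  "mild_solution p H u0 T u \<longleftrightarrow> continuous_into_Cb 1 T u \<and>
     (\<forall>t\<in>{0<..T}. \<forall>x.
        set_integrable lborel {0<..<t}
          (\<lambda>s. semigroup_of p (t - s) (\<lambda>y. H s y (grad (u s) y)) x) \<and>
        u t x = semigroup_of p t u0 x +
          (LINT s:{0<..<t}|lborel. semigroup_of p (t - s) (\<lambda>y. H s y (grad (u s) y)) x))"

end

theory Submission
  imports Defs
begin

text \<open>
  The proof is a contraction argument for the weighted gradient, but the weight, the bound on the free
  evolution and the continuity in time all have to be extracted from the \<open>L\<^sup>1\<close> bound on the gradient of
  the kernel. Write \<open>a = 1/\<alpha>\<close>, \<open>\<theta> = (1 - \<delta>)/\<alpha>\<close> and \<open>G\<^sub>t \<phi> = Dp\<^sub>t * \<phi>\<close>.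

  \<^emph>\<open>The kernel.\<close> The Fourier transforms \<open>exp (- t \<psi>)\<close> multiply, so uniqueness of the Fourier transform
  on \<open>\<real>\<^sup>d\<close> (\<open>fourier_transform_unique\<close>) gives \<open>p\<^sub>s\<^sub>+\<^sub>t = p\<^sub>s * p\<^sub>t\<close>, and they tend to 1 as \<open>t\<close> tends to 0, so the
  laws \<open>p\<^sub>h\<close> concentrate at 0 (\<open>law_concentrates\<close>). For bounded Borel \<open>\<phi>\<close> the function \<open>P\<^sub>t \<phi>\<close> is \<open>C\<^sup>1\<close> with
  gradient \<open>G\<^sub>t \<phi>\<close>, where \<open>\<bar>G\<^sub>t \<phi>\<bar> \<le> c\<^sub>0 t powr (- a) \<parallel>\<phi>\<parallel>\<close>. As \<open>P\<^sub>\<sigma>\<^sub>+\<^sub>h \<phi> = P\<^sub>h (P\<^sub>\<sigma> \<phi>)\<close> with \<open>P\<^sub>\<sigma> \<phi>\<close> Lipschitz, both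
  \<open>P\<^sub>\<sigma>\<close> and \<open>G\<^sub>\<sigma>\<close> depend on \<open>\<sigma> \<ge> \<eta>\<close> uniformly continuously in operator norm (\<open>P_modulus\<close>, \<open>G_modulus\<close>).

  \<^emph>\<open>The initial datum.\<close> No moment of \<open>Dp\<^sub>t\<close> is available, so \<open>\<bar>G\<^sub>t u\<^sub>0\<bar> \<le> C t powr (- \<theta>)\<close> is an interpolation:
  \<open>u\<^sub>0\<close> is a Lipschitz function plus a small one, at scale \<open>t powr a\<close> (\<open>G_bound_Hoelder\<close>).

  \<^emph>\<open>The fixed point.\<close> If \<open>\<bar>w(s)\<bar> \<le> R s powr (- \<theta>)\<close> then \<open>H(s, \<cdot>, w(s))\<close> is of size \<open>s powr (- r \<theta>)\<close>, and
  \<open>\<integral>\<^sub>0\<^sup>t (t - s) powr (- a) s powr (- r \<theta>) ds = B t powr (1 - a - r \<theta>)\<close>, a Beta integral. The conditions on \<open>\<delta>\<close>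
  imply that \<open>1 - a - (r - 1) \<theta> > 0\<close>; hence in the norm \<open>sup t powr \<theta> \<bar>w(t)\<bar>\<close> the gradient of the
  Duhamel map carries a positive power of \<open>T\<close> and is a contraction for small \<open>T\<close> (\<open>fixed_profile_exists\<close>).
  A competing solution may have a larger constant \<open>R\<close> on the same interval, so for uniqueness smallness
  comes from an additional weight \<open>exp (- \<lambda> t)\<close> with \<open>\<lambda>\<close> large instead of from \<open>T\<close> (\<open>fixed_profile_unique\<close>).
\<close>

section \<open>Uniqueness of the Fourier transform\<close>

text \<open>
  Pushing \<open>a M\<close> and \<open>a N\<close> forward along one coordinate and normalising gives two laws on the line, which
  the one-dimensional uniqueness theorem identifies. The lower bound on \<open>a\<close> keeps the mass positive.
\<close>
lemma coordinate_law_determined: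
  fixes M N :: "(real^'d::finite) measure" and a :: "real^'d \<Rightarrow> real"
  assumes M: "prob_space M" "sets M = sets borel" and N: "prob_space N" "sets N = sets borel"
    and a[measurable]: "a \<in> borel_measurable borel" and a_ge: "\<And>x. 1 \<le> a x" and a_le: "\<And>x. a x \<le> C"
    and eq: "\<And>\<tau>. (CLINT x|M. of_real (a x) * iexp (\<tau> * x$k)) = (CLINT x|N. of_real (a x) * iexp (\<tau> * x$k))"
    and B[measurable]: "B \<in> sets borel"
  shows "(LINT x|M. a x * indicator B (x$k)) = (LINT x|N. a x * indicator B (x$k))"
proof -
  define m where "m = (LINT x|M. a x)"
  define D where "D Q = distr (density Q (\<lambda>x. ennreal (a x / m))) borel (\<lambda>x. x$k)" for Q :: "(real^'d) measure"
  have int: "integrable Q a" if "prob_space Q" "sets Q = sets borel" for Q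
  proof -
    interpret prob_space Q by fact
    show ?thesis using a_ge a_le that(2)
      by (intro integrable_const_bound[of _ C] AE_I2) (auto simp: abs_if intro: order_trans[OF zero_le_one] dest: less_le_trans[OF _ a_ge] cong: measurable_cong_sets, smt (verit) a_ge)
  qed
  have "complex_of_real m = complex_of_real (LINT x|N. a x)"
    using eq[of 0] by (simp add: m_def)
  then have mN: "m = (LINT x|N. a x)" by (simp only: of_real_eq_iff)
  have m1: "m \<ge> 1"
  proof -
    interpret prob_space M by fact
    have "(LINT x|M. 1) \<le> m" unfolding m_def
      by (intro integral_mono int M) (auto simp: a_ge)
    then show ?thesis by (simp add: prob_space)
  qed
  have D: "real_distribution (D Q) \<and> (\<forall>\<tau>. char (D Q) \<tau> = (CLINT x|Q. of_real (a x) * iexp (\<tau> * x$k)) / of_real m)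
      \<and> measure (D Q) B = (LINT x|Q. a x * indicator B (x$k)) / m"
    if Q: "prob_space Q" and s[measurable_cong]: "sets Q = sets borel" and mQ: "m = (LINT x|Q. a x)" for Q
  proof -
    have a0: "0 \<le> a x / m" for x using m1 a_ge[of x] by simp
    have [measurable]: "(\<lambda>x. x$k) \<in> borel_measurable borel"
      by (intro borel_measurable_continuous_onI continuous_intros)
    have "emeasure (density Q (\<lambda>x. ennreal (a x / m))) (space Q) = (\<integral>\<^sup>+x. ennreal (a x / m) \<partial>Q)"
      by (subst emeasure_density) (auto intro!: nn_integral_cong)
    also have "\<dots> = ennreal (LINT x|Q. a x / m)"
      by (intro nn_integral_eq_integral) (use int[OF Q s] a0 in auto)
    also have "\<dots> = 1" using m1 mQ by simp
    finally have "prob_space (density Q (\<lambda>x. ennreal (a x / m)))"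
      by (intro prob_spaceI) simp
    then interpret P: prob_space "density Q (\<lambda>x. ennreal (a x / m))" .
    have "real_distribution (D Q)" unfolding D_def
      by (intro P.real_distribution_distr) simp
    moreover have "char (D Q) \<tau> = (CLINT x|Q. of_real (a x) * iexp (\<tau> * x$k)) / of_real m" for \<tau>
    proof -
      have "char (D Q) \<tau> = (CLINT x|density Q (\<lambda>x. ennreal (a x / m)). iexp (\<tau> * x$k))"
        unfolding D_def char_def by (subst integral_distr) auto
      also have "\<dots> = (CLINT x|Q. (a x / m) *\<^sub>R iexp (\<tau> * x$k))"
        by (subst integral_density) (use a0 in auto)
      also have "\<dots> = (CLINT x|Q. of_real (a x) * iexp (\<tau> * x$k) / of_real m)"
        by (intro Bochner_Integration.integral_cong) (auto simp: scaleR_conv_of_real)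
      finally show ?thesis by simp
    qed
    moreover have "measure (D Q) B = (LINT x|Q. a x * indicator B (x$k)) / m"
    proof -
      interpret R: real_distribution "D Q" by fact
      have "measure (D Q) B = (LINT x|D Q. indicator B x)" by simp
      also have "\<dots> = (LINT x|density Q (\<lambda>x. ennreal (a x / m)). indicator B (x$k))"
        unfolding D_def by (subst integral_distr) auto
      also have "\<dots> = (LINT x|Q. (a x / m) *\<^sub>R indicator B (x$k))"
        by (subst integral_density) (use a0 in auto)
      also have "\<dots> = (LINT x|Q. a x * indicator B (x$k) / m)"
        by (intro Bochner_Integration.integral_cong) auto
      finally show ?thesis by simp
    qed
    ultimately show ?thesis by blast
  qed
  have "D M = D N"
    using D[OF M m_def] D[OF N mN] eq by (intro Levy_uniqueness) (auto simp: fun_eq_iff)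
  then show ?thesis
    using D[OF M m_def] D[OF N mN] m1 by simp
qed

lemma bounded_fourier_integrable:
  fixes M :: "(real^'d::finite) measure" and g :: "real^'d \<Rightarrow> real"
  assumes "prob_space M" and s[measurable_cong]: "sets M = sets borel"
    and [measurable]: "g \<in> borel_measurable borel" and bd: "\<And>x. \<bar>g x\<bar> \<le> C"
  shows "integrable M (\<lambda>x. complex_of_real (g x) * iexp (\<xi> \<bullet> x))"
    "integrable M (\<lambda>x. g x * cos (\<xi> \<bullet> x))" "integrable M (\<lambda>x. g x * sin (\<xi> \<bullet> x))"
proof -
  interpret prob_space M by fact
  have C0: "0 \<le> C" using bd[of 0] by simp
  show "integrable M (\<lambda>x. complex_of_real (g x) * iexp (\<xi> \<bullet> x))"
    by (intro integrable_const_bound[of _ C] AE_I2) (auto simp: norm_mult bd)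
  show "integrable M (\<lambda>x. g x * cos (\<xi> \<bullet> x))"
    using mult_mono[OF bd abs_cos_le_one C0] 
    by (intro integrable_const_bound[of _ C] AE_I2) (auto simp: abs_mult)
  show "integrable M (\<lambda>x. g x * sin (\<xi> \<bullet> x))"
    using mult_mono[OF bd abs_sin_le_one C0] 
    by (intro integrable_const_bound[of _ C] AE_I2) (auto simp: abs_mult)
qed

text \<open>
  Equality of the transforms of \<open>g M\<close> and \<open>g N\<close> survives multiplying \<open>g\<close> by the indicator of a slab in
  coordinate \<open>k\<close>. The signed weights \<open>g cos\<close> and \<open>g sin\<close> are lifted above 1 by adding a constant, which
  is subtracted again afterwards.
\<close>
lemma fourier_restrict_coordinate:
  fixes M N :: "(real^'d::finite) measure" and g :: "real^'d \<Rightarrow> real"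
  assumes M: "prob_space M" "sets M = sets borel" and N: "prob_space N" "sets N = sets borel"
    and g[measurable]: "g \<in> borel_measurable borel" and bd: "\<And>x. \<bar>g x\<bar> \<le> C"
    and eq1: "\<And>\<xi>. (CLINT x|M. iexp (\<xi> \<bullet> x)) = (CLINT x|N. iexp (\<xi> \<bullet> x))"
    and eqg: "\<And>\<xi>. (CLINT x|M. of_real (g x) * iexp (\<xi> \<bullet> x)) = (CLINT x|N. of_real (g x) * iexp (\<xi> \<bullet> x))"
    and B[measurable]: "B \<in> sets borel"
  shows "(CLINT x|M. of_real (g x * indicator B (x$k)) * iexp (\<xi> \<bullet> x))
       = (CLINT x|N. of_real (g x * indicator B (x$k)) * iexp (\<xi> \<bullet> x))"
proof -
  have C0: "0 \<le> C" using bd[of 0] by simp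
  have [measurable]: "(\<lambda>x. x$k) \<in> borel_measurable borel"
    by (intro borel_measurable_continuous_onI continuous_intros)
  have ax: "\<tau> * x$k = (axis k \<tau>) \<bullet> x" for \<tau> and x :: "real^'d"
    by (simp add: inner_axis')
  note int = bounded_fourier_integrable[OF M g bd] bounded_fourier_integrable[OF N g bd]
  note int1 = bounded_fourier_integrable[OF M, of "\<lambda>_. 1" 1, simplified] bounded_fourier_integrable[OF N, of "\<lambda>_. 1" 1, simplified]
  have bd': "\<bar>g x * indicator B (x$k)\<bar> \<le> C" for x using bd[of x] C0 by (auto simp: indicator_def)
  have gB: "(\<lambda>x. g x * indicator B (x$k)) \<in> borel_measurable borel" by measurable
  note intB = bounded_fourier_integrable[OF M gB bd'] bounded_fourier_integrable[OF N gB bd']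
  have key: "(LINT x|M. (C + 1 + g x * w x) * indicator B (x$k)) = (LINT x|N. (C + 1 + g x * w x) * indicator B (x$k))"
    if w[measurable]: "w \<in> borel_measurable borel" and w1: "\<And>x. \<bar>w x\<bar> \<le> 1"
      and w: "\<And>x. complex_of_real (w x) = c1 * iexp (\<xi> \<bullet> x) + c2 * iexp ((-\<xi>) \<bullet> x)" for w c1 c2
  proof (rule coordinate_law_determined[OF M N, where C="2*C+1"])
    have le: "\<bar>g x * w x\<bar> \<le> C" for x
      using mult_mono[OF bd w1 C0, of x x] by (simp add: abs_mult)
    show "1 \<le> C + 1 + g x * w x" "C + 1 + g x * w x \<le> 2*C+1" for x using le[of x] by linarith+
    show "(\<lambda>x. C + 1 + g x * w x) \<in> borel_measurable borel" by measurable
    fix \<tau>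
    have f: "complex_of_real (C + 1 + g x * w x) * iexp (\<tau> * x$k) =
      of_real (C+1) * iexp (axis k \<tau> \<bullet> x) + c1 * (of_real (g x) * iexp ((\<xi> + axis k \<tau>) \<bullet> x))
       + c2 * (of_real (g x) * iexp ((-\<xi> + axis k \<tau>) \<bullet> x))" for x
      unfolding ax of_real_add of_real_mult w
      by (simp add: algebra_simps exp_add exp_diff inner_add_left inner_diff_left exp_minus divide_inverse)
    show "(CLINT x|M. of_real (C + 1 + g x * w x) * iexp (\<tau> * x$k)) = (CLINT x|N. of_real (C + 1 + g x * w x) * iexp (\<tau> * x$k))"
      unfolding f using int(1)[of "\<xi> + axis k \<tau>"] int(1)[of "-\<xi> + axis k \<tau>"] int(4)[of "\<xi> + axis k \<tau>"] int(4)[of "-\<xi> + axis k \<tau>"] int1(1)[of "axis k \<tau>"] int1(4)[of "axis k \<tau>"]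
      by (simp add: Bochner_Integration.integral_add eq1 eqg del: of_real_add)
  qed (fact B)
  have k0: "(LINT x|M. (C + 1) * indicator B (x$k)) = (LINT x|N. (C + 1) * indicator B (x$k))"
    using key[of "\<lambda>_. 0" 0 0] by simp
  have iB: "integrable M (\<lambda>x. indicator B (x$k) :: real)" "integrable N (\<lambda>x. indicator B (x$k) :: real)"
    using bounded_fourier_integrable(2)[OF M, of "\<lambda>x. indicator B (x$k)" 1 0] bounded_fourier_integrable(2)[OF N, of "\<lambda>x. indicator B (x$k)" 1 0] by auto
  have split: "(LINT x|Q. (C + 1 + g x * w x) * indicator B (x$k)) =
      (LINT x|Q. (C + 1) * indicator B (x$k)) + (LINT x|Q. g x * indicator B (x$k) * w x)"
    if "integrable Q (\<lambda>x. indicator B (x$k) :: real)" "integrable Q (\<lambda>x. g x * indicator B (x$k) * w x)" for Q w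
    using that by (subst Bochner_Integration.integral_add[symmetric])
      (auto intro!: Bochner_Integration.integral_cong simp: algebra_simps simp del: indicator_simps)
  have "(LINT x|M. (C + 1 + g x * cos (\<xi> \<bullet> x)) * indicator B (x$k)) =
      (LINT x|N. (C + 1 + g x * cos (\<xi> \<bullet> x)) * indicator B (x$k))"
    by (rule key[of _ "1/2" "1/2"]) (auto simp: cos_of_real[symmetric] cos_exp_eq simp del: cos_of_real)
  then have k1: "(LINT x|M. g x * indicator B (x$k) * cos (\<xi> \<bullet> x)) = (LINT x|N. g x * indicator B (x$k) * cos (\<xi> \<bullet> x))"
    unfolding split[OF iB(1) intB(2)] split[OF iB(2) intB(5)] k0 by simp
  have "(LINT x|M. (C + 1 + g x * sin (\<xi> \<bullet> x)) * indicator B (x$k)) =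
      (LINT x|N. (C + 1 + g x * sin (\<xi> \<bullet> x)) * indicator B (x$k))"
    by (rule key[of _ "1/(2*\<i>)" "-1/(2*\<i>)"])
      (auto simp: sin_of_real[symmetric] sin_exp_eq field_simps simp del: sin_of_real)
  then have k2: "(LINT x|M. g x * indicator B (x$k) * sin (\<xi> \<bullet> x)) = (LINT x|N. g x * indicator B (x$k) * sin (\<xi> \<bullet> x))"
    unfolding split[OF iB(1) intB(3)] split[OF iB(2) intB(6)] k0 by simp
  have *: "(CLINT x|Q. of_real (g x * indicator B (x$k)) * iexp (\<xi> \<bullet> x)) =
    Complex (LINT x|Q. g x * indicator B (x$k) * cos (\<xi> \<bullet> x)) (LINT x|Q. g x * indicator B (x$k) * sin (\<xi> \<bullet> x))"
    if "integrable Q (\<lambda>x. complex_of_real (g x * indicator B (x$k)) * iexp (\<xi> \<bullet> x))" for Q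
    using that by (intro complex_eqI) (auto simp flip: integral_Re integral_Im simp: Re_exp Im_exp)
  show ?thesis using *[OF intB(1)] *[OF intB(4)] k1 k2 by simp
qed

text \<open>
  Adding one slab at a time reduces the statement to boxes, which are stable under intersection.
\<close>
theorem fourier_transform_unique:
  fixes M N :: "(real^'d::finite) measure"
  assumes M: "prob_space M" "sets M = sets borel" and N: "prob_space N" "sets N = sets borel"
    and eq: "\<And>\<xi>. (CLINT x|M. iexp (\<xi> \<bullet> x)) = (CLINT x|N. iexp (\<xi> \<bullet> x))"
  shows "M = N"
proof -
  have [measurable]: "(\<lambda>x::real^'d. x$k) \<in> borel_measurable borel" for k
    by (intro borel_measurable_continuous_onI continuous_intros)
  have main: "(CLINT x|M. of_real (\<Prod>k\<in>K. indicator (B k) (x$k)) * iexp (\<xi> \<bullet> x)) =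
      (CLINT x|N. of_real (\<Prod>k\<in>K. indicator (B k) (x$k)) * iexp (\<xi> \<bullet> x))"
    if B: "\<And>k. B k \<in> sets borel" for K and B :: "'d \<Rightarrow> real set" and \<xi>
    using finite[of K]
  proof (induction K arbitrary: \<xi> rule: finite_induct)
    case empty then show ?case using eq by simp
  next
    case (insert k K)
    have [measurable]: "B k \<in> sets borel" for k using B by simp
    have "(CLINT x|M. of_real ((\<Prod>k\<in>K. indicator (B k) (x$k)) * indicator (B k) (x$k)) * iexp (\<xi> \<bullet> x)) =
      (CLINT x|N. of_real ((\<Prod>k\<in>K. indicator (B k) (x$k)) * indicator (B k) (x$k)) * iexp (\<xi> \<bullet> x))"
    proof (rule fourier_restrict_coordinate[OF M N, where C=1])
      show "\<bar>\<Prod>k\<in>K. indicator (B k) (x$k) :: real\<bar> \<le> 1" for x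
        by (simp add: abs_prod prod_le_1)
    qed (use eq insert.IH in auto)
    then show ?case using insert.hyps by (simp add: mult.commute)
  qed
  have ind: "indicator (box a b) x = (\<Prod>k\<in>UNIV. indicator {a$k<..<b$k} (x$k) :: real)" for a b x :: "real^'d"
    by (auto simp: mem_box_cart indicator_def prod.neutral intro!: prod_zero)
  show ?thesis
  proof (rule measure_eqI_generator_eq[where E="range (\<lambda>(a, b). box a b)" and \<Omega>=UNIV and A="\<lambda>n. box (-(\<chi> i. real n)) (\<chi> i. real n)"])
    show "Int_stable (range (\<lambda>(a, b). box a b :: (real^'d) set))"
      by (auto simp: Int_stable_def box_Int_box)
    fix X assume "X \<in> range (\<lambda>(a, b). box a b :: (real^'d) set)"
    then obtain a b where X: "X = box a b" by auto
    have "complex_of_real (measure M X) = complex_of_real (measure N X)"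
      using main[of "\<lambda>k. {a$k<..<b$k}" UNIV 0] M(2) N(2)
      by (simp add: X ind[symmetric] sets_eq_imp_space_eq[OF M(2)] sets_eq_imp_space_eq[OF N(2)])
    then have "measure M X = measure N X" by (simp only: of_real_eq_iff)
    then show "emeasure M X = emeasure N X"
      using M(1) N(1) by (simp add: finite_measure.emeasure_eq_measure prob_space_def)
  next
    show "(\<Union>n. box (-(\<chi> i. real n)) (\<chi> i. real n)) = (UNIV :: (real^'d) set)"
    proof (intro UNIV_eq_I[symmetric])
      fix x :: "real^'d"
      obtain n where n: "norm x < real n" using reals_Archimedean2 by blast
      have "\<bar>x$i\<bar> < n" for i using component_le_norm_cart[of x i] n by linarith
      then have "x \<in> box (-(\<chi> i. real n)) (\<chi> i. real n)" 
        by (auto simp: mem_box_cart abs_less_iff minus_less_iff)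
      then show "x \<in> (\<Union>n. box (-(\<chi> i. real n)) (\<chi> i. real n))" by blast
    qed
  next
    show "emeasure M (box (-(\<chi> i. real n)) (\<chi> i. real n)) \<noteq> \<infinity>" for n
      using M(1) by (simp add: finite_measure.emeasure_eq_measure prob_space_def)
  qed (auto simp: M N borel_eq_box)
qed

section \<open>The semigroup of a heat kernel\<close>

lemma lborel_distr_reflect:
  fixes x :: "'a::euclidean_space"
  shows "distr lborel borel (\<lambda>y. x - y) = lborel"
  by (subst lborel_affine[of "-1" x]) (auto simp: density_1)

lemma integral_lborel_reflect:
  fixes f :: "'a::euclidean_space \<Rightarrow> 'b::{banach,second_countable_topology}"
  assumes [measurable]: "f \<in> borel_measurable borel"
  shows "(LINT y|lborel. f (x - y)) = (LINT y|lborel. f y)"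
  by (subst lborel_distr_reflect[of x, symmetric], subst integral_distr) auto

lemma nn_integral_lborel_translate:
  fixes x :: "'a::euclidean_space"
  assumes [measurable]: "f \<in> borel_measurable borel"
  shows "(\<integral>\<^sup>+y. f (x + y) \<partial>lborel) = (\<integral>\<^sup>+y. f y \<partial>lborel)"
  by (subst lborel_distr_plus[of x, symmetric], subst nn_integral_distr) auto

text \<open>
  The bound is a parameter, not a supremum: estimates proportional to it then give operator norms
  without any boundedness side conditions on \<open>sup_norm\<close>.
\<close>
definition bounded_by :: "real \<Rightarrow> (real^'d::finite \<Rightarrow> real) \<Rightarrow> bool" where
  "bounded_by C \<phi> \<longleftrightarrow> \<phi> \<in> borel_measurable borel \<and> (\<forall>x. \<bar>\<phi> x\<bar> \<le> C)"

lemma bounded_byD: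
  assumes "bounded_by C \<phi>"
  shows "\<phi> \<in> borel_measurable borel" "\<bar>\<phi> x\<bar> \<le> C" "0 \<le> C"
  using assms order_trans[OF abs_ge_zero, of "\<phi> 0" C] by (auto simp: bounded_by_def)

lemma has_derivative_grad:
  fixes f :: "real^'d::finite \<Rightarrow> real"
  assumes "f differentiable at x"
  shows "(f has_derivative (\<lambda>h. grad f x \<bullet> h)) (at x)"
proof -
  have d: "(f has_derivative frechet_derivative f (at x)) (at x)"
    using assms by (simp add: frechet_derivative_works)
  have "frechet_derivative f (at x) h = grad f x \<bullet> h" for h
  proof -
    interpret linear "frechet_derivative f (at x)" using d by (rule has_derivative_linear)
    have "(\<Sum>i\<in>UNIV. h$i *\<^sub>R axis i 1) = h"
      using basis_expansion[of h] by (simp only: scalar_mult_eq_scaleR)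
    then have "frechet_derivative f (at x) h = frechet_derivative f (at x) (\<Sum>i\<in>UNIV. h$i *\<^sub>R axis i 1)"
      by (simp only:)
    also have "\<dots> = grad f x \<bullet> h"
      by (simp add: sum scale grad_def dpartial_def inner_vec_def mult.commute)
    finally show ?thesis .
  qed
  then have "frechet_derivative f (at x) = (\<lambda>h. grad f x \<bullet> h)" by (rule ext)
  with d show ?thesis by simp
qed

lemma grad_eqI:
  fixes f :: "real^'d::finite \<Rightarrow> real"
  assumes "(f has_derivative (\<lambda>h. g \<bullet> h)) (at x)"
  shows "grad f x = g"
  using frechet_derivative_at[OF assms, symmetric]
  by (simp add: grad_def dpartial_def vec_eq_iff inner_axis)

text \<open>
  A heat kernel with its smoothing estimate; \<open>a\<close> stands for \<open>1/\<alpha>\<close> and \<open>\<psi>\<close> for the symbol.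
\<close>
locale smoothing_kernel =
  fixes p :: "real \<Rightarrow> real^'d::finite \<Rightarrow> real" and \<psi> :: "real^'d \<Rightarrow> complex" and Tm a c0 :: real
  assumes p_meas: "t > 0 \<Longrightarrow> p t \<in> borel_measurable borel"
    and p_nonneg: "t > 0 \<Longrightarrow> 0 \<le> p t x"
    and p_prob: "t > 0 \<Longrightarrow> prob_space (density lborel (\<lambda>x. ennreal (p t x)))"
    and p_char: "t > 0 \<Longrightarrow> (LINT x|density lborel (\<lambda>x. ennreal (p t x)). exp (- \<i> * of_real (\<xi> \<bullet> x)))
          = exp (- of_real t * \<psi> \<xi>)"
    and p_diff: "t > 0 \<Longrightarrow> p t differentiable at x"
    and p_grad_cont: "t > 0 \<Longrightarrow> continuous_on UNIV (grad (p t))"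
    and p_grad_int: "0 < t \<Longrightarrow> t \<le> Tm \<Longrightarrow>
      (\<integral>\<^sup>+ y. ennreal (norm (grad (p t) y)) \<partial>lborel) \<le> ennreal (c0 * t powr (- a))"
    and a: "0 < a" "a < 1" and c0: "0 < c0" and Tm: "0 < Tm"
begin

abbreviation "P \<equiv> semigroup_of p"

definition law :: "real \<Rightarrow> (real^'d) measure" where
  "law t = density lborel (\<lambda>x. ennreal (p t x))"

definition G :: "real \<Rightarrow> (real^'d \<Rightarrow> real) \<Rightarrow> real^'d \<Rightarrow> real^'d" where
  "G t \<phi> x = (LINT y|lborel. \<phi> y *\<^sub>R grad (p t) (x - y))"

lemma sets_law[simp, measurable_cong]: "sets (law t) = sets borel"
  by (simp add: law_def)

lemma space_law[simp]: "space (law t) = UNIV"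
  by (simp add: law_def)

lemma prob_law: "t > 0 \<Longrightarrow> prob_space (law t)"
  using p_prob by (simp add: law_def)

lemma P_eq_law:
  assumes t: "t > 0" and [measurable]: "\<phi> \<in> borel_measurable borel"
  shows "P t \<phi> x = (LINT y|law t. \<phi> (x - y))"
proof -
  note [measurable] = p_meas[OF t]
  have "(LINT y|law t. \<phi> (x - y)) = (LINT y|lborel. p t y *\<^sub>R \<phi> (x - y))"
    unfolding law_def by (subst integral_density) (auto simp: p_nonneg t)
  also have "\<dots> = (LINT y|lborel. p t (x - y) *\<^sub>R \<phi> (x - (x - y)))"
    by (rule integral_lborel_reflect[symmetric]) measurable
  finally show ?thesis by (simp add: semigroup_of_def)
qed

lemma bounded_integrable_law:
  assumes t: "t > 0" and \<phi>: "bounded_by C \<phi>"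
  shows "integrable (law t) (\<lambda>y. \<phi> (x - y))" "integrable (law t) \<phi>"
proof -
  interpret prob_space "law t" by (rule prob_law[OF t])
  note [measurable] = bounded_byD(1)[OF \<phi>]
  show "integrable (law t) (\<lambda>y. \<phi> (x - y))" "integrable (law t) \<phi>"
    by (auto intro!: integrable_const_bound[of _ C] AE_I2 bounded_byD(2)[OF \<phi>])
qed

lemma P_bounded:
  assumes t: "t > 0" and \<phi>: "bounded_by C \<phi>"
  shows "bounded_by C (P t \<phi>)"
proof -
  interpret prob_space "law t" by (rule prob_law[OF t])
  note [measurable] = bounded_byD(1)[OF \<phi>]
  have eq: "P t \<phi> = (\<lambda>x. LINT y|law t. \<phi> (x - y))"
    by (simp add: fun_eq_iff P_eq_law t)
  have "\<bar>LINT y|law t. \<phi> (x - y)\<bar> \<le> C" for x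
  proof -
    have "\<bar>LINT y|law t. \<phi> (x - y)\<bar> \<le> (LINT y|law t. \<bar>\<phi> (x - y)\<bar>)" by (rule integral_abs_bound)
    also have "\<dots> \<le> (LINT y|law t. C)"
      using bounded_integrable_law(1)[OF t \<phi>, of x] bounded_byD[OF \<phi>] by (intro integral_mono) auto
    finally show ?thesis by (simp add: prob_space[unfolded space_law])
  qed
  moreover have "(\<lambda>x. LINT y|law t. \<phi> (x - y)) \<in> borel_measurable borel" by measurable
  ultimately show ?thesis by (simp add: bounded_by_def eq)
qed

lemma char_law: "t > 0 \<Longrightarrow> (CLINT x|law t. iexp (\<xi> \<bullet> x)) = exp (- of_real t * \<psi> (- \<xi>))"
  using p_char[of t "-\<xi>"] by (simp add: law_def)

lemma law_add:
  assumes s: "s > 0" and t: "t > 0"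
  shows "law (s + t) = distr (law s \<Otimes>\<^sub>M law t) borel (\<lambda>(x, y). x + y)"
proof (rule fourier_transform_unique)
  interpret s: prob_space "law s" by (rule prob_law[OF s])
  interpret t: prob_space "law t" by (rule prob_law[OF t])
  interpret st: pair_prob_space "law s" "law t" ..
  show "prob_space (law (s + t))" using s t by (intro prob_law) simp
  show "prob_space (distr (law s \<Otimes>\<^sub>M law t) borel (\<lambda>(x, y). x + y))"
    by (intro st.prob_space_distr) measurable
  fix \<xi>
  have i: "integrable (law s \<Otimes>\<^sub>M law t) (\<lambda>(x, y). iexp (\<xi> \<bullet> x) * iexp (\<xi> \<bullet> y))"
    by (intro st.integrable_const_bound[of _ 1] AE_I2) (auto simp: norm_mult split: prod.splits)
  have "(CLINT z|distr (law s \<Otimes>\<^sub>M law t) borel (\<lambda>(x, y). x + y). iexp (\<xi> \<bullet> z)) =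
    (CLINT z|law s \<Otimes>\<^sub>M law t. iexp (\<xi> \<bullet> (fst z + snd z)))"
    by (subst integral_distr) (auto simp: case_prod_beta)
  also have "\<dots> = (CLINT z|law s \<Otimes>\<^sub>M law t. (case z of (x, y) \<Rightarrow> iexp (\<xi> \<bullet> x) * iexp (\<xi> \<bullet> y)))"
    by (intro Bochner_Integration.integral_cong) (auto simp: case_prod_beta inner_add_right exp_add distrib_left)
  also have "\<dots> = (CLINT x|law s. CLINT y|law t. iexp (\<xi> \<bullet> x) * iexp (\<xi> \<bullet> y))"
    using st.integral_fst'[OF i] by simp
  also have "\<dots> = (CLINT x|law s. iexp (\<xi> \<bullet> x)) * (CLINT y|law t. iexp (\<xi> \<bullet> y))"
    by simp
  also have "\<dots> = (CLINT x|law (s + t). iexp (\<xi> \<bullet> x))"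
    using s t by (simp add: char_law exp_add[symmetric] algebra_simps)
  finally show "(CLINT x|law (s + t). iexp (\<xi> \<bullet> x)) =
      (CLINT z|distr (law s \<Otimes>\<^sub>M law t) borel (\<lambda>(x, y). x + y). iexp (\<xi> \<bullet> z))" by simp
qed (auto)

lemma P_add:
  assumes s: "s > 0" and t: "t > 0" and \<phi>: "bounded_by C \<phi>"
  shows "P (s + t) \<phi> = P s (P t \<phi>)"
proof
  fix x
  interpret s: prob_space "law s" by (rule prob_law[OF s])
  interpret t: prob_space "law t" by (rule prob_law[OF t])
  interpret st: pair_prob_space "law s" "law t" ..
  note [measurable] = bounded_byD(1)[OF \<phi>] bounded_byD(1)[OF P_bounded[OF t \<phi>]]
  have i: "integrable (law s \<Otimes>\<^sub>M law t) (\<lambda>(y, z). \<phi> (x - y - z))"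
    by (intro st.integrable_const_bound[of _ C] AE_I2) (auto simp: bounded_byD(2)[OF \<phi>] split: prod.splits)
  have "P (s + t) \<phi> x = (LINT y|law (s + t). \<phi> (x - y))"
    using s t by (subst P_eq_law) auto
  also have "\<dots> = (LINT z|(law s \<Otimes>\<^sub>M law t). \<phi> (x - (fst z + snd z)))"
    unfolding law_add[OF s t] by (subst integral_distr) (auto simp: case_prod_beta)
  also have "\<dots> = (LINT z|(law s \<Otimes>\<^sub>M law t). (case z of (y, z) \<Rightarrow> \<phi> (x - y - z)))"
    by (intro Bochner_Integration.integral_cong refl) (simp add: case_prod_beta diff_diff_eq)
  also have "\<dots> = (LINT y|law s. LINT z|law t. \<phi> (x - y - z))"
    using st.integral_fst'[OF i] by simp
  also have "\<dots> = P s (P t \<phi>) x"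
    unfolding P_eq_law[OF s bounded_byD(1)[OF P_bounded[OF t \<phi>]]]
    by (intro Bochner_Integration.integral_cong refl P_eq_law[OF t bounded_byD(1)[OF \<phi>], symmetric])
  finally show "P (s + t) \<phi> x = P s (P t \<phi>) x" .
qed

text \<open>
  Each coordinate of \<open>law h\<close> has a characteristic function tending to 1, so by Levy's continuity
  theorem it converges weakly to the point mass at 0; a union bound over the coordinates finishes.
\<close>
lemma law_concentrates:
  assumes \<epsilon>: "\<epsilon> > 0"
  shows "((\<lambda>h. measure (law h) {y. \<epsilon> \<le> norm y}) \<longlongrightarrow> 0) (at_right 0)"
proof -
  have [measurable]: "(\<lambda>x::real^'d. x$k) \<in> borel_measurable borel" for k
    by (intro borel_measurable_continuous_onI continuous_intros)
  \<comment> \<open>If all coordinates are below \<open>e\<close>, the norm is at most \<open>\<epsilon> / 2\<close>.\<close>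
  define e where "e = \<epsilon> / (2 * CARD('d))"
  have e: "e > 0" using \<epsilon> by (simp add: e_def)
  have coord: "((\<lambda>h. measure (law h) {y. e \<le> \<bar>y$k\<bar>}) \<longlongrightarrow> 0) (at_right 0)" for k
  proof (unfold tendsto_at_iff_sequentially, intro allI impI)
    fix X :: "nat \<Rightarrow> real" assume X: "\<forall>i. X i \<in> {0<..} - {0}" "X \<longlonglongrightarrow> 0"
    define D where "D n = distr (law (X n)) borel (\<lambda>x. x$k)" for n
    have X0: "X n > 0" for n using X by auto
    have D: "real_distribution (D n)" for n
    proof -
      interpret prob_space "law (X n)" using X0 by (rule prob_law)
      show ?thesis unfolding D_def by (intro real_distribution_distr) simp
    qed
    have 0: "real_distribution (return borel (0::real))"
      by (auto simp: real_distribution_def real_distribution_axioms_def prob_space_return)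
    have "weak_conv_m D (return borel 0)"
    proof (rule levy_continuity[OF D 0])
      fix \<tau>
      have "char (D n) \<tau> = exp (- of_real (X n) * \<psi> (- axis k \<tau>))" for n
        unfolding char_law[OF X0, symmetric] char_def D_def
        by (subst integral_distr) (auto simp: inner_axis')
      moreover have "(\<lambda>n. exp (- of_real (X n) * \<psi> (- axis k \<tau>))) \<longlonglongrightarrow> exp (- of_real 0 * \<psi> (- axis k \<tau>))"
        by (intro tendsto_intros X)
      moreover have "char (return borel 0) \<tau> = 1" by (simp add: char_def integral_return)
      ultimately show "(\<lambda>n. char (D n) \<tau>) \<longlonglongrightarrow> char (return borel 0) \<tau>" by simp
    qed
    then have "(\<lambda>n. measure (D n) {x. e \<le> \<bar>x\<bar>}) \<longlonglongrightarrow> measure (return borel 0) {x. e \<le> \<bar>x\<bar>}"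
    proof (rule weak_conv_imp_continuity_set_conv[OF D 0])
      have "frontier {x::real. e \<le> \<bar>x\<bar>} \<subseteq> {x. e \<le> \<bar>x\<bar>}"
        by (intro frontier_subset_closed closed_Collect_le continuous_intros)
      then have "0 \<notin> frontier {x::real. e \<le> \<bar>x\<bar>}" using e by auto
      then show "emeasure (return borel 0) (frontier {x::real. e \<le> \<bar>x\<bar>}) = 0"
        by (subst emeasure_return) (auto simp: indicator_def frontier_def)
    qed measurable
    moreover have "measure (D n) {x. e \<le> \<bar>x\<bar>} = measure (law (X n)) {y. e \<le> \<bar>y$k\<bar>}" for n
      unfolding D_def by (subst measure_distr) (auto simp: vimage_def)
    moreover have "measure (return borel (0::real)) {x. e \<le> \<bar>x\<bar>} = 0"
      using e by (subst measure_return) (auto simp: indicator_def)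
    ultimately show "((\<lambda>h. measure (law h) {y. e \<le> \<bar>y$k\<bar>}) \<circ> X) \<longlonglongrightarrow> 0"
      by (simp add: o_def)
  qed
  have "((\<lambda>h. \<Sum>k\<in>(UNIV::'d set). measure (law h) {y. e \<le> \<bar>y$k\<bar>}) \<longlongrightarrow> (\<Sum>k\<in>(UNIV::'d set). 0)) (at_right 0)"
    by (intro tendsto_sum coord)
  moreover have "\<forall>\<^sub>F h in at_right 0. norm (measure (law h) {y. \<epsilon> \<le> norm y}) \<le> (\<Sum>k\<in>(UNIV::'d set). measure (law h) {y. e \<le> \<bar>y$k\<bar>})"
    unfolding eventually_at_right_field
  proof (intro exI[of _ 1] conjI allI impI)
    fix h :: real assume h: "0 < h"
    interpret prob_space "law h" using h by (rule prob_law)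
    have "{y. \<epsilon> \<le> norm y} \<subseteq> (\<Union>k. {y::real^'d. e \<le> \<bar>y$k\<bar>})"
    proof (rule subsetI, rule ccontr)
      fix y :: "real^'d"
      assume y: "y \<in> {y. \<epsilon> \<le> norm y}" "y \<notin> (\<Union>k. {y. e \<le> \<bar>y$k\<bar>})"
      have ye: "\<bar>y$k\<bar> < e" for k
      proof (rule ccontr)
        assume "\<not> \<bar>y$k\<bar> < e"
        then have "y \<in> {y. e \<le> \<bar>y$k\<bar>}" by simp
        with y(2) show False by blast
      qed
      have "norm y \<le> (\<Sum>k\<in>UNIV. \<bar>y$k\<bar>)" by (rule norm_le_l1_cart)
      also have "\<dots> \<le> (\<Sum>k\<in>(UNIV::'d set). e)" by (intro sum_mono less_imp_le ye)
      also have "\<dots> < \<epsilon>" using \<epsilon> by (simp add: e_def)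
      finally show False using y(1) by simp
    qed
    then have "measure (law h) {y. \<epsilon> \<le> norm y} \<le> measure (law h) (\<Union>k. {y. e \<le> \<bar>y$k\<bar>})"
    proof (rule finite_measure_mono)
      show "(\<Union>k. {y. e \<le> \<bar>y$k\<bar>}) \<in> events" by measurable
    qed
    also have "\<dots> \<le> (\<Sum>k\<in>(UNIV::'d set). measure (law h) {y. e \<le> \<bar>y$k\<bar>})"
    proof (rule finite_measure_subadditive_finite)
      show "range (\<lambda>k. {y::real^'d. e \<le> \<bar>y$k\<bar>}) \<subseteq> events"
        by (rule image_subsetI) measurable
    qed simp
    finally show "norm (measure (law h) {y. \<epsilon> \<le> norm y}) \<le> (\<Sum>k\<in>(UNIV::'d set). measure (law h) {y. e \<le> \<bar>y$k\<bar>})" by simp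
  qed simp
  ultimately show ?thesis
    unfolding sum.neutral_const by (rule Lim_null_comparison[rotated])
qed

end

section \<open>Gradient of the semigroup\<close>

context smoothing_kernel
begin

definition l1_shift :: "real \<Rightarrow> real^'d \<Rightarrow> real" where
  "l1_shift t k = (LINT z|lborel. norm (grad (p t) (z + k) - grad (p t) z))"

lemma grad_measurable: "t > 0 \<Longrightarrow> grad (p t) \<in> borel_measurable borel"
  by (intro borel_measurable_continuous_onI p_grad_cont)

lemma p_has_derivative: "t > 0 \<Longrightarrow> (p t has_derivative (\<lambda>h. grad (p t) x \<bullet> h)) (at x)"
  by (intro has_derivative_grad p_diff)

lemma grad_integrable:
  assumes "0 < t" "t \<le> Tm"
  shows "integrable lborel (grad (p t))"
  using p_grad_int[OF assms] grad_measurable[OF assms(1)]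
  by (intro integrableI_bounded) (auto simp: order.strict_trans1)

lemma grad_l1:
  assumes "0 < t" "t \<le> Tm"
  shows "(LINT y|lborel. norm (grad (p t) y)) \<le> c0 * t powr (- a)"
  using p_grad_int[OF assms] c0 grad_integrable[OF assms]
  by (subst (asm) nn_integral_eq_integral) (auto simp: ennreal_le_iff)

lemma grad_shift_integrable:
  assumes "0 < t" "t \<le> Tm"
  shows "integrable lborel (\<lambda>z. grad (p t) (z + k))"
proof -
  note [measurable] = grad_measurable[OF assms(1)]
  have "integrable (distr lborel borel ((+) k)) (grad (p t))"
    using grad_integrable[OF assms] by (simp add: lborel_distr_plus)
  then show ?thesis
    by (subst (asm) integrable_distr_eq) (auto simp: add.commute)
qed

lemma grad_shift_l1:
  assumes "0 < t" "t \<le> Tm"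
  shows "(\<integral>\<^sup>+z. ennreal (norm (grad (p t) (z + k) - grad (p t) z)) \<partial>lborel) = ennreal (l1_shift t k)"
  unfolding l1_shift_def
  using grad_shift_integrable[OF assms, of k] grad_integrable[OF assms]
  by (intro nn_integral_eq_integral) auto

text \<open>
  Translates of \<open>Dp\<^sub>t\<close> converge pointwise and have the same \<open>L\<^sup>1\<close> norm, so Scheffe's lemma applies.
\<close>
lemma l1_shift_tendsto_0:
  assumes t: "0 < t" "t \<le> Tm"
  shows "(l1_shift t \<longlongrightarrow> 0) (at 0)"
proof (unfold tendsto_at_iff_sequentially, intro allI impI)
  fix X :: "nat \<Rightarrow> real^'d" assume X: "\<forall>i. X i \<in> UNIV - {0}" "X \<longlonglongrightarrow> 0"
  note [measurable] = grad_measurable[OF t(1)]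
  have "(\<lambda>n. \<integral>\<^sup>+z. ennreal (norm (grad (p t) (z + X n) - grad (p t) z)) \<partial>lborel) \<longlonglongrightarrow> 0"
  proof (rule Scheffe_lemma2)
    show "integrable lborel (grad (p t))" by (rule grad_integrable[OF t])
    show "AE z in lborel. (\<lambda>n. grad (p t) (z + X n)) \<longlonglongrightarrow> grad (p t) z"
    proof (rule AE_I2)
      fix z
      have "isCont (grad (p t)) z" using p_grad_cont[OF t(1)] by (simp add: continuous_on_eq_continuous_at)
      moreover have "(\<lambda>n. z + X n) \<longlonglongrightarrow> z" using tendsto_add[OF tendsto_const X(2), of z] by simp
      ultimately show "(\<lambda>n. grad (p t) (z + X n)) \<longlonglongrightarrow> grad (p t) z"
        by (rule isCont_tendsto_compose)
    qed
    fix n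
    have "(\<integral>\<^sup>+z. ennreal (norm (grad (p t) (X n + z))) \<partial>lborel) = (\<integral>\<^sup>+z. ennreal (norm (grad (p t) z)) \<partial>lborel)"
      by (rule nn_integral_lborel_translate) measurable
    then show "(\<integral>\<^sup>+z. ennreal (norm (grad (p t) (z + X n))) \<partial>lborel) \<le> (\<integral>\<^sup>+z. ennreal (norm (grad (p t) z)) \<partial>lborel)"
      by (simp add: add.commute)
  qed measurable
  then have "(\<lambda>n. ennreal (l1_shift t (X n))) \<longlonglongrightarrow> ennreal 0"
    unfolding grad_shift_l1[OF t] by simp
  then show "(l1_shift t \<circ> X) \<longlonglongrightarrow> 0"
    by (subst (asm) tendsto_ennreal_iff) (auto simp: o_def l1_shift_def)
qed

text \<open>
  Differentiability of the kernel in \<open>L\<^sup>1\<close>: the first-order error at \<open>z\<close> is the integral over the segment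
  from \<open>z\<close> to \<open>z + h\<close> of the increment of the gradient, and Tonelli exchanges the two integrals.
\<close>
lemma first_order_l1:
  assumes t: "0 < t" "t \<le> Tm" and \<epsilon>: "0 < \<epsilon>"
  shows "\<exists>d>0. \<forall>h. norm h < d \<longrightarrow>
    (\<integral>\<^sup>+z. ennreal \<bar>p t (z + h) - p t z - grad (p t) z \<bullet> h\<bar> \<partial>lborel) \<le> ennreal (\<epsilon> * norm h)"
proof -
  note [measurable] = grad_measurable[OF t(1)] p_meas[OF t(1)]
  have "\<forall>\<^sub>F k in at 0. l1_shift t k < \<epsilon>"
    using l1_shift_tendsto_0[OF t] \<epsilon> by (rule order_tendstoD)
  then obtain d where d: "d > 0" "\<And>k. k \<noteq> 0 \<Longrightarrow> norm k < d \<Longrightarrow> l1_shift t k < \<epsilon>"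
    by (auto simp: eventually_at dist_norm)
  have d': "l1_shift t k \<le> \<epsilon>" if "norm k < d" for k
    using less_imp_le[OF d(2)[of k]] that \<epsilon> by (cases "k = 0") (auto simp: l1_shift_def)
  have "(\<integral>\<^sup>+z. ennreal \<bar>p t (z + h) - p t z - grad (p t) z \<bullet> h\<bar> \<partial>lborel) \<le> ennreal (\<epsilon> * norm h)" if h: "norm h < d" for h
  proof -
    define w where "w z \<tau> = norm (grad (p t) (z + \<tau> *\<^sub>R h) - grad (p t) z)" for z and \<tau> :: real
    have pt: "ennreal \<bar>p t (z + h) - p t z - grad (p t) z \<bullet> h\<bar> \<le> (\<integral>\<^sup>+\<tau>. ennreal (w z \<tau> * norm h) * indicator {0..1} \<tau> \<partial>lborel)" for z
    proof -
      let ?f = "\<lambda>\<tau>. (grad (p t) (z + \<tau> *\<^sub>R h) - grad (p t) z) \<bullet> h"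
      have cg: "continuous_on A (\<lambda>\<tau>. grad (p t) (z + \<tau> *\<^sub>R h))" for A
        by (rule continuous_on_compose2[OF p_grad_cont[OF t(1)]]) (auto intro!: continuous_intros)
      then have c: "continuous_on {0..1} ?f" by (intro continuous_intros)
      have hd: "((\<lambda>\<tau>. p t (z + \<tau> *\<^sub>R h) - \<tau> * (grad (p t) z \<bullet> h)) has_vector_derivative ?f \<tau>) (at \<tau> within {0..1})" for \<tau>
      proof -
        have 1: "((\<lambda>\<tau>. z + \<tau> *\<^sub>R h) has_derivative (\<lambda>s. s *\<^sub>R h)) (at \<tau> within {0..1})"
          by (auto intro!: derivative_eq_intros)
        have "((\<lambda>\<tau>. p t (z + \<tau> *\<^sub>R h)) has_derivative (\<lambda>s. grad (p t) (z + \<tau> *\<^sub>R h) \<bullet> (s *\<^sub>R h))) (at \<tau> within {0..1})"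
          using has_derivative_compose[OF 1 p_has_derivative[OF t(1)]] .
        then have "((\<lambda>\<tau>. p t (z + \<tau> *\<^sub>R h) - \<tau> * (grad (p t) z \<bullet> h)) has_derivative (\<lambda>s. grad (p t) (z + \<tau> *\<^sub>R h) \<bullet> (s *\<^sub>R h) - s * (grad (p t) z \<bullet> h))) (at \<tau> within {0..1})"
          by (intro derivative_intros)
        then show ?thesis by (simp add: has_vector_derivative_def inner_diff_left algebra_simps)
      qed
      have int: "integrable lborel (\<lambda>\<tau>. indicator {0..1} \<tau> *\<^sub>R ?f \<tau>)"
        using borel_integrable_atLeastAtMost'[OF c] by (simp add: set_integrable_def)
      have "p t (z + h) - p t z - grad (p t) z \<bullet> h = (LBINT \<tau>. indicator {0..1} \<tau> *\<^sub>R ?f \<tau>)"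
        using integral_FTC_atLeastAtMost[of 0 1, OF _ hd c] by simp
      then have "ennreal \<bar>p t (z + h) - p t z - grad (p t) z \<bullet> h\<bar> \<le> (\<integral>\<^sup>+\<tau>. ennreal (norm (indicator {0..1} \<tau> *\<^sub>R ?f \<tau>)) \<partial>lborel)"
        using integral_norm_bound_ennreal[OF int] by simp
      also have "\<dots> \<le> (\<integral>\<^sup>+\<tau>. ennreal (w z \<tau> * norm h) * indicator {0..1} \<tau> \<partial>lborel)"
        by (intro nn_integral_mono) (auto simp: w_def indicator_def intro!: ennreal_leI Cauchy_Schwarz_ineq2)
      finally show ?thesis .
    qed
    have "(\<integral>\<^sup>+z. ennreal \<bar>p t (z + h) - p t z - grad (p t) z \<bullet> h\<bar> \<partial>lborel) \<le> 
        (\<integral>\<^sup>+z. \<integral>\<^sup>+\<tau>. ennreal (w z \<tau> * norm h) * indicator {0..1} \<tau> \<partial>lborel \<partial>lborel)"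
      by (intro nn_integral_mono pt)
    also have "\<dots> = (\<integral>\<^sup>+\<tau>. \<integral>\<^sup>+z. ennreal (w z \<tau> * norm h) * indicator {0..1} \<tau> \<partial>lborel \<partial>lborel)"
      unfolding w_def by (intro lborel_pair.Fubini') measurable
    also have "\<dots> = (\<integral>\<^sup>+\<tau>. ennreal (l1_shift t (\<tau> *\<^sub>R h)) * ennreal (norm h) * indicator {0..1} \<tau> \<partial>lborel)"
    proof (intro nn_integral_cong)
      fix \<tau> :: real
      have "(\<integral>\<^sup>+z. ennreal (w z \<tau> * norm h) * indicator {0..1} \<tau> \<partial>lborel) =
        (\<integral>\<^sup>+z. ennreal (w z \<tau>) * (ennreal (norm h) * indicator {0..1} \<tau>) \<partial>lborel)"
        by (simp add: w_def ennreal_mult mult.assoc)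
      also have "\<dots> = (\<integral>\<^sup>+z. ennreal (w z \<tau>) \<partial>lborel) * (ennreal (norm h) * indicator {0..1} \<tau>)"
        unfolding w_def by (intro nn_integral_multc) measurable
      also have "(\<integral>\<^sup>+z. ennreal (w z \<tau>) \<partial>lborel) = ennreal (l1_shift t (\<tau> *\<^sub>R h))"
        unfolding w_def by (rule grad_shift_l1[OF t])
      finally show "(\<integral>\<^sup>+z. ennreal (w z \<tau> * norm h) * indicator {0..1} \<tau> \<partial>lborel) = ennreal (l1_shift t (\<tau> *\<^sub>R h)) * ennreal (norm h) * indicator {0..1} \<tau>"
        by (simp add: mult.assoc)
    qed
    also have "\<dots> \<le> (\<integral>\<^sup>+\<tau>. ennreal \<epsilon> * ennreal (norm h) * indicator {0..1::real} \<tau> \<partial>lborel)"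
    proof (intro nn_integral_mono)
      fix \<tau> :: real
      have "l1_shift t (\<tau> *\<^sub>R h) \<le> \<epsilon>" if "\<tau> \<in> {0..1}"
      proof (rule d')
        have "norm (\<tau> *\<^sub>R h) \<le> 1 * norm h" using mult_right_mono[of \<tau> 1 "norm h"] that by simp
        then show "norm (\<tau> *\<^sub>R h) < d" using h by simp
      qed
      then show "ennreal (l1_shift t (\<tau> *\<^sub>R h)) * ennreal (norm h) * indicator {0..1} \<tau> \<le> ennreal \<epsilon> * ennreal (norm h) * indicator {0..1::real} \<tau>"
        by (auto simp: indicator_def intro!: mult_right_mono ennreal_leI)
    qed
    also have "\<dots> = ennreal (\<epsilon> * norm h)"
      using \<epsilon> by (subst nn_integral_cmult_indicator) (auto simp: ennreal_mult)
    finally show ?thesis .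
  qed
  then show ?thesis using d(1) by blast
qed

lemma G_integrable:
  assumes t: "0 < t" "t \<le> Tm" and \<phi>: "bounded_by C \<phi>"
  shows "integrable lborel (\<lambda>y. \<phi> y *\<^sub>R grad (p t) (x - y))" 
    "integrable lborel (\<lambda>y. \<phi> (x - y) *\<^sub>R grad (p t) y)"
    "G t \<phi> x = (LINT y|lborel. \<phi> (x - y) *\<^sub>R grad (p t) y)"
proof -
  note [measurable] = grad_measurable[OF t(1)] bounded_byD(1)[OF \<phi>]
  show i: "integrable lborel (\<lambda>y. \<phi> (x - y) *\<^sub>R grad (p t) y)"
  proof (rule Bochner_Integration.integrable_bound)
    show "integrable lborel (\<lambda>y. C *\<^sub>R grad (p t) y)" using grad_integrable[OF t] by simp
    show "AE y in lborel. norm (\<phi> (x - y) *\<^sub>R grad (p t) y) \<le> norm (C *\<^sub>R grad (p t) y)"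
      using bounded_byD(2,3)[OF \<phi>] by (intro AE_I2) (auto intro!: mult_right_mono)
  qed measurable
  have "integrable (distr lborel borel (\<lambda>y. x - y)) (\<lambda>y. \<phi> (x - y) *\<^sub>R grad (p t) y)"
    using i by (simp only: lborel_distr_reflect)
  then show "integrable lborel (\<lambda>y. \<phi> y *\<^sub>R grad (p t) (x - y))"
    by (subst (asm) integrable_distr_eq) auto
  show "G t \<phi> x = (LINT y|lborel. \<phi> (x - y) *\<^sub>R grad (p t) y)"
    unfolding G_def by (subst integral_lborel_reflect[of _ x, symmetric]) auto
qed

lemma G_bound:
  assumes t: "0 < t" "t \<le> Tm" and \<phi>: "bounded_by C \<phi>"
  shows "norm (G t \<phi> x) \<le> C * (c0 * t powr (- a))"
proof -
  have "norm (G t \<phi> x) \<le> (LINT y|lborel. norm (\<phi> (x - y) *\<^sub>R grad (p t) y))"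
    unfolding G_integrable(3)[OF t \<phi>] by (rule integral_norm_bound)
  also have "\<dots> \<le> (LINT y|lborel. C * norm (grad (p t) y))"
    using grad_integrable[OF t] bounded_byD(2,3)[OF \<phi>]
    by (intro integral_mono integrable_norm G_integrable(2)[OF t \<phi>]) (auto intro!: mult_right_mono)
  also have "\<dots> = C * (LINT y|lborel. norm (grad (p t) y))" by simp
  also have "\<dots> \<le> C * (c0 * t powr (- a))"
    by (intro mult_left_mono grad_l1[OF t] bounded_byD[OF \<phi>])
  finally show ?thesis .
qed

lemma G_continuous:
  assumes t: "0 < t" "t \<le> Tm" and \<phi>: "bounded_by C \<phi>"
  shows "continuous_on UNIV (G t \<phi>)"
proof -
  note [measurable] = grad_measurable[OF t(1)] bounded_byD(1)[OF \<phi>]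
  have le: "norm (G t \<phi> (x + h) - G t \<phi> x) \<le> C * l1_shift t h" for x h
  proof -
    have i: "integrable lborel (\<lambda>y. grad (p t) ((x - y) + h) - grad (p t) (x - y))" 
    proof -
      have "integrable (distr lborel borel (\<lambda>y. x - y)) (\<lambda>y. grad (p t) (y + h) - grad (p t) y)"
        unfolding lborel_distr_reflect using grad_shift_integrable[OF t] grad_integrable[OF t] by auto
      then show ?thesis by (subst (asm) integrable_distr_eq) auto
    qed
    have "G t \<phi> (x + h) - G t \<phi> x = (LINT y|lborel. \<phi> y *\<^sub>R (grad (p t) ((x - y) + h) - grad (p t) (x - y)))"
      unfolding G_def using G_integrable(1)[OF t \<phi>, of "x + h"] G_integrable(1)[OF t \<phi>, of x]
      by (subst Bochner_Integration.integral_diff[symmetric]) (auto simp: scaleR_diff_right algebra_simps)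
    also have "norm \<dots> \<le> (LINT y|lborel. C * norm (grad (p t) ((x - y) + h) - grad (p t) (x - y)))"
    proof (rule order_trans[OF integral_norm_bound integral_mono[OF integrable_norm]])
      show "integrable lborel (\<lambda>y. \<phi> y *\<^sub>R (grad (p t) ((x - y) + h) - grad (p t) (x - y)))"
        using G_integrable(1)[OF t \<phi>, of "x + h"] G_integrable(1)[OF t \<phi>, of x]
        by (simp add: scaleR_diff_right algebra_simps)
      show "integrable lborel (\<lambda>y. C * norm (grad (p t) ((x - y) + h) - grad (p t) (x - y)))"
        using i by simp
    qed (use bounded_byD(2,3)[OF \<phi>] in \<open>auto intro!: mult_right_mono\<close>)
    also have "\<dots> = C * (LINT y|lborel. norm (grad (p t) ((x - y) + h) - grad (p t) (x - y)))" by simp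
    also have "(LINT y|lborel. norm (grad (p t) ((x - y) + h) - grad (p t) (x - y))) = l1_shift t h"
      unfolding l1_shift_def by (rule integral_lborel_reflect) measurable
    finally show ?thesis .
  qed
  show ?thesis
  proof (intro continuous_at_imp_continuous_on ballI)
    fix x
    have "((\<lambda>h. G t \<phi> (x + h) - G t \<phi> x) \<longlongrightarrow> 0) (at 0)"
    proof (rule tendsto_0_le)
      show "((\<lambda>h. C * l1_shift t h) \<longlongrightarrow> 0) (at 0)"
        by (intro tendsto_mult_right_zero l1_shift_tendsto_0[OF t])
      show "\<forall>\<^sub>F h in at 0. norm (G t \<phi> (x + h) - G t \<phi> x) \<le> norm (C * l1_shift t h) * 1"
        using le by (intro always_eventually) (auto intro: order_trans[OF _ abs_ge_self])
    qed
    then have "((\<lambda>h. G t \<phi> (x + h)) \<longlongrightarrow> G t \<phi> x) (at 0)" by (simp add: LIM_zero_iff)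
    then show "isCont (G t \<phi>) x" by (simp add: isCont_iff)
  qed
qed

lemma P_has_derivative:
  assumes t: "0 < t" "t \<le> Tm" and \<phi>: "bounded_by C \<phi>"
  shows "(P t \<phi> has_derivative (\<lambda>h. G t \<phi> x \<bullet> h)) (at x)"
  unfolding has_derivative_at_alt
proof (intro conjI allI impI)
  show "bounded_linear (\<lambda>h. G t \<phi> x \<bullet> h)" by (rule bounded_linear_inner_right)
  note [measurable] = grad_measurable[OF t(1)] bounded_byD(1)[OF \<phi>] p_meas[OF t(1)]
  have C0: "0 \<le> C" by (rule bounded_byD(3)[OF \<phi>])
  fix e :: real assume e: "0 < e"
  define \<epsilon> where "\<epsilon> = e / (C + 1)"
  have \<epsilon>: "\<epsilon> > 0" using e C0 by (simp add: \<epsilon>_def)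
  obtain d where d: "d > 0" and dle: "\<And>h. norm h < d \<Longrightarrow>
    (\<integral>\<^sup>+z. ennreal \<bar>p t (z + h) - p t z - grad (p t) z \<bullet> h\<bar> \<partial>lborel) \<le> ennreal (\<epsilon> * norm h)"
    using first_order_l1[OF t \<epsilon>] by blast
  have Pi: "integrable lborel (\<lambda>y. p t (x - y) * \<phi> y)" for x
  proof -
    have "integrable lborel (\<lambda>y. p t y *\<^sub>R \<phi> (x - y))"
      using bounded_integrable_law(1)[OF t(1) \<phi>, of x] unfolding law_def
      by (subst (asm) integrable_density) (auto simp: p_nonneg t)
    then have "integrable (distr lborel borel (\<lambda>y. x - y)) (\<lambda>y. p t y *\<^sub>R \<phi> (x - y))"
      by (simp only: lborel_distr_reflect)
    then show ?thesis by (subst (asm) integrable_distr_eq) auto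
  qed
  have "norm (P t \<phi> y - P t \<phi> x - G t \<phi> x \<bullet> (y - x)) \<le> e * norm (y - x)" if y: "norm (y - x) < d" for y
  proof -
    define h where "h = y - x"
    define R where "R z = p t (z + h) - p t z - grad (p t) z \<bullet> h" for z
    have [measurable]: "R \<in> borel_measurable borel" unfolding R_def by measurable
    have gi: "integrable lborel (\<lambda>z. \<phi> z * (grad (p t) (x - z) \<bullet> h))" "G t \<phi> x \<bullet> h = (LINT z|lborel. \<phi> z * (grad (p t) (x - z) \<bullet> h))"
      using integrable_inner_left[of h, OF G_integrable(1)[OF t \<phi>, of x]] integral_inner_left[of h, OF G_integrable(1)[OF t \<phi>, of x]]
      unfolding G_def by auto
    have "P t \<phi> (x + h) - P t \<phi> x - G t \<phi> x \<bullet> h =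
      (LINT z|lborel. p t (x + h - z) * \<phi> z - p t (x - z) * \<phi> z - \<phi> z * (grad (p t) (x - z) \<bullet> h))"
      unfolding semigroup_of_def gi(2) using Pi gi(1) by simp
    also have "\<dots> = (LINT z|lborel. \<phi> z * R (x - z))"
      by (intro Bochner_Integration.integral_cong) (auto simp: R_def algebra_simps)
    finally have eq: "P t \<phi> (x + h) - P t \<phi> x - G t \<phi> x \<bullet> h = (LINT z|lborel. \<phi> z * R (x - z))" .
    have int: "integrable lborel (\<lambda>z. \<phi> z * R (x - z))"
    proof -
      have "integrable lborel (\<lambda>z. p t (x + h - z) * \<phi> z - p t (x - z) * \<phi> z - \<phi> z * (grad (p t) (x - z) \<bullet> h))"
        using Pi gi(1) by simp
      then show ?thesis by (rule Bochner_Integration.integrable_cong[THEN iffD1, rotated -1]) (auto simp: R_def algebra_simps)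
    qed
    have "ennreal (norm (P t \<phi> (x + h) - P t \<phi> x - G t \<phi> x \<bullet> h)) \<le> (\<integral>\<^sup>+z. ennreal (norm (\<phi> z * R (x - z))) \<partial>lborel)"
      unfolding eq by (rule integral_norm_bound_ennreal[OF int])
    also have "\<dots> \<le> (\<integral>\<^sup>+z. ennreal C * ennreal \<bar>R (x - z)\<bar> \<partial>lborel)"
      using bounded_byD(2,3)[OF \<phi>] by (intro nn_integral_mono) (auto simp: abs_mult ennreal_mult[symmetric] intro!: ennreal_leI mult_right_mono)
    also have "\<dots> = (\<integral>\<^sup>+z. ennreal C * ennreal \<bar>R z\<bar> \<partial>distr lborel borel (\<lambda>z. x - z))"
      by (subst nn_integral_distr) auto
    also have "\<dots> = ennreal C * (\<integral>\<^sup>+z. ennreal \<bar>R z\<bar> \<partial>lborel)"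
      unfolding lborel_distr_reflect by (intro nn_integral_cmult) measurable
    also have "\<dots> \<le> ennreal C * ennreal (\<epsilon> * norm h)"
      unfolding R_def using y by (intro mult_left_mono dle) (auto simp: h_def)
    also have "\<dots> = ennreal (C * (\<epsilon> * norm h))" using C0 \<epsilon> by (simp add: ennreal_mult)
    finally have "norm (P t \<phi> (x + h) - P t \<phi> x - G t \<phi> x \<bullet> h) \<le> C * (\<epsilon> * norm h)"
      using C0 \<epsilon> by (subst (asm) ennreal_le_iff) auto
    also have "\<dots> \<le> e * norm h"
    proof -
      have "C * \<epsilon> \<le> e" using C0 e by (simp add: \<epsilon>_def field_simps)
      from mult_right_mono[OF this norm_ge_zero, of h] show ?thesis by (simp add: mult.assoc)
    qed
    finally show ?thesis by (simp add: h_def)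
  qed
  then show "\<exists>d>0. \<forall>y. norm (y - x) < d \<longrightarrow> norm (P t \<phi> y - P t \<phi> x - G t \<phi> x \<bullet> (y - x)) \<le> e * norm (y - x)"
    using d by blast
qed

end

section \<open>Continuity in time and initial data of Hoelder class\<close>

text \<open>Differentiate along the direction of the gradient itself.\<close>
lemma norm_gradient_le_Lipschitz:
  fixes f :: "real^'d::finite \<Rightarrow> real"
  assumes d: "(f has_derivative (\<lambda>h. g \<bullet> h)) (at x)" and K: "\<And>y. \<bar>f y - f x\<bar> \<le> K * norm (y - x)"
  shows "norm g \<le> K"
proof (cases "g = 0")
  case True
  have "0 \<le> \<bar>f (x + axis undefined 1) - f x\<bar>" by simp
  also have "\<dots> \<le> K" using K[of "x + axis undefined 1"] by simp
  finally show ?thesis using True by simp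
next
  case False
  have "((\<lambda>\<tau>. x + \<tau> *\<^sub>R g) has_derivative (\<lambda>\<tau>. \<tau> *\<^sub>R g)) (at 0)"
    by (auto intro!: derivative_eq_intros)
  from has_derivative_compose[OF this, of f "\<lambda>h. g \<bullet> h"] d
  have "((\<lambda>\<tau>. f (x + \<tau> *\<^sub>R g)) has_derivative (\<lambda>\<tau>. g \<bullet> (\<tau> *\<^sub>R g))) (at 0)" by simp
  then have "((\<lambda>\<tau>. f (x + \<tau> *\<^sub>R g)) has_real_derivative (g \<bullet> g)) (at 0)"
    by (rule has_derivative_imp_has_field_derivative) simp
  then have "((\<lambda>h. (f (x + h *\<^sub>R g) - f x) / h) \<longlongrightarrow> g \<bullet> g) (at 0)" by (simp add: DERIV_def)
  then have "g \<bullet> g \<le> K * norm g"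
  proof (rule tendsto_upperbound)
    have "(f (x + h *\<^sub>R g) - f x) / h \<le> K * norm g" if "h \<noteq> 0" for h
    proof -
      have "(f (x + h *\<^sub>R g) - f x) / h \<le> \<bar>f (x + h *\<^sub>R g) - f x\<bar> / \<bar>h\<bar>"
        by (metis abs_divide abs_ge_self)
      also have "\<dots> \<le> (K * norm (h *\<^sub>R g)) / \<bar>h\<bar>"
        using K[of "x + h *\<^sub>R g"] by (intro divide_right_mono) auto
      also have "\<dots> = K * norm g" using that by simp
      finally show ?thesis .
    qed
    then show "\<forall>\<^sub>F h in at 0. (f (x + h *\<^sub>R g) - f x) / h \<le> K * norm g"
      by (auto simp: eventually_at intro!: exI[of _ 1])
  qed simp
  then have "norm g * norm g \<le> K * norm g" by (simp add: power2_norm_eq_inner[symmetric] power2_eq_square)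
  then show ?thesis using False by (simp add: mult_le_cancel_right)
qed

text \<open>
  Uniform continuity in operator norm of \<open>\<sigma> \<mapsto> S\<^sub>\<sigma>\<close> at times bounded away from 0; \<open>e\<close> does not depend on
  \<open>\<phi>\<close>, so that it can later be integrated against forcing terms that are merely pointwise continuous in time.
\<close>
abbreviation time_modulus ::
  "(real \<Rightarrow> (real^'d::finite \<Rightarrow> real) \<Rightarrow> real^'d \<Rightarrow> 'b::real_normed_vector) \<Rightarrow> real \<Rightarrow> real \<Rightarrow> real \<Rightarrow> real \<Rightarrow> bool" where
  "time_modulus S Tm \<eta> e d \<equiv> \<forall>\<sigma> h \<phi> C x. \<eta> \<le> \<sigma> \<longrightarrow> 0 \<le> h \<longrightarrow> h < d \<longrightarrow> \<sigma> + h \<le> Tm \<longrightarrow>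
     bounded_by C \<phi> \<longrightarrow> norm (S (\<sigma> + h) \<phi> x - S \<sigma> \<phi> x) \<le> e * C"

context smoothing_kernel
begin

lemma P_diff:
  assumes t: "0 < t" and \<phi>: "bounded_by C \<phi>" and \<phi>': "bounded_by C' \<phi>'"
  shows "P t (\<lambda>x. \<phi> x - \<phi>' x) x = P t \<phi> x - P t \<phi>' x"
  using bounded_integrable_law(1)[OF t \<phi>, of x] bounded_integrable_law(1)[OF t \<phi>', of x]
    bounded_byD(1)[OF \<phi>] bounded_byD(1)[OF \<phi>']
  by (simp add: P_eq_law t)

lemma G_diff:
  assumes t: "0 < t" "t \<le> Tm" and \<phi>: "bounded_by C \<phi>" and \<phi>': "bounded_by C' \<phi>'"
  shows "G t (\<lambda>x. \<phi> x - \<phi>' x) x = G t \<phi> x - G t \<phi>' x"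
  using G_integrable(1)[OF t \<phi>, of x] G_integrable(1)[OF t \<phi>', of x]
  by (simp add: G_def scaleR_diff_left)

lemma P_differentiable: "0 < t \<Longrightarrow> t \<le> Tm \<Longrightarrow> bounded_by C \<phi> \<Longrightarrow> P t \<phi> differentiable (at x)"
  using P_has_derivative unfolding differentiable_def by blast

lemma grad_P: "0 < t \<Longrightarrow> t \<le> Tm \<Longrightarrow> bounded_by C \<phi> \<Longrightarrow> grad (P t \<phi>) x = G t \<phi> x"
  by (intro grad_eqI P_has_derivative)

lemma P_continuous: "0 < t \<Longrightarrow> t \<le> Tm \<Longrightarrow> bounded_by C \<phi> \<Longrightarrow> continuous_on UNIV (P t \<phi>)"
  by (intro continuous_at_imp_continuous_on ballI differentiable_imp_continuous_within P_differentiable)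

lemma G_add:
  assumes s: "0 < s" and t: "0 < t" and st: "s + t \<le> Tm" and \<phi>: "bounded_by C \<phi>"
  shows "G (s + t) \<phi> x = G s (P t \<phi>) x"
proof -
  have "G (s + t) \<phi> x = grad (P (s + t) \<phi>) x" using s t st \<phi> by (intro grad_P[symmetric]) auto
  also have "\<dots> = grad (P s (P t \<phi>)) x" by (simp add: P_add[OF s t \<phi>])
  also have "\<dots> = G s (P t \<phi>) x" using s t st by (intro grad_P[OF _ _ P_bounded[OF t \<phi>]]) auto
  finally show ?thesis .
qed

lemma P_Lipschitz:
  assumes t: "0 < t" "t \<le> Tm" and \<phi>: "bounded_by C \<phi>"
  shows "\<bar>P t \<phi> y - P t \<phi> x\<bar> \<le> C * (c0 * t powr (- a)) * norm (y - x)"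
proof -
  have "norm (P t \<phi> y - P t \<phi> x) \<le> C * (c0 * t powr (- a)) * norm (y - x)"
  proof (rule differentiable_bound[OF convex_UNIV])
    show "(P t \<phi> has_derivative (\<lambda>h. G t \<phi> x \<bullet> h)) (at x within UNIV)" for x
      using P_has_derivative[OF t \<phi>] by simp
    show "onorm (\<lambda>h. G t \<phi> x \<bullet> h) \<le> C * (c0 * t powr (- a))" for x
    proof (rule onorm_le)
      fix h
      have "norm (G t \<phi> x \<bullet> h) \<le> norm (G t \<phi> x) * norm h" by (simp add: Cauchy_Schwarz_ineq2)
      also have "\<dots> \<le> C * (c0 * t powr (- a)) * norm h"
        by (intro mult_right_mono G_bound[OF t \<phi>]) simp
      finally show "norm (G t \<phi> x \<bullet> h) \<le> C * (c0 * t powr (- a)) * norm h" .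
    qed
  qed auto
  then show ?thesis by simp
qed

lemma P_Lipschitz_contraction:
  assumes t: "0 < t" and \<phi>: "bounded_by C \<phi>" and K: "\<And>x y. \<bar>\<phi> x - \<phi> y\<bar> \<le> K * norm (x - y)"
  shows "\<bar>P t \<phi> y - P t \<phi> x\<bar> \<le> K * norm (y - x)"
proof -
  interpret prob_space "law t" by (rule prob_law[OF t])
  note [measurable] = bounded_byD(1)[OF \<phi>]
  have i: "integrable (law t) (\<lambda>z. \<phi> (y - z) - \<phi> (x - z))"
    using bounded_integrable_law(1)[OF t \<phi>, of x] bounded_integrable_law(1)[OF t \<phi>, of y] by simp
  have "P t \<phi> y - P t \<phi> x = (LINT z|law t. \<phi> (y - z) - \<phi> (x - z))"
    using bounded_integrable_law(1)[OF t \<phi>, of x] bounded_integrable_law(1)[OF t \<phi>, of y] t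
    by (simp add: P_eq_law)
  also have "\<bar>\<dots>\<bar> \<le> (LINT z|law t. \<bar>\<phi> (y - z) - \<phi> (x - z)\<bar>)" by (rule integral_abs_bound)
  also have "\<dots> \<le> (LINT z|law t. K * norm (y - x))"
    using i K[of "y - z" "x - z" for z] by (intro integral_mono) auto
  finally show ?thesis by (simp add: prob_space[unfolded space_law])
qed

lemma G_bound_Lipschitz:
  assumes t: "0 < t" "t \<le> Tm" and \<phi>: "bounded_by C \<phi>" and K: "\<And>x y. \<bar>\<phi> x - \<phi> y\<bar> \<le> K * norm (x - y)"
  shows "norm (G t \<phi> x) \<le> K"
  by (rule norm_gradient_le_Lipschitz[OF P_has_derivative[OF t \<phi>]]) (rule P_Lipschitz_contraction[OF t(1) \<phi> K])

text \<open>
  Split the average over \<open>law h\<close> at distance \<open>\<epsilon>\<close>: use the Lipschitz bound inside, the sup bound outside.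
\<close>
lemma P_near_identity:
  assumes h: "0 < h" and \<phi>: "bounded_by C \<phi>" and K: "\<And>y. \<bar>\<phi> y - \<phi> x\<bar> \<le> K * norm (y - x)"
    and K0: "0 \<le> K" and \<epsilon>: "0 < \<epsilon>"
  shows "\<bar>P h \<phi> x - \<phi> x\<bar> \<le> K * \<epsilon> + 2 * C * measure (law h) {y. \<epsilon> \<le> norm y}"
proof -
  interpret prob_space "law h" by (rule prob_law[OF h])
  note [measurable] = bounded_byD(1)[OF \<phi>]
  note C0 = bounded_byD(3)[OF \<phi>]
  have i: "integrable (law h) (\<lambda>y. \<phi> (x - y) - \<phi> x)" using bounded_integrable_law(1)[OF h \<phi>, of x] by simp
  have i1: "integrable (law h) (indicator {y. \<epsilon> \<le> norm y} :: _ \<Rightarrow> real)"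
    by (rule integrable_real_indicator) (measurable, simp add: less_top[symmetric])
  have "P h \<phi> x - \<phi> x = (LINT y|law h. \<phi> (x - y) - \<phi> x)"
    using bounded_integrable_law(1)[OF h \<phi>, of x] h by (simp add: P_eq_law prob_space[unfolded space_law])
  also have "\<bar>\<dots>\<bar> \<le> (LINT y|law h. \<bar>\<phi> (x - y) - \<phi> x\<bar>)" by (rule integral_abs_bound)
  also have "\<dots> \<le> (LINT y|law h. K * \<epsilon> + 2 * C * indicator {y. \<epsilon> \<le> norm y} y)"
  proof (rule integral_mono)
    show "integrable (law h) (\<lambda>y. K * \<epsilon> + 2 * C * indicator {y. \<epsilon> \<le> norm y} y)"
      using i1 by simp
    fix y
    show "\<bar>\<phi> (x - y) - \<phi> x\<bar> \<le> K * \<epsilon> + 2 * C * indicator {y. \<epsilon> \<le> norm y} y"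
    proof (cases "\<epsilon> \<le> norm y")
      case True
      have "\<bar>\<phi> (x - y) - \<phi> x\<bar> \<le> 2 * C"
        using bounded_byD(2)[OF \<phi>, of "x - y"] bounded_byD(2)[OF \<phi>, of x] by linarith
      moreover have "0 \<le> K * \<epsilon>" using K0 \<epsilon> by simp
      ultimately show ?thesis using True by simp
    next
      case False
      have "\<bar>\<phi> (x - y) - \<phi> x\<bar> \<le> K * norm y" using K[of "x - y"] by simp
      also have "\<dots> \<le> K * \<epsilon>" using False K0 by (intro mult_left_mono) auto
      finally show ?thesis using False by simp
    qed
  qed (use i in simp)
  also have "\<dots> = K * \<epsilon> + 2 * C * measure (law h) {y. \<epsilon> \<le> norm y}"
    using i1 by (subst Bochner_Integration.integral_add) (auto simp: prob_space[unfolded space_law])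
  finally show ?thesis .
qed

text \<open>
  \<open>P\<^sub>\<sigma>\<^sub>+\<^sub>h \<phi> - P\<^sub>\<sigma> \<phi> = (P\<^sub>h - 1) (P\<^sub>\<sigma> \<phi>)\<close>, and \<open>P\<^sub>\<sigma> \<phi>\<close> is Lipschitz with a constant uniform in \<open>\<sigma> \<ge> \<eta>\<close>.
\<close>
lemma P_modulus:
  assumes \<eta>: "0 < \<eta>" and e: "0 < e"
  shows "\<exists>d>0. time_modulus P Tm \<eta> e d"
proof -
  define K where "K = c0 * \<eta> powr (- a)"
  have K: "K > 0" using c0 \<eta> by (simp add: K_def)
  \<comment> \<open>Half of the error budget goes to the region within distance \<open>\<epsilon>\<close>, the other half to the tail.\<close>
  define \<epsilon> where "\<epsilon> = e / (2 * K)"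
  have \<epsilon>: "\<epsilon> > 0" using e K by (simp add: \<epsilon>_def)
  have "\<forall>\<^sub>F h in at_right 0. measure (law h) {y. \<epsilon> \<le> norm y} < e / 4"
    using law_concentrates[OF \<epsilon>] by (rule order_tendstoD) (use e in simp)
  then obtain d where d: "d > 0" "\<And>h. 0 < h \<Longrightarrow> h < d \<Longrightarrow> measure (law h) {y. \<epsilon> \<le> norm y} < e / 4"
    by (auto simp: eventually_at_right_field)
  show ?thesis
  proof (intro exI[of _ d] conjI allI impI d(1))
    fix \<sigma> h C :: real and \<phi> :: "real^'d \<Rightarrow> real" and x
    assume \<sigma>: "\<eta> \<le> \<sigma>" and h: "0 \<le> h" "h < d" "\<sigma> + h \<le> Tm" and \<phi>: "bounded_by C \<phi>"
    note C0 = bounded_byD(3)[OF \<phi>]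
    show "norm (P (\<sigma> + h) \<phi> x - P \<sigma> \<phi> x) \<le> e * C"
    proof (cases "h = 0")
      case True then show ?thesis using e C0 by simp
    next
      case False
      then have h0: "0 < h" using h by simp
      have \<sigma>0: "0 < \<sigma>" "\<sigma> \<le> Tm" using \<sigma> \<eta> h by auto
      have "P (\<sigma> + h) \<phi> x = P h (P \<sigma> \<phi>) x" using P_add[OF h0 \<sigma>0(1) \<phi>] by (simp add: add.commute)
      moreover have "\<bar>P h (P \<sigma> \<phi>) x - P \<sigma> \<phi> x\<bar> \<le> (C * K) * \<epsilon> + 2 * C * measure (law h) {y. \<epsilon> \<le> norm y}"
      proof (rule P_near_identity[OF h0 P_bounded[OF \<sigma>0(1) \<phi>] _ _ \<epsilon>])
        show "0 \<le> C * K" using C0 K by simp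
        fix y
        have "\<sigma> powr (- a) \<le> \<eta> powr (- a)" using \<sigma> \<eta> a by (intro powr_mono2') auto
        then have "C * (c0 * \<sigma> powr (- a)) \<le> C * K" using C0 c0 unfolding K_def by (intro mult_left_mono) auto
        then show "\<bar>P \<sigma> \<phi> y - P \<sigma> \<phi> x\<bar> \<le> C * K * norm (y - x)"
          using P_Lipschitz[OF \<sigma>0 \<phi>, of y x] by (meson mult_right_mono norm_ge_zero order_trans)
      qed
      moreover have "(C * K) * \<epsilon> = e * C / 2" using K by (simp add: \<epsilon>_def)
      moreover have "2 * C * measure (law h) {y. \<epsilon> \<le> norm y} \<le> e * C / 2"
        using mult_left_mono[OF less_imp_le[OF d(2)[OF h0 h(2)]], of "2 * C"] C0 by (simp add: mult.commute[of e C])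
      ultimately show ?thesis unfolding real_norm_def by linarith
    qed
  qed
qed

text \<open>
  Half of the minimal time \<open>\<eta>\<close> is spent on the gradient, \<open>G\<^sub>\<sigma> \<phi> = G\<^sub>\<eta>\<^sub>/\<^sub>2 (P\<^sub>\<sigma>\<^sub>-\<^sub>\<eta>\<^sub>/\<^sub>2 \<phi>)\<close>; the rest is left to \<open>P_modulus\<close>.
\<close>
lemma G_modulus:
  assumes \<eta>: "0 < \<eta>" and e: "0 < e"
  shows "\<exists>d>0. time_modulus G Tm \<eta> e d"
proof -
  define K where "K = c0 * (\<eta>/2) powr (- a)"
  have K: "K > 0" using c0 \<eta> by (simp add: K_def)
  obtain d where d: "d > 0" and dP: "\<And>\<sigma> h \<phi> C x. \<eta>/2 \<le> \<sigma> \<Longrightarrow> 0 \<le> h \<Longrightarrow> h < d \<Longrightarrow> \<sigma> + h \<le> Tm \<Longrightarrow> bounded_by C \<phi> \<Longrightarrow>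
     \<bar>P (\<sigma> + h) \<phi> x - P \<sigma> \<phi> x\<bar> \<le> e / K * C"
    using P_modulus[of "\<eta>/2" "e / K"] \<eta> e K by auto
  show ?thesis
  proof (intro exI[of _ d] conjI allI impI d)
    fix \<sigma> h C :: real and \<phi> :: "real^'d \<Rightarrow> real" and x
    assume \<sigma>: "\<eta> \<le> \<sigma>" and h: "0 \<le> h" "h < d" "\<sigma> + h \<le> Tm" and \<phi>: "bounded_by C \<phi>"
    define s where "s = \<sigma> - \<eta>/2"
    have s: "\<eta>/2 \<le> s" "0 < s" "\<sigma> = \<eta>/2 + s" using \<sigma> \<eta> by (auto simp: s_def)
    have le: "\<eta>/2 \<le> Tm" using s h \<eta> by linarith
    have b: "bounded_by C (P (s + h) \<phi>)" "bounded_by C (P s \<phi>)"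
      using s(2) h(1) by (intro P_bounded[OF _ \<phi>]; simp)+
    have "G (\<sigma> + h) \<phi> x - G \<sigma> \<phi> x = G (\<eta>/2) (P (s + h) \<phi>) x - G (\<eta>/2) (P s \<phi>) x"
      using G_add[of "\<eta>/2" "s + h" C \<phi> x] G_add[of "\<eta>/2" s C \<phi> x] \<phi> s h \<eta> by (simp add: algebra_simps)
    also have "\<dots> = G (\<eta>/2) (\<lambda>y. P (s + h) \<phi> y - P s \<phi> y) x"
      by (rule G_diff[symmetric, OF _ le b]) (use \<eta> in simp)
    also have "norm \<dots> \<le> (e / K * C) * (c0 * (\<eta>/2) powr (- a))"
    proof (rule G_bound[OF _ le])
      show "bounded_by (e / K * C) (\<lambda>y. P (s + h) \<phi> y - P s \<phi> y)"
        using dP[OF s(1) h(1,2) _ \<phi>] h s \<eta> bounded_byD(1)[OF b(1)] bounded_byD(1)[OF b(2)]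
        by (auto simp: bounded_by_def)
    qed (use \<eta> in simp)
    also have "\<dots> = e * C" using K by (simp add: K_def[symmetric])
    finally show "norm (G (\<sigma> + h) \<phi> x - G \<sigma> \<phi> x) \<le> e * C" .
  qed
qed

lemma P_dominated_convergence:
  assumes t: "0 < t" and \<phi>: "\<And>n. bounded_by C (\<phi> n)" "bounded_by C \<phi>'"
    and lim: "\<And>y. (\<lambda>n. \<phi> n y) \<longlonglongrightarrow> \<phi>' y"
  shows "(\<lambda>n. P t (\<phi> n) x) \<longlonglongrightarrow> P t \<phi>' x"
proof -
  interpret prob_space "law t" by (rule prob_law[OF t])
  note [measurable] = bounded_byD(1)[OF \<phi>(1)] bounded_byD(1)[OF \<phi>(2)]
  show ?thesis
    unfolding P_eq_law[OF t bounded_byD(1)[OF \<phi>(1)]] P_eq_law[OF t bounded_byD(1)[OF \<phi>(2)]]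
    by (rule integral_dominated_convergence[where w="\<lambda>_. C"])
      (auto intro!: lim AE_I2 bounded_byD(2)[OF \<phi>(1)])
qed

lemma G_dominated_convergence:
  assumes t: "0 < t" "t \<le> Tm" and \<phi>: "\<And>n. bounded_by C (\<phi> n)" "bounded_by C \<phi>'"
    and lim: "\<And>y. (\<lambda>n. \<phi> n y) \<longlonglongrightarrow> \<phi>' y"
  shows "(\<lambda>n. G t (\<phi> n) x) \<longlonglongrightarrow> G t \<phi>' x"
proof -
  note [measurable] = bounded_byD(1)[OF \<phi>(1)] bounded_byD(1)[OF \<phi>(2)] grad_measurable[OF t(1)]
  show ?thesis
    unfolding G_integrable(3)[OF t \<phi>(1)] G_integrable(3)[OF t \<phi>(2)]
  proof (rule integral_dominated_convergence[where w="\<lambda>y. C * norm (grad (p t) y)"])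
    show "integrable lborel (\<lambda>y. C * norm (grad (p t) y))" using grad_integrable[OF t] by simp
    show "AE y in lborel. (\<lambda>n. \<phi> n (x - y) *\<^sub>R grad (p t) y) \<longlonglongrightarrow> \<phi>' (x - y) *\<^sub>R grad (p t) y"
      by (intro AE_I2 tendsto_intros lim)
    show "AE y in lborel. norm (\<phi> n (x - y) *\<^sub>R grad (p t) y) \<le> C * norm (grad (p t) y)" for n
      by (auto intro!: AE_I2 mult_right_mono bounded_byD(2)[OF \<phi>(1)])
  qed measurable
qed

end

text \<open>
  The infimal convolution of \<open>f\<close> with a cone of slope \<open>K \<epsilon> powr (\<delta> - 1)\<close>. That slope is where the cone
  overtakes the Hoelder modulus at distance \<open>\<epsilon>\<close>, so farther points cannot lower the infimum.
\<close>
lemma Hoelder_Lipschitz_approximation: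
  fixes f :: "'a::real_normed_vector \<Rightarrow> real"
  assumes H: "\<And>x y. \<bar>f x - f y\<bar> \<le> K * dist x y powr \<delta>" and K: "0 \<le> K" and \<delta>: "0 < \<delta>" "\<delta> < 1"
    and bd: "\<And>x. \<bar>f x\<bar> \<le> B" and \<epsilon>: "0 < \<epsilon>"
  obtains g where "\<And>x y. \<bar>g x - g y\<bar> \<le> K * \<epsilon> powr (\<delta> - 1) * norm (x - y)" "\<And>x. \<bar>g x\<bar> \<le> B"
    "\<And>x. \<bar>f x - g x\<bar> \<le> K * \<epsilon> powr \<delta>"
proof -
  define M where "M = K * \<epsilon> powr (\<delta> - 1)"
  have M: "0 \<le> M" using K by (simp add: M_def)
  define g where "g x = (INF y. f y + M * norm (x - y))" for x
  have bb: "bdd_below (range (\<lambda>y. f y + M * norm (x - y)))" for x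
  proof (rule bdd_belowI2)
    show "- B \<le> f y + M * norm (x - y)" for y
      using bd[of y] mult_nonneg_nonneg[OF M norm_ge_zero, of "x - y"] by linarith
  qed
  have g_le: "g x \<le> f y + M * norm (x - y)" for x y
    unfolding g_def by (rule cINF_lower[OF bb]) simp
  have le_g: "c \<le> g x" if "\<And>y. c \<le> f y + M * norm (x - y)" for c x
    unfolding g_def by (rule cINF_greatest) (auto intro: that)
  have one: "g x - g y \<le> M * norm (x - y)" for x y
  proof -
    have "g x - M * norm (x - y) \<le> g y"
    proof (rule le_g)
      fix z
      have "norm (x - z) \<le> norm (x - y) + norm (y - z)" by (rule norm_diff_triangle_ineq[of x y y z, simplified])
      from mult_left_mono[OF this M] g_le[of x z]
      show "g x - M * norm (x - y) \<le> f z + M * norm (y - z)" by (simp add: algebra_simps)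
    qed
    then show ?thesis by simp
  qed
  show thesis
  proof
    show "\<bar>g x - g y\<bar> \<le> K * \<epsilon> powr (\<delta> - 1) * norm (x - y)" for x y
      using one[of x y] one[of y x] unfolding M_def[symmetric] by (simp add: norm_minus_commute abs_le_iff)
    have gf: "g x \<le> f x" for x using g_le[of x x] by simp
    have lg: "- B \<le> g x" for x
    proof (rule le_g)
      show "- B \<le> f y + M * norm (x - y)" for y
        using bd[of y] mult_nonneg_nonneg[OF M norm_ge_zero, of "x - y"] by linarith
    qed
    show "\<bar>g x\<bar> \<le> B" for x using lg[of x] gf[of x] bd[of x] by linarith
    have "f x - K * \<epsilon> powr \<delta> \<le> g x" for x
    proof (rule le_g)
      fix y
      define r where "r = norm (x - y)"
      have "f x - f y \<le> K * r powr \<delta>" using H[of x y] by (simp add: r_def dist_norm abs_le_iff)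
      moreover have "K * r powr \<delta> \<le> K * \<epsilon> powr \<delta> + M * r"
      proof (cases "r \<le> \<epsilon>")
        case True
        then have "r powr \<delta> \<le> \<epsilon> powr \<delta>" using \<delta> by (intro powr_mono2) (auto simp: r_def)
        then have "K * r powr \<delta> \<le> K * \<epsilon> powr \<delta>" using K by (rule mult_left_mono)
        moreover have "0 \<le> M * r" using M by (simp add: r_def)
        ultimately show ?thesis by simp
      next
        case False
        then have "r powr \<delta> = r powr (\<delta> - 1) * r" using \<epsilon> by (simp add: powr_mult_base mult.commute)
        also have "\<dots> \<le> \<epsilon> powr (\<delta> - 1) * r" using False \<epsilon> \<delta> by (intro mult_right_mono powr_mono2') auto
        finally have "K * r powr \<delta> \<le> M * r" unfolding M_def using K by (simp add: mult_left_mono mult.assoc)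
        moreover have "0 \<le> K * \<epsilon> powr \<delta>" using K by simp
        ultimately show ?thesis by simp
      qed
      ultimately show "f x - K * \<epsilon> powr \<delta> \<le> f y + M * norm (x - y)" by (simp add: r_def)
    qed
    then show "\<bar>f x - g x\<bar> \<le> K * \<epsilon> powr \<delta>" for x using gf[of x] by (auto simp: abs_le_iff)
      (smt (verit) K mult_nonneg_nonneg powr_ge_zero)+
  qed
qed

lemma Cb_Hoelder_borel_bounded:
  assumes \<delta>: "0 \<le> \<delta>" and u: "u \<in> Cb_Hoelder \<delta>"
  obtains B where "bounded_by B u" "continuous_on UNIV u"
proof -
  have "bounded (range u) \<and> continuous_on UNIV u"
  proof (cases "\<delta> = 0")
    case True then show ?thesis using u by (auto simp: Cb_Hoelder_def Cb_def derivs_def)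
  next
    case False
    then obtain K where K: "\<And>x y. \<bar>u x - u y\<bar> \<le> K * dist x y powr \<delta>" and b: "bounded (range u)"
      using u by (auto simp: Cb_Hoelder_def)
    have "isCont u x" for x
    proof -
      have "((\<lambda>y. u y - u x) \<longlongrightarrow> 0) (at x)"
      proof (rule Lim_null_comparison)
        show "\<forall>\<^sub>F y in at x. norm (u y - u x) \<le> K * dist y x powr \<delta>" using K by simp
        have "((\<lambda>y. dist y x powr \<delta>) \<longlongrightarrow> 0) (at x)"
          using False \<delta> by (intro tendsto_zero_powrI[where b=\<delta>] tendsto_eq_intros) auto
        then show "((\<lambda>y. K * dist y x powr \<delta>) \<longlongrightarrow> 0) (at x)" by (rule tendsto_mult_right_zero)
      qed
      then show ?thesis by (simp add: isCont_def LIM_zero_iff)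
    qed
    then show ?thesis using b by (simp add: continuous_at_imp_continuous_on)
  qed
  then obtain B where "\<And>x. \<bar>u x\<bar> \<le> B" and c: "continuous_on UNIV u" by (auto simp: bounded_iff)
  then have "bounded_by B u" by (auto simp: bounded_by_def intro: borel_measurable_continuous_onI)
  then show thesis using c by (rule that)
qed

context smoothing_kernel
begin

text \<open>
  The semigroup preserves the Lipschitz part and smooths the small part; the choice \<open>\<epsilon> = t powr a\<close>
  makes both contributions to the gradient of the same order.
\<close>
lemma G_bound_Hoelder:
  assumes \<delta>: "0 \<le> \<delta>" "\<delta> < 1" and u: "u \<in> Cb_Hoelder \<delta>"
  obtains C where "0 \<le> C" "\<And>t x. 0 < t \<Longrightarrow> t \<le> Tm \<Longrightarrow> norm (G t u x) \<le> C * t powr (- ((1 - \<delta>) * a))"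
proof -
  obtain B where B: "bounded_by B u" using Cb_Hoelder_borel_bounded[OF \<delta>(1) u] .
  note B0 = bounded_byD(3)[OF B]
  show thesis
  proof (cases "\<delta> = 0")
    case True
    show thesis
      by (rule that[of "B * c0"]) (use G_bound[OF _ _ B] True c0 B0 in \<open>auto simp: mult.assoc\<close>)
  next
    case False
    then obtain K' where K': "\<And>x y. \<bar>u x - u y\<bar> \<le> K' * dist x y powr \<delta>"
      using u by (auto simp: Cb_Hoelder_def)
    define K where "K = max K' 0"
    have K: "\<bar>u x - u y\<bar> \<le> K * dist x y powr \<delta>" for x y
      using K'[of x y] mult_right_mono[of K' K "dist x y powr \<delta>"] by (auto simp: K_def)
    have K0: "0 \<le> K" by (simp add: K_def)
    show thesis
    proof (rule that[of "K + K * c0"])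
      show "0 \<le> K + K * c0" using K0 c0 by simp
      fix t :: real and x assume t: "0 < t" "t \<le> Tm"
      define \<epsilon> where "\<epsilon> = t powr a"
      have \<epsilon>: "\<epsilon> > 0" using t by (simp add: \<epsilon>_def)
      obtain g where g: "\<And>x y. \<bar>g x - g y\<bar> \<le> K * \<epsilon> powr (\<delta> - 1) * norm (x - y)" "\<And>x. \<bar>g x\<bar> \<le> B"
        "\<And>x. \<bar>u x - g x\<bar> \<le> K * \<epsilon> powr \<delta>"
        using Hoelder_Lipschitz_approximation[OF K K0 _ \<delta>(2) bounded_byD(2)[OF B] \<epsilon>] False \<delta>(1) by auto
      have "continuous_on UNIV g"
        by (rule lipschitz_on_continuous_on[where L="K * \<epsilon> powr (\<delta> - 1)"])
          (use g(1) K0 in \<open>auto simp: lipschitz_on_def dist_norm\<close>)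
      then have bg: "bounded_by B g" using g(2) by (auto simp: bounded_by_def intro: borel_measurable_continuous_onI)
      have bd: "bounded_by (K * \<epsilon> powr \<delta>) (\<lambda>x. u x - g x)"
        using g(3) bounded_byD(1)[OF B] bounded_byD(1)[OF bg] by (auto simp: bounded_by_def)
      have "G t u x = G t g x + G t (\<lambda>x. u x - g x) x" using G_diff[OF t B bg] by simp
      then have "norm (G t u x) \<le> norm (G t g x) + norm (G t (\<lambda>x. u x - g x) x)" by (simp add: norm_triangle_ineq)
      also have "\<dots> \<le> K * \<epsilon> powr (\<delta> - 1) + K * \<epsilon> powr \<delta> * (c0 * t powr (- a))"
        by (intro add_mono G_bound_Lipschitz[OF t bg g(1)] G_bound[OF t bd])
      also have "\<dots> = (K + K * c0) * t powr (- ((1 - \<delta>) * a))"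
      proof -
        have "\<epsilon> powr (\<delta> - 1) = t powr (- ((1 - \<delta>) * a))" by (simp add: \<epsilon>_def powr_powr algebra_simps)
        moreover have "\<epsilon> powr \<delta> * t powr (- a) = t powr (- ((1 - \<delta>) * a))"
          by (simp add: \<epsilon>_def powr_powr powr_add[symmetric] algebra_simps)
        ultimately show ?thesis by (simp add: algebra_simps)
      qed
      finally show "norm (G t u x) \<le> (K + K * c0) * t powr (- ((1 - \<delta>) * a))" .
    qed
  qed
qed

end

section \<open>Duhamel integrals\<close>

abbreviation beta_kernel :: "real \<Rightarrow> real \<Rightarrow> real \<Rightarrow> real \<Rightarrow> real" where
  "beta_kernel a b t s \<equiv> indicator {0<..<t} s *\<^sub>R ((t - s) powr (- a) * s powr (- b))"

lemma has_bochner_integral_lborel_nonneg: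
  fixes f :: "real \<Rightarrow> real"
  assumes I: "(f has_integral I) {l..u}" and nn: "\<And>x. x \<in> {l..u} \<Longrightarrow> 0 \<le> f x" and [measurable]: "f \<in> borel_measurable borel"
  shows "has_bochner_integral lborel (\<lambda>x. indicator {l<..<u} x *\<^sub>R f x) I"
proof -
  have "f absolutely_integrable_on {l..u}"
    using I nn by (intro nonnegative_absolutely_integrable_1) (auto simp: integrable_on_def)
  then have s: "f absolutely_integrable_on {l<..<u}"
    by (rule set_integrable_subset) auto
  have "(f has_integral I) {l<..<u}" using I by (simp add: has_integral_Icc_iff_Ioo)
  then have "(LINT x:{l<..<u}|lebesgue. f x) = I"
    using set_lebesgue_integral_eq_integral(2)[OF s] by (simp add: integral_unique)
  then show ?thesis using s
    by (simp add: has_bochner_integral_iff set_integrable_def set_lebesgue_integral_def integrable_completion integral_completion)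
qed

lemma beta_kernel_integral:
  assumes a: "a < 1" and b: "b < 1" and t: "0 < (t::real)"
  shows "has_bochner_integral lborel (\<lambda>s. beta_kernel a b t s)
    (t powr (1 - a - b) * Beta (1 - b) (1 - a))"
proof -
  have "((\<lambda>x. x powr (1 - b - 1) * (1 - x) powr (1 - a - 1)) has_integral Beta (1 - b) (1 - a)) {0..1}"
    using a b by (intro has_integral_Beta_real) auto
  then have I: "has_bochner_integral lborel (\<lambda>x. indicator {0<..<1} x *\<^sub>R (x powr (- b) * (1 - x) powr (- a))) (Beta (1 - b) (1 - a))"
    by (intro has_bochner_integral_lborel_nonneg) auto
  have "has_bochner_integral lborel (\<lambda>x. indicator {0<..<t} (0 + t * x) *\<^sub>R ((t - (0 + t * x)) powr (- a) * (0 + t * x) powr (- b)))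
    (t powr (- a - b) * Beta (1 - b) (1 - a))"
  proof (subst has_bochner_integral_cong[OF refl _ refl])
    show "has_bochner_integral lborel (\<lambda>x. t powr (- a - b) * (indicator {0<..<1} x *\<^sub>R (x powr (- b) * (1 - x) powr (- a)))) (t powr (- a - b) * Beta (1 - b) (1 - a))"
      by (intro has_bochner_integral_mult_right I)
    fix x
    have "indicator {0<..<t} (t * x) = (indicator {0<..<1} x :: real)"
      using t by (auto simp: indicator_def zero_less_mult_iff)
    moreover have "(t - t * x) powr (- a) * (t * x) powr (- b) = t powr (- a - b) * (x powr (- b) * (1 - x) powr (- a))"
      if "x \<in> {0<..<1}"
    proof -
      have "(t - t * x) powr (- a) = t powr (- a) * (1 - x) powr (- a)"
        using powr_mult[of t "1 - x" "- a"] t that by (simp add: right_diff_distrib)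
      moreover have "(t * x) powr (- b) = t powr (- b) * x powr (- b)"
        using powr_mult[of t x "- b"] t that by simp
      moreover have "t powr (- a - b) = t powr (- a) * t powr (- b)"
        using powr_add[of t "- a" "- b"] by simp
      ultimately show ?thesis by (simp only: mult_ac)
    qed
    ultimately show "indicator {0<..<t} (0 + t * x) *\<^sub>R ((t - (0 + t * x)) powr (- a) * (0 + t * x) powr (- b)) =
       t powr (- a - b) * (indicator {0<..<1} x *\<^sub>R (x powr (- b) * (1 - x) powr (- a)))"
      by (cases "x \<in> {0<..<1}") simp_all
  qed
  then have "has_bochner_integral lborel (\<lambda>s. beta_kernel a b t s)
     (\<bar>t\<bar> *\<^sub>R (t powr (- a - b) * Beta (1 - b) (1 - a)))"
    using t by (subst lborel_has_bochner_integral_real_affine_iff[of t _ _ 0]) (auto simp: mult.assoc[symmetric])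
  moreover have "\<bar>t\<bar> *\<^sub>R (t powr (- a - b) * Beta (1 - b) (1 - a)) = t powr (1 - a - b) * Beta (1 - b) (1 - a)"
    using t powr_add[of t 1 "- a - b"] by (simp add: algebra_simps)
  ultimately show ?thesis by (simp only:)
qed

lemma powr_kernel_integral:
  assumes a: "a < 1" and t: "u < (t::real)"
  shows "has_bochner_integral lborel (\<lambda>s. indicator {u<..<t} s *\<^sub>R ((t - s) powr (- a)))
    ((t - u) powr (1 - a) * Beta 1 (1 - a))"
proof -
  have "has_bochner_integral lborel (\<lambda>s. indicator {0<..<t - u} s *\<^sub>R ((t - u - s) powr (- a) * s powr (- 0)))
     ((t - u) powr (1 - a - 0) * Beta (1 - 0) (1 - a))"
    using a t by (intro beta_kernel_integral) auto
  then have "has_bochner_integral lborel (\<lambda>s. indicator {0<..<t - u} s *\<^sub>R ((t - u - s) powr (- a)))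
     ((t - u) powr (1 - a) * Beta 1 (1 - a))"
    by (rule has_bochner_integral_cong[THEN iffD1, rotated -1]) (auto simp: indicator_def)
  then have "has_bochner_integral lborel (\<lambda>s. indicator {u<..<t} (u + 1 * s) *\<^sub>R ((t - (u + 1 * s)) powr (- a)))
     ((t - u) powr (1 - a) * Beta 1 (1 - a))"
    by (rule has_bochner_integral_cong[THEN iffD1, rotated -1]) (auto simp: indicator_def algebra_simps)
  then show ?thesis
    by (subst lborel_has_bochner_integral_real_affine_iff[of 1 _ _ u]) auto
qed

text \<open>
  Only joint continuity is required, not continuity in time for the sup norm: \<open>H(s, x, w(s, x))\<close> need
  not have the latter, since \<open>H\<close> is continuous only locally uniformly in \<open>x\<close>.
\<close>
definition admissible_forcing :: "real \<Rightarrow> real \<Rightarrow> real \<Rightarrow> (real \<Rightarrow> real^'d::finite \<Rightarrow> real) \<Rightarrow> bool" where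
  "admissible_forcing T b K f \<longleftrightarrow> continuous_on ({0<..<T} \<times> UNIV) (\<lambda>(s, y). f s y) \<and>
     (\<forall>s\<in>{0<..<T}. \<forall>y. \<bar>f s y\<bar> \<le> K * s powr (- b))"

lemma admissible_forcing_slice:
  assumes f: "admissible_forcing T b K f" and s: "0 < s" "s < T"
  shows "bounded_by (K * s powr (- b)) (f s)"
proof -
  have c: "continuous_on ({0<..<T} \<times> UNIV) (\<lambda>z. f (fst z) (snd z))"
    using f by (simp add: admissible_forcing_def case_prod_beta')
  have "continuous_on UNIV (f s)"
    using continuous_on_compose2[OF c, of UNIV "\<lambda>y. (s, y)"] s by (simp add: continuous_on_Pair image_subset_iff)
  then show ?thesis using f s by (auto simp: bounded_by_def admissible_forcing_def intro: borel_measurable_continuous_onI)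
qed

lemma admissible_forcing_nonneg:
  assumes "admissible_forcing T b K f" and "0 < T"
  shows "0 \<le> K"
  using bounded_byD(3)[OF admissible_forcing_slice[OF assms(1), of "T/2"]] assms(2)
  by (simp add: zero_le_mult_iff)

lemma admissible_forcing_tendsto:
  assumes f: "admissible_forcing T b K f" and X: "\<And>n. X n \<in> {0<..<T}" "X \<longlonglongrightarrow> s" and s: "0 < s" "s < T"
  shows "(\<lambda>n. f (X n) y) \<longlonglongrightarrow> f s y"
proof -
  have c': "continuous_on ({0<..<T} \<times> UNIV) (\<lambda>z. f (fst z) (snd z))"
    using f by (simp add: admissible_forcing_def case_prod_beta')
  have c: "continuous_on {0<..<T} (\<lambda>s. f s y)"
    using continuous_on_compose2[OF c', of "{0<..<T}" "\<lambda>s. (s, y)"] by (simp add: continuous_on_Pair image_subset_iff)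
  show ?thesis
    using continuous_on_tendsto_compose[OF c X(2)] X(1) s by auto
qed

definition duhamel :: "(real \<Rightarrow> (real^'d::finite \<Rightarrow> real) \<Rightarrow> real^'d \<Rightarrow> 'b::{banach,second_countable_topology}) \<Rightarrow>
    (real \<Rightarrow> real^'d \<Rightarrow> real) \<Rightarrow> real \<Rightarrow> real^'d \<Rightarrow> 'b" where
  "duhamel S f t x = (LINT s:{0<..<t}|lborel. S (t - s) (f s) x)"

text \<open>
  Common properties of the semigroup (with \<open>q = 0\<close>) and of its gradient (with \<open>q = a\<close>), so that Duhamel
  integrals of both are treated at once.
\<close>
locale smoothing_family =
  fixes S :: "real \<Rightarrow> (real^'d::finite \<Rightarrow> real) \<Rightarrow> real^'d \<Rightarrow> 'b::{banach,second_countable_topology}"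
    and Tm q c :: real
  assumes q: "0 \<le> q" "q < 1" and c: "0 < c"
    and S_bound: "0 < \<sigma> \<Longrightarrow> \<sigma> \<le> Tm \<Longrightarrow> bounded_by C \<phi> \<Longrightarrow> norm (S \<sigma> \<phi> x) \<le> C * (c * \<sigma> powr (- q))"
    and S_modulus: "0 < \<eta> \<Longrightarrow> 0 < e \<Longrightarrow> \<exists>d>0. time_modulus S Tm \<eta> e d"
    and S_dct: "0 < \<sigma> \<Longrightarrow> \<sigma> \<le> Tm \<Longrightarrow> (\<And>n. bounded_by C (\<Phi> n)) \<Longrightarrow> bounded_by C \<phi>' \<Longrightarrow>
      (\<And>y. (\<lambda>n. \<Phi> n y) \<longlonglongrightarrow> \<phi>' y) \<Longrightarrow> (\<lambda>n. S \<sigma> (\<Phi> n) x) \<longlonglongrightarrow> S \<sigma> \<phi>' x"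
    and S_continuous: "0 < \<sigma> \<Longrightarrow> \<sigma> \<le> Tm \<Longrightarrow> bounded_by C \<phi> \<Longrightarrow> continuous_on UNIV (S \<sigma> \<phi>)"
    and S_diff: "0 < \<sigma> \<Longrightarrow> \<sigma> \<le> Tm \<Longrightarrow> bounded_by C \<phi> \<Longrightarrow> bounded_by C' \<phi>' \<Longrightarrow>
      S \<sigma> (\<lambda>x. \<phi> x - \<phi>' x) x = S \<sigma> \<phi> x - S \<sigma> \<phi>' x"
begin

lemma S_modulus_symmetric:
  assumes "0 < \<eta>" "0 < e"
  obtains d where "0 < d" "\<And>\<sigma> \<sigma>' C \<phi> x. \<eta> \<le> \<sigma> \<Longrightarrow> \<eta> \<le> \<sigma>' \<Longrightarrow> \<bar>\<sigma> - \<sigma>'\<bar> < d \<Longrightarrow> \<sigma> \<le> Tm \<Longrightarrow> \<sigma>' \<le> Tm \<Longrightarrow>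
      bounded_by C \<phi> \<Longrightarrow> norm (S \<sigma> \<phi> x - S \<sigma>' \<phi> x) \<le> e * C"
proof -
  obtain d where d: "d > 0" and D: "\<And>\<sigma> h \<phi> C x. \<eta> \<le> \<sigma> \<Longrightarrow> 0 \<le> h \<Longrightarrow> h < d \<Longrightarrow> \<sigma> + h \<le> Tm \<Longrightarrow>
      bounded_by C \<phi> \<Longrightarrow> norm (S (\<sigma> + h) \<phi> x - S \<sigma> \<phi> x) \<le> e * C"
    using S_modulus[OF assms] by blast
  show thesis
  proof (rule that[OF d])
    fix \<sigma> \<sigma>' C and \<phi> :: "real^'d \<Rightarrow> real" and x
    assume *: "\<eta> \<le> \<sigma>" "\<eta> \<le> \<sigma>'" "\<bar>\<sigma> - \<sigma>'\<bar> < d" "\<sigma> \<le> Tm" "\<sigma>' \<le> Tm" "bounded_by C \<phi>"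
    show "norm (S \<sigma> \<phi> x - S \<sigma>' \<phi> x) \<le> e * C"
    proof (cases "\<sigma>' \<le> \<sigma>")
      case True then show ?thesis using D[of \<sigma>' "\<sigma> - \<sigma>'" C \<phi> x] * by auto
    next
      case False then show ?thesis using D[of \<sigma> "\<sigma>' - \<sigma>" C \<phi> x] * by (auto simp: norm_minus_commute)
    qed
  qed
qed

context
  fixes T b K :: real and f :: "real \<Rightarrow> real^'d \<Rightarrow> real"
  assumes f: "admissible_forcing T b K f" and T: "0 < T" "T \<le> Tm" and b: "0 \<le> b" "b < 1"
begin

lemma integrand_bound:
  assumes "0 < s" "s < t" "t \<le> T"
  shows "norm (S (t - s) (f s) x) \<le> K * c * ((t - s) powr (- q) * s powr (- b))"
  using S_bound[of "t - s" "K * s powr (- b)" "f s" x] admissible_forcing_slice[OF f, of s] assms T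
  by (simp add: algebra_simps)

text \<open>
  Moving the time of \<open>S\<close> is controlled uniformly in the forcing by the modulus, and moving the forcing
  at a fixed time of \<open>S\<close> by dominated convergence.
\<close>
lemma integrand_continuous:
  assumes t: "0 < t" "t \<le> T"
  shows "continuous_on {0<..<t} (\<lambda>s. S (t - s) (f s) x)"
proof (intro continuous_at_imp_continuous_on ballI)
  fix s assume s: "s \<in> {0<..<t}"
  define A where "A = {s/2<..<t}"
  define \<eta> where "\<eta> = (t - s) / 2"
  define M where "M = K * (s/2) powr (- b)"
  have K: "0 \<le> K" using f T(1) by (rule admissible_forcing_nonneg)
  have M: "0 \<le> M" using K by (simp add: M_def)
  have \<eta>: "0 < \<eta>" using s by (simp add: \<eta>_def)
  have bC: "bounded_by M (f r)" if "s/2 < r" "r < T" for r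
  proof -
    have "r powr (- b) \<le> (s/2) powr (- b)" using that s b by (intro powr_mono2') auto
    then have "K * r powr (- b) \<le> M" unfolding M_def using K by (rule mult_left_mono)
    then show ?thesis using admissible_forcing_slice[OF f, of r] that s
      by (auto simp: bounded_by_def intro: order_trans)
  qed
  have "continuous (at s within A) (\<lambda>s. S (t - s) (f s) x)"
    unfolding continuous_within_sequentially
  proof (intro allI impI, elim conjE)
    fix X assume XA: "\<forall>n. X n \<in> A" and X: "X \<longlonglongrightarrow> s"
    have Xn: "s/2 < X n" "X n < t" for n using XA by (auto simp: A_def)
    have 1: "(\<lambda>n. S (t - s) (f (X n)) x) \<longlonglongrightarrow> S (t - s) (f s) x"
    proof (rule S_dct[where C=M])
      show "bounded_by M (f (X n))" for n using Xn[of n] t by (intro bC) auto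
      show "bounded_by M (f s)" using s t by (intro bC) auto
      have "X n \<in> {0<..<T}" for n using Xn[of n] s t by auto
      then show "(\<lambda>n. f (X n) y) \<longlonglongrightarrow> f s y" for y
        using X s t by (intro admissible_forcing_tendsto[OF f]) auto
    qed (use s t T in auto)
    have 2: "(\<lambda>n. S (t - X n) (f (X n)) x - S (t - s) (f (X n)) x) \<longlonglongrightarrow> 0"
    proof (rule tendstoI)
      fix e :: real assume e: "0 < e"
      have e': "0 < e / (2 * (M + 1))" using e M by simp
      obtain d where d: "0 < d" "\<And>\<sigma> \<sigma>' C \<phi> x. \<eta> \<le> \<sigma> \<Longrightarrow> \<eta> \<le> \<sigma>' \<Longrightarrow> \<bar>\<sigma> - \<sigma>'\<bar> < d \<Longrightarrow> \<sigma> \<le> Tm \<Longrightarrow> \<sigma>' \<le> Tm \<Longrightarrow>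
        bounded_by C \<phi> \<Longrightarrow> norm (S \<sigma> \<phi> x - S \<sigma>' \<phi> x) \<le> e / (2 * (M + 1)) * C"
        using S_modulus_symmetric[OF \<eta> e'] by metis
      have "\<forall>\<^sub>F n in sequentially. dist (X n) s < min d \<eta>"
        using X d(1) \<eta> by (intro tendstoD) auto
      then show "\<forall>\<^sub>F n in sequentially. dist (S (t - X n) (f (X n)) x - S (t - s) (f (X n)) x) 0 < e"
      proof eventually_elim
        fix n assume n: "dist (X n) s < min d \<eta>"
        have "norm (S (t - X n) (f (X n)) x - S (t - s) (f (X n)) x) \<le> e / (2 * (M + 1)) * M"
        proof (rule d(2))
          show "bounded_by M (f (X n))" using Xn[of n] t by (intro bC) auto
          have "\<bar>X n - s\<bar> < (t - s) / 2" using n by (simp add: \<eta>_def dist_real_def)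
          then have "X n - s < (t - s) / 2" by (simp only: abs_less_iff)
          then show "\<eta> \<le> t - X n" by (simp add: \<eta>_def field_simps)
        qed (use n Xn[of n] s t T in \<open>auto simp: \<eta>_def dist_real_def abs_minus_commute\<close>)
        also have "\<dots> < e" using e M by (simp add: field_simps add_nonneg_pos)
        finally show "dist (S (t - X n) (f (X n)) x - S (t - s) (f (X n)) x) 0 < e" by simp
      qed
    qed
    show "((\<lambda>s. S (t - s) (f s) x) \<circ> X) \<longlonglongrightarrow> S (t - s) (f s) x"
      using tendsto_add[OF 1 2] by (simp add: o_def)
  qed
  then show "isCont (\<lambda>s. S (t - s) (f s) x) s"
    using s by (subst (asm) at_within_open) (auto simp: A_def)
qed

lemma integrand_integrable:
  assumes t: "0 < t" "t \<le> T"
  shows "set_integrable lborel {0<..<t} (\<lambda>s. S (t - s) (f s) x)"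
  unfolding set_integrable_def
proof (rule Bochner_Integration.integrable_bound)
  show "integrable lborel (\<lambda>s. K * c * beta_kernel q b t s)"
    using beta_kernel_integral[OF q(2) b(2) t(1)] by (auto simp: has_bochner_integral_iff)
  show "(\<lambda>s. indicator {0<..<t} s *\<^sub>R S (t - s) (f s) x) \<in> borel_measurable lborel"
    using borel_measurable_continuous_on_indicator[OF _ integrand_continuous[OF t]] by simp
  show "AE s in lborel. norm (indicator {0<..<t} s *\<^sub>R S (t - s) (f s) x) \<le> norm (K * c * beta_kernel q b t s)"
    using integrand_bound[OF _ _ t(2)] by (intro AE_I2) (auto simp: indicator_def intro: order_trans[OF _ abs_ge_self])
qed

lemma duhamel_bound_of_integrand:
  assumes t: "0 < t" "t \<le> T" and q': "q' < 1"
    and le: "\<And>s. 0 < s \<Longrightarrow> s < t \<Longrightarrow> norm (S (t - s) (f s) x) \<le> k * ((t - s) powr (- q') * s powr (- b))"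
  shows "norm (duhamel S f t x) \<le> k * (t powr (1 - q' - b) * Beta (1 - b) (1 - q'))"
proof -
  note B = beta_kernel_integral[OF q' b(2) t(1)]
  have "norm (duhamel S f t x) \<le> (LINT s|lborel. norm (indicator {0<..<t} s *\<^sub>R S (t - s) (f s) x))"
    unfolding duhamel_def set_lebesgue_integral_def by (rule integral_norm_bound)
  also have "\<dots> \<le> (LINT s|lborel. k * beta_kernel q' b t s)"
  proof (rule integral_mono)
    show "integrable lborel (\<lambda>s. norm (indicator {0<..<t} s *\<^sub>R S (t - s) (f s) x))"
      using integrand_integrable[OF t] by (intro integrable_norm) (simp add: set_integrable_def)
    show "integrable lborel (\<lambda>s. k * beta_kernel q' b t s)"
      using B by (auto simp: has_bochner_integral_iff)
  qed (use le in \<open>auto simp: indicator_def\<close>)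
  also have "\<dots> = k * (t powr (1 - q' - b) * Beta (1 - b) (1 - q'))"
    using has_bochner_integral_integral_eq[OF B] by simp
  finally show ?thesis .
qed

lemma duhamel_bound:
  assumes t: "0 < t" "t \<le> T"
  shows "norm (duhamel S f t x) \<le> K * c * (t powr (1 - q - b) * Beta (1 - b) (1 - q))"
  using t q(2) by (rule duhamel_bound_of_integrand) (rule integrand_bound[OF _ _ t(2)])

lemma duhamel_continuous:
  assumes t: "0 < t" "t \<le> T"
  shows "continuous_on UNIV (duhamel S f t)"
proof (intro continuous_at_imp_continuous_on ballI)
  fix x
  have "continuous (at x within UNIV) (duhamel S f t)"
    unfolding continuous_within_sequentially o_def duhamel_def set_lebesgue_integral_def
  proof (intro allI impI, elim conjE)
    fix X assume X: "X \<longlonglongrightarrow> x"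
    show "(\<lambda>n. LINT s|lborel. indicator {0<..<t} s *\<^sub>R S (t - s) (f s) (X n)) \<longlonglongrightarrow> (LINT s|lborel. indicator {0<..<t} s *\<^sub>R S (t - s) (f s) x)"
    proof (rule integral_dominated_convergence)
      show "integrable lborel (\<lambda>s. K * c * beta_kernel q b t s)"
        using beta_kernel_integral[OF q(2) b(2) t(1)] by (auto simp: has_bochner_integral_iff)
      show "(\<lambda>s. indicator {0<..<t} s *\<^sub>R S (t - s) (f s) (X n)) \<in> borel_measurable lborel"
        "(\<lambda>s. indicator {0<..<t} s *\<^sub>R S (t - s) (f s) x) \<in> borel_measurable lborel" for n
        using borel_measurable_continuous_on_indicator[OF _ integrand_continuous[OF t]] by simp_all
      show "AE s in lborel. norm (indicator {0<..<t} s *\<^sub>R S (t - s) (f s) (X n)) \<le> K * c * beta_kernel q b t s" for n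
        using integrand_bound[OF _ _ t(2)] by (intro AE_I2) (auto simp: indicator_def)
      have "(\<lambda>n. S (t - s) (f s) (X n)) \<longlonglongrightarrow> S (t - s) (f s) x" if "0 < s" "s < t" for s
      proof (rule continuous_on_tendsto_compose[OF S_continuous X])
        show "bounded_by (K * s powr (- b)) (f s)" using that t by (intro admissible_forcing_slice[OF f]) auto
      qed (use that t T in auto)
      then show "AE s in lborel. (\<lambda>n. indicator {0<..<t} s *\<^sub>R S (t - s) (f s) (X n)) \<longlonglongrightarrow> indicator {0<..<t} s *\<^sub>R S (t - s) (f s) x"
        by (intro AE_I2) (auto simp: indicator_def)
    qed
  qed
  then show "isCont (duhamel S f t) x" by simp
qed

text \<open>
  Up to time \<open>t - \<eta>\<close> both integrands stay away from the singularity of \<open>S\<close> and their difference is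
  controlled by its modulus; what remains are two short integrals over \<open>(t - s) powr (- q)\<close>.
\<close>
lemma duhamel_increment:
  assumes \<eta>: "0 < \<eta>" and t: "\<eta> < t" "t \<le> t'" "t' \<le> T" and m: "0 < m" "m \<le> t - \<eta>"
    and e: "\<And>s. 0 < s \<Longrightarrow> s \<le> t - \<eta> \<Longrightarrow> norm (S (t' - s) (f s) x - S (t - s) (f s) x) \<le> e * s powr (- b)"
    and e0: "0 \<le> e"
  shows "norm (duhamel S f t' x - duhamel S f t x) \<le> e * (T powr (1 - b) * Beta (1 - b) 1)
    + 2 * (K * c * m powr (- b) * ((t' - t + \<eta>) powr (1 - q) * Beta 1 (1 - q)))"
proof -
  define k where "k = K * c * m powr (- b)"
  have K: "0 \<le> K" using f T(1) by (rule admissible_forcing_nonneg)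
  have k: "0 \<le> k" using K c by (simp add: k_def)
  define D where "D s = indicator {0<..<t'} s *\<^sub>R S (t' - s) (f s) x - indicator {0<..<t} s *\<^sub>R S (t - s) (f s) x" for s
  define g where "g s = e * (indicator {0<..<T} s *\<^sub>R s powr (- b)) + k * (indicator {t - \<eta><..<t'} s *\<^sub>R (t' - s) powr (- q))
    + k * (indicator {t - \<eta><..<t} s *\<^sub>R (t - s) powr (- q))" for s
  have t0: "0 < t" "0 < t'" "t \<le> T" using t \<eta> by auto
  note i = integrand_integrable[OF t0(1,3), of x] integrand_integrable[OF t0(2) t(3), of x]
  have h1: "has_bochner_integral lborel (\<lambda>s. indicator {0<..<T} s *\<^sub>R s powr (- b)) (T powr (1 - b) * Beta (1 - b) 1)"
  proof -
    have "has_bochner_integral lborel (\<lambda>s. indicator {0<..<T} s *\<^sub>R ((T - s) powr (- 0) * s powr (- b))) (T powr (1 - 0 - b) * Beta (1 - b) (1 - 0))"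
      using b T by (intro beta_kernel_integral) auto
    then have "has_bochner_integral lborel (\<lambda>s. indicator {0<..<T} s *\<^sub>R s powr (- b)) (T powr (1 - 0 - b) * Beta (1 - b) (1 - 0))"
      by (rule has_bochner_integral_cong[THEN iffD1, rotated -1]) (auto simp: indicator_def)
    then show ?thesis by simp
  qed
  have h2: "has_bochner_integral lborel (\<lambda>s. indicator {t - \<eta><..<t'} s *\<^sub>R (t' - s) powr (- q)) ((t' - (t - \<eta>)) powr (1 - q) * Beta 1 (1 - q))"
    using q t \<eta> by (intro powr_kernel_integral) auto
  have h3: "has_bochner_integral lborel (\<lambda>s. indicator {t - \<eta><..<t} s *\<^sub>R (t - s) powr (- q)) ((t - (t - \<eta>)) powr (1 - q) * Beta 1 (1 - q))"
    using q t \<eta> by (intro powr_kernel_integral) auto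
  have hg: "has_bochner_integral lborel g (e * (T powr (1 - b) * Beta (1 - b) 1) + k * ((t' - (t - \<eta>)) powr (1 - q) * Beta 1 (1 - q)) + k * ((t - (t - \<eta>)) powr (1 - q) * Beta 1 (1 - q)))"
    unfolding g_def by (intro has_bochner_integral_add has_bochner_integral_mult_right h1 h2 h3)
  have tail: "norm (S (r - s) (f s) x) \<le> k * (r - s) powr (- q)" if "t - \<eta> < s" "s < r" "r \<le> T" for r s
  proof -
    have "norm (S (r - s) (f s) x) \<le> K * c * ((r - s) powr (- q) * s powr (- b))"
      using that m by (intro integrand_bound) auto
    also have "\<dots> \<le> K * c * ((r - s) powr (- q) * m powr (- b))"
      using K c that m b by (intro mult_left_mono powr_mono2') auto
    finally show ?thesis by (simp add: k_def algebra_simps)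
  qed
  have Dg: "norm (D s) \<le> g s" for s
  proof -
    consider "s \<le> 0 \<or> t' \<le> s" | "0 < s" "s \<le> t - \<eta>" | "t - \<eta> < s" "s < t" | "t \<le> s" "s < t'" by linarith
    then show ?thesis
    proof cases
      case 1 then show ?thesis using t e0 k by (auto simp: D_def g_def indicator_def)
    next
      case 2
      then show ?thesis using t \<eta> e[of s] by (auto simp: D_def g_def indicator_def)
    next
      case 3
      then have *: "norm (D s) \<le> k * (t' - s) powr (- q) + k * (t - s) powr (- q)"
        using tail[of s t'] tail[of s t] t m unfolding D_def
        by (intro order_trans[OF norm_triangle_ineq4]) (auto intro!: add_mono simp: indicator_def)
      have "0 \<le> e * s powr (- b)" using e0 by simp
      then show ?thesis using 3 t m * by (auto simp: g_def indicator_def)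
    next
      case 4
      then have *: "norm (D s) \<le> k * (t' - s) powr (- q)"
        using tail[of s t'] t t0 \<eta> by (auto simp: D_def indicator_def)
      have "0 \<le> e * s powr (- b)" using e0 by simp
      then show ?thesis using 4 t t0 \<eta> * by (auto simp: g_def indicator_def)
    qed
  qed
  have "duhamel S f t' x - duhamel S f t x = (LINT s|lborel. D s)"
    using i unfolding duhamel_def set_lebesgue_integral_def D_def set_integrable_def by simp
  also have "norm \<dots> \<le> (LINT s|lborel. norm (D s))" by (rule integral_norm_bound)
  also have "\<dots> \<le> (LINT s|lborel. g s)"
  proof (rule integral_mono)
    show "integrable lborel (\<lambda>s. norm (D s))" using i unfolding D_def set_integrable_def by simp
    show "integrable lborel g" using hg by (simp add: has_bochner_integral_iff)
  qed (rule Dg)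
  also have "\<dots> = e * (T powr (1 - b) * Beta (1 - b) 1) + k * ((t' - (t - \<eta>)) powr (1 - q) * Beta 1 (1 - q)) + k * ((t - (t - \<eta>)) powr (1 - q) * Beta 1 (1 - q))"
    using hg by (rule has_bochner_integral_integral_eq)
  also have "\<dots> \<le> e * (T powr (1 - b) * Beta (1 - b) 1) + 2 * (k * ((t' - t + \<eta>) powr (1 - q) * Beta 1 (1 - q)))"
  proof -
    have "(t - (t - \<eta>)) powr (1 - q) \<le> (t' - t + \<eta>) powr (1 - q)" using t \<eta> q by (intro powr_mono2) auto
    moreover have "0 \<le> Beta 1 (1 - q)" using q by (simp add: Beta_def Gamma_real_nonneg)
    ultimately have "k * ((t - (t - \<eta>)) powr (1 - q) * Beta 1 (1 - q)) \<le> k * ((t' - t + \<eta>) powr (1 - q) * Beta 1 (1 - q))"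
      using k by (intro mult_left_mono mult_right_mono) auto
    moreover have eq: "t' - (t - \<eta>) = t' - t + \<eta>" by simp
    ultimately show ?thesis unfolding eq by linarith
  qed
  finally show ?thesis by (simp add: k_def)
qed

text \<open>
  First \<open>\<eta>\<close> is chosen to make the short integrals small, then the time difference to make the rest
  small. All bounds are independent of \<open>x\<close>.
\<close>
lemma duhamel_time_continuous:
  assumes t0: "0 < t0" "t0 \<le> T" and e: "0 < e"
  shows "\<exists>d>0. \<forall>t x. 0 < t \<longrightarrow> t \<le> T \<longrightarrow> \<bar>t - t0\<bar> < d \<longrightarrow> norm (duhamel S f t x - duhamel S f t0 x) \<le> e"
proof -
  \<comment> \<open>Lower bound for the times at which the forcing is evaluated in the short integrals.\<close>
  define m where "m = t0 / 4"
  define k where "k = 2 * (K * c * m powr (- b) * Beta 1 (1 - q))"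
  define j where "j = T powr (1 - b) * Beta (1 - b) 1"
  have K: "0 \<le> K" using f T(1) by (rule admissible_forcing_nonneg)
  have j: "0 \<le> j" using b by (simp add: j_def Beta_def Gamma_real_nonneg)
  have "((\<lambda>\<eta>. k * (2 * \<eta>) powr (1 - q)) \<longlongrightarrow> 0) (at_right 0)"
    using q by (intro tendsto_mult_right_zero tendsto_zero_powrI[where b="1 - q"] tendsto_eq_intros) (auto intro: eventually_mono[OF eventually_at_right_less[of 0]])
  then have "\<forall>\<^sub>F \<eta> in at_right 0. k * (2 * \<eta>) powr (1 - q) < e / 2"
    using e by (intro order_tendstoD) auto
  then obtain \<eta>0 where \<eta>0: "0 < \<eta>0" "\<And>\<eta>. 0 < \<eta> \<Longrightarrow> \<eta> < \<eta>0 \<Longrightarrow> k * (2 * \<eta>) powr (1 - q) < e / 2"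
    by (auto simp: eventually_at_right_field)
  define \<eta> where "\<eta> = min (\<eta>0 / 2) m"
  have \<eta>: "0 < \<eta>" "\<eta> \<le> m" "k * (2 * \<eta>) powr (1 - q) < e / 2"
    using \<eta>0 t0 by (auto simp: \<eta>_def m_def)
  define e1 where "e1 = e / (2 * (j + 1))"
  define e2 where "e2 = e1 / (K + 1)"
  have e1: "0 < e1" using e j by (simp add: e1_def)
  have e2: "0 < e2" using e1 K by (simp add: e2_def)
  obtain d where d: "0 < d" "\<And>\<sigma> \<sigma>' C \<phi> x. \<eta> \<le> \<sigma> \<Longrightarrow> \<eta> \<le> \<sigma>' \<Longrightarrow> \<bar>\<sigma> - \<sigma>'\<bar> < d \<Longrightarrow> \<sigma> \<le> Tm \<Longrightarrow> \<sigma>' \<le> Tm \<Longrightarrow>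
      bounded_by C \<phi> \<Longrightarrow> norm (S \<sigma> \<phi> x - S \<sigma>' \<phi> x) \<le> e2 * C"
    using S_modulus_symmetric[OF \<eta>(1) e2] by metis
  have main: "norm (duhamel S f t' x - duhamel S f t x) \<le> e"
    if t: "2 * m \<le> t" "t \<le> t'" "t' \<le> T" "t' - t < d" "t' - t \<le> \<eta>" for t t' x
  proof -
    have "norm (duhamel S f t' x - duhamel S f t x) \<le> e1 * (T powr (1 - b) * Beta (1 - b) 1)
    + 2 * (K * c * m powr (- b) * ((t' - t + \<eta>) powr (1 - q) * Beta 1 (1 - q)))"
    proof (rule duhamel_increment[OF \<eta>(1) _ t(2,3)])
      show "\<eta> < t" "0 < m" "m \<le> t - \<eta>" "0 \<le> e1" using \<eta> t t0 e1 by (auto simp: m_def)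
      fix s assume s: "0 < s" "s \<le> t - \<eta>"
      have "norm (S (t' - s) (f s) x - S (t - s) (f s) x) \<le> e2 * (K * s powr (- b))"
        using s t T \<eta> by (intro d(2) admissible_forcing_slice[OF f]) auto
      also have "\<dots> = (e2 * K) * s powr (- b)" by simp
      also have "\<dots> \<le> e1 * s powr (- b)" using K e1 by (intro mult_right_mono) (auto simp: e2_def field_simps)
      finally show "norm (S (t' - s) (f s) x - S (t - s) (f s) x) \<le> e1 * s powr (- b)" .
    qed
    also have "\<dots> = e1 * j + k * (t' - t + \<eta>) powr (1 - q)" by (simp add: j_def k_def)
    also have "\<dots> \<le> e1 * j + k * (2 * \<eta>) powr (1 - q)"
    proof -
      have "0 \<le> k" using K c q by (simp add: k_def Beta_def Gamma_real_nonneg)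
      then show ?thesis using t q \<eta> by (intro add_left_mono mult_left_mono powr_mono2) auto
    qed
    also have "\<dots> \<le> e / 2 + e / 2"
    proof (rule add_mono)
      show "e1 * j \<le> e / 2" using e j by (simp add: e1_def field_simps)
    qed (use \<eta> in simp)
    finally show ?thesis by simp
  qed
  show ?thesis
  proof (intro exI[of _ "min d \<eta>"] conjI allI impI)
    show "0 < min d \<eta>" using d \<eta> by simp
    fix t x assume t: "0 < t" "t \<le> T" "\<bar>t - t0\<bar> < min d \<eta>"
    show "norm (duhamel S f t x - duhamel S f t0 x) \<le> e"
    proof (cases "t0 \<le> t")
      case True then show ?thesis using t t0 main[of t0 t x] by (auto simp: m_def)
    next
      case False
      have "norm (duhamel S f t0 x - duhamel S f t x) \<le> e"
        using False t t0 \<eta> by (intro main) (auto simp: m_def)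
      then show ?thesis by (simp add: norm_minus_commute)
    qed
  qed
qed

lemma mild_flow_time_continuous:
  assumes u: "bounded_by B u" and t0: "t0 \<in> {0<..T}" and e: "0 < e"
  shows "\<exists>d>0. \<forall>t\<in>{0<..T}. \<bar>t - t0\<bar> < d \<longrightarrow>
    (\<forall>x. norm ((S t u x + duhamel S f t x) - (S t0 u x + duhamel S f t0 x)) \<le> e)"
proof -
  note B = bounded_byD(3)[OF u]
  have e': "0 < e / (2 * (B + 1))" "e / (2 * (B + 1)) * B \<le> e / 2" using e B by (auto simp: field_simps)
  have half: "0 < t0 / 2" "0 < e / 2" using t0 e by auto
  note t0' = t0[unfolded greaterThanAtMost_iff]
  obtain d1 where d1: "0 < d1" "\<And>\<sigma> \<sigma>' C \<phi> x. t0/2 \<le> \<sigma> \<Longrightarrow> t0/2 \<le> \<sigma>' \<Longrightarrow> \<bar>\<sigma> - \<sigma>'\<bar> < d1 \<Longrightarrow> \<sigma> \<le> Tm \<Longrightarrow> \<sigma>' \<le> Tm \<Longrightarrow>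
      bounded_by C \<phi> \<Longrightarrow> norm (S \<sigma> \<phi> x - S \<sigma>' \<phi> x) \<le> e / (2 * (B + 1)) * C"
    using S_modulus_symmetric[OF half(1) e'(1)] by metis
  obtain d2 where d2: "0 < d2" "\<And>t x. 0 < t \<Longrightarrow> t \<le> T \<Longrightarrow> \<bar>t - t0\<bar> < d2 \<Longrightarrow> norm (duhamel S f t x - duhamel S f t0 x) \<le> e / 2"
    using duhamel_time_continuous[OF _ _ half(2)] t0' by blast
  show ?thesis
  proof (intro exI[of _ "min (t0/2) (min d1 d2)"] conjI ballI impI allI)
    fix t x assume t: "t \<in> {0<..T}" "\<bar>t - t0\<bar> < min (t0/2) (min d1 d2)"
    have "\<bar>t - t0\<bar> < t0 / 2" using t(2) by simp
    then have "t0/2 \<le> t" by (simp add: abs_if split: if_splits)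
    then have "norm (S t u x - S t0 u x) \<le> e / 2"
      using t t0' T by (intro order_trans[OF d1(2)[OF _ _ _ _ _ u] e'(2)]) auto
    moreover have "norm (duhamel S f t x - duhamel S f t0 x) \<le> e / 2"
      using t by (intro d2) auto
    ultimately have "norm ((S t u x - S t0 u x) + (duhamel S f t x - duhamel S f t0 x)) \<le> e / 2 + e / 2"
      by (intro norm_triangle_le add_mono)
    then show "norm ((S t u x + duhamel S f t x) - (S t0 u x + duhamel S f t0 x)) \<le> e" by (simp add: algebra_simps)
  qed (use half d1 d2 in auto)
qed

end

lemma duhamel_diff:
  assumes f: "admissible_forcing T b K f" "admissible_forcing T b K' f'" and T: "0 < T" "T \<le> Tm" and b: "0 \<le> b" "b < 1"
    and t: "0 < t" "t \<le> T"
  shows "duhamel S f t x - duhamel S f' t x = duhamel S (\<lambda>s y. f s y - f' s y) t x"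
proof -
  have "duhamel S f t x - duhamel S f' t x = (LINT s:{0<..<t}|lborel. S (t - s) (f s) x - S (t - s) (f' s) x)"
    unfolding duhamel_def
    by (rule set_integral_diff(2)[symmetric, OF integrand_integrable[OF f(1) T b t] integrand_integrable[OF f(2) T b t]])
  also have "\<dots> = duhamel S (\<lambda>s y. f s y - f' s y) t x"
    unfolding duhamel_def
  proof (rule set_lebesgue_integral_cong, simp, intro allI impI)
    fix s assume "s \<in> {0<..<t}"
    then show "S (t - s) (f s) x - S (t - s) (f' s) x = S (t - s) (\<lambda>y. f s y - f' s y) x"
      using S_diff[OF _ _ admissible_forcing_slice[OF f(1), of s] admissible_forcing_slice[OF f(2), of s]] t T by simp
  qed
  finally show ?thesis .
qed

end

sublocale smoothing_kernel \<subseteq> PS: smoothing_family "semigroup_of p" Tm 0 1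
proof
  show "norm (P \<sigma> \<phi> x) \<le> C * (1 * \<sigma> powr - 0)" if "0 < \<sigma>" "\<sigma> \<le> Tm" "bounded_by C \<phi>" for \<sigma> C \<phi> x
    using bounded_byD(2)[OF P_bounded[OF that(1,3)]] that by simp
  show "\<exists>d>0. time_modulus P Tm \<eta> e d" if "0 < \<eta>" "0 < e" for \<eta> e
    by (rule P_modulus[OF that])
qed (auto intro: P_dominated_convergence P_continuous P_diff)

sublocale smoothing_kernel \<subseteq> GS: smoothing_family G Tm a c0
proof
  show "\<exists>d>0. time_modulus G Tm \<eta> e d" if "0 < \<eta>" "0 < e" for \<eta> e
    by (rule G_modulus[OF that])
qed (use a c0 in \<open>auto intro: G_bound G_dominated_convergence G_continuous G_diff\<close>)

context smoothing_kernel
begin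

text \<open>
  Differentiation under the integral: the difference quotients at time \<open>s\<close> are dominated
  because \<open>(t - s) powr (- a) s powr (- b)\<close> bounds both the Lipschitz constant of
  \<open>P\<^sub>t\<^sub>-\<^sub>s (f s)\<close> and the norm of \<open>G\<^sub>t\<^sub>-\<^sub>s (f s)\<close>, up to a constant factor.
\<close>
lemma duhamel_has_derivative:
  assumes f: "admissible_forcing T b K f" and T: "0 < T" "T \<le> Tm" and b: "0 \<le> b" "b < 1" and t: "0 < t" "t \<le> T"
  shows "(duhamel P f t has_derivative (\<lambda>h. duhamel G f t x \<bullet> h)) (at x)"
  unfolding has_derivative_iff_norm
proof (intro conjI bounded_linear_inner_right)
  define R where "R s y = P (t - s) (f s) y - P (t - s) (f s) x - G (t - s) (f s) x \<bullet> (y - x)" for s y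
  have slice: "bounded_by (K * s powr (- b)) (f s)" if "s \<in> {0<..<t}" for s
    using that t by (intro admissible_forcing_slice[OF f]) auto
  have time: "0 < t - s" "t - s \<le> Tm" if "s \<in> {0<..<t}" for s using that t T by auto
  note Pi = PS.integrand_integrable[OF f T b t]
  note Gi = GS.integrand_integrable[OF f T b t, of x]
  have Gi': "set_integrable lborel {0<..<t} (\<lambda>s. G (t - s) (f s) x \<bullet> h)"
    and Gh: "duhamel G f t x \<bullet> h = (LINT s:{0<..<t}|lborel. G (t - s) (f s) x \<bullet> h)" for h
    using integrable_inner_left[OF Gi[unfolded set_integrable_def], of h] integral_inner_left[OF Gi[unfolded set_integrable_def], of h]
    by (simp_all add: set_integrable_def duhamel_def set_lebesgue_integral_def)
  have Ri: "set_integrable lborel {0<..<t} (\<lambda>s. R s y)" for y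
    unfolding R_def by (intro set_integral_diff(1) Pi Gi')
  have eq: "duhamel P f t y - duhamel P f t x - duhamel G f t x \<bullet> (y - x) = (LINT s:{0<..<t}|lborel. R s y)" for y
    unfolding R_def Gh set_integral_diff(2)[OF set_integral_diff(1)[OF Pi Pi] Gi'] set_integral_diff(2)[OF Pi Pi]
    by (simp add: duhamel_def)
  have bd: "\<bar>R s y\<bar> / norm (y - x) \<le> 2 * (K * c0) * ((t - s) powr (- a) * s powr (- b))" if s: "s \<in> {0<..<t}" and y: "y \<noteq> x" for s y
  proof -
    let ?B = "K * s powr (- b) * (c0 * (t - s) powr (- a))"
    have "\<bar>P (t - s) (f s) y - P (t - s) (f s) x\<bar> \<le> ?B * norm (y - x)"
      by (rule P_Lipschitz[OF time[OF s] slice[OF s]])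
    moreover have "\<bar>G (t - s) (f s) x \<bullet> (y - x)\<bar> \<le> ?B * norm (y - x)"
      by (rule order_trans[OF Cauchy_Schwarz_ineq2 mult_right_mono[OF G_bound[OF time[OF s] slice[OF s]]]]) simp
    ultimately have "\<bar>R s y\<bar> \<le> (2 * ?B) * norm (y - x)" unfolding R_def by (simp add: abs_le_iff)
    then show ?thesis using y by (simp add: pos_divide_le_eq mult_ac)
  qed
  show "((\<lambda>y. norm (duhamel P f t y - duhamel P f t x - duhamel G f t x \<bullet> (y - x)) / norm (y - x)) \<longlongrightarrow> 0) (at x)"
    unfolding eq tendsto_at_iff_sequentially
  proof (intro allI impI)
    fix X assume X: "\<forall>i. X i \<in> UNIV - {x}" "X \<longlonglongrightarrow> x"
    have Xne: "X n \<noteq> x" for n using X(1) by auto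
    have "(\<lambda>n. LINT s|lborel. indicator {0<..<t} s *\<^sub>R (R s (X n) / norm (X n - x))) \<longlonglongrightarrow> (LINT s|(lborel :: real measure). 0)"
    proof (rule integral_dominated_convergence[where w="\<lambda>s. 2 * (K * c0) * beta_kernel a b t s"])
      show "integrable lborel (\<lambda>s. 2 * (K * c0) * beta_kernel a b t s)"
        using beta_kernel_integral[OF a(2) b(2) t(1)] by (auto simp: has_bochner_integral_iff)
      show "(\<lambda>s. indicator {0<..<t} s *\<^sub>R (R s (X n) / norm (X n - x))) \<in> borel_measurable lborel" for n
      proof -
        have "integrable lborel (\<lambda>s. (indicator {0<..<t} s *\<^sub>R R s (X n)) / norm (X n - x))"
          using Ri[of "X n"] unfolding set_integrable_def by (rule integrable_divide)
        from borel_measurable_integrable[OF this] show ?thesis by simp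
      qed
      show "AE s in lborel. norm (indicator {0<..<t} s *\<^sub>R (R s (X n) / norm (X n - x))) \<le> 2 * (K * c0) * beta_kernel a b t s" for n
        using bd[OF _ Xne] by (intro AE_I2) (auto simp: indicator_def)
      show "AE s in lborel. (\<lambda>n. indicator {0<..<t} s *\<^sub>R (R s (X n) / norm (X n - x))) \<longlonglongrightarrow> 0"
      proof (intro AE_I2)
        fix s
        show "(\<lambda>n. indicator {0<..<t} s *\<^sub>R (R s (X n) / norm (X n - x))) \<longlonglongrightarrow> 0"
        proof (cases "s \<in> {0<..<t}")
          case True
          have "((\<lambda>y. norm (R s y) / norm (y - x)) \<longlongrightarrow> 0) (at x)"
            using P_has_derivative[OF time[OF True] slice[OF True], of x]
            unfolding has_derivative_iff_norm R_def by simp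
          then have "(\<lambda>n. norm (R s (X n) / norm (X n - x))) \<longlonglongrightarrow> 0"
            using X unfolding tendsto_at_iff_sequentially by (simp add: o_def)
          then have "(\<lambda>n. R s (X n) / norm (X n - x)) \<longlonglongrightarrow> 0" by (rule tendsto_norm_zero_cancel)
          then show ?thesis using True by simp
        qed simp
      qed
    qed simp
    then have "(\<lambda>n. (LINT s:{0<..<t}|lborel. R s (X n)) / norm (X n - x)) \<longlonglongrightarrow> 0"
      by (simp add: set_lebesgue_integral_def)
    from tendsto_norm_zero[OF this]
    show "((\<lambda>y. norm (LINT s:{0<..<t}|lborel. R s y) / norm (y - x)) \<circ> X) \<longlonglongrightarrow> 0"
      by (simp add: o_def)
  qed
qed

end

lemma nonneg_factor_of_mult: "0 \<le> k * z \<Longrightarrow> 0 < z \<Longrightarrow> 0 \<le> (k::real)"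
  by (auto simp: zero_le_mult_iff)

text \<open>
  If the forcing grows like \<open>exp (\<lambda> s)\<close>, the factor \<open>exp (- \<lambda> (t - s)) \<le> (\<lambda> (t - s)) powr (- \<nu>)\<close> trades a
  slightly stronger singularity at \<open>s = t\<close> for the decay \<open>\<lambda> powr (- \<nu>)\<close>.
\<close>
lemma (in smoothing_family) duhamel_exponential_bound:
  assumes g: "admissible_forcing T b K' g" and T: "0 < T" "T \<le> Tm" and b: "0 \<le> b" "b < 1" and t: "0 < t" "t \<le> T"
    and le: "\<And>s y. 0 < s \<Longrightarrow> s < T \<Longrightarrow> \<bar>g s y\<bar> \<le> K * (exp (lam * s) * s powr (- b))"
    and lam: "0 < lam" and nu: "0 \<le> nu" "nu \<le> 1" "q + nu < 1"
  shows "norm (duhamel S g t x) \<le> K * c * exp (lam * t) * lam powr (- nu) * (t powr (1 - (q + nu) - b) * Beta (1 - b) (1 - (q + nu)))"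
proof -
  define k where "k = K * c * exp (lam * t) * lam powr (- nu)"
  have K: "0 \<le> K"
  proof -
    have "0 \<le> \<bar>g (T/2) 0\<bar>" by simp
    also have "\<dots> \<le> K * (exp (lam * (T/2)) * (T/2) powr (- b))" using T by (intro le) auto
    finally show ?thesis
      by (rule nonneg_factor_of_mult) (use T in simp)
  qed
  have pt: "norm (S (t - s) (g s) x) \<le> k * ((t - s) powr (- (q + nu)) * s powr (- b))" if s: "0 < s" "s < t" for s
  proof -
    define y where "y = lam * (t - s)"
    have y: "0 < y" using lam s by (simp add: y_def)
    have "y powr nu \<le> exp y"
    proof (cases "y \<le> 1")
      case True
      then have "y powr nu \<le> 1" using y nu by (intro powr_le1) auto
      also have "1 \<le> exp y" using y by simp
      finally show ?thesis .
    next
      case False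
      then have "y powr nu \<le> y powr 1" using nu by (intro powr_mono) auto
      also have "\<dots> = y" using y by simp
      also have "\<dots> \<le> exp y" using exp_ge_add_one_self[of y] by linarith
      finally show ?thesis .
    qed
    then have ey: "exp (- y) \<le> y powr (- nu)" using y by (simp add: powr_minus exp_minus field_simps)
    have "bounded_by (K * (exp (lam * s) * s powr (- b))) (g s)"
      using admissible_forcing_slice[OF g, of s] le[of s] s t by (auto simp: bounded_by_def)
    then have "norm (S (t - s) (g s) x) \<le> K * (exp (lam * s) * s powr (- b)) * (c * (t - s) powr (- q))"
      using s t T by (intro S_bound) auto
    also have "exp (lam * s) = exp (lam * t) * exp (- y)" by (simp add: y_def exp_add[symmetric] algebra_simps)
    also have "K * (exp (lam * t) * exp (- y) * s powr (- b)) * (c * (t - s) powr (- q)) \<le>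
        K * (exp (lam * t) * y powr (- nu) * s powr (- b)) * (c * (t - s) powr (- q))"
      using K c ey by (intro mult_right_mono mult_left_mono) auto
    also have "y powr (- nu) = lam powr (- nu) * (t - s) powr (- nu)"
      using lam s by (simp add: y_def powr_mult)
    also have "K * (exp (lam * t) * (lam powr (- nu) * (t - s) powr (- nu)) * s powr (- b)) * (c * (t - s) powr (- q)) =
       k * (((t - s) powr (- q) * (t - s) powr (- nu)) * s powr (- b))" by (simp add: k_def mult_ac)
    also have "(t - s) powr (- q) * (t - s) powr (- nu) = (t - s) powr (- (q + nu))"
      by (simp add: powr_add[symmetric])
    finally show ?thesis .
  qed
  show ?thesis
    using duhamel_bound_of_integrand[OF g T b t nu(3) pt] by (simp add: k_def)
qed

section \<open>The spaces of bounded functions of class one\<close>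

lemma derivs_simps: "derivs [] f = f" "derivs [i] f = dpartial i f"
  by (simp_all add: derivs_def)

lemma grad_nth: "grad f x $ i = dpartial i f x"
  by (simp add: grad_def)

lemma lists_length_1: "{is. length is = Suc 0} = range (\<lambda>i. [i])"
  by (auto simp: length_Suc_conv)

lemma Cb_1_iff:
  "f \<in> Cb 1 \<longleftrightarrow> (\<forall>x. f differentiable at x) \<and> bounded (range f) \<and> continuous_on UNIV (grad f) \<and> bounded (range (grad f))"
  (is "?L \<longleftrightarrow> ?R")
proof
  assume L: ?L
  then have d: "f differentiable at x" for x
    by (auto simp: Cb_def dest!: spec[of _ "[]"] simp: derivs_simps)
  have *: "continuous_on UNIV (derivs is f) \<and> bounded (range (derivs is f))" if "length is \<le> 1" for "is"
    using L that by (auto simp: Cb_def)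
  have c: "continuous_on UNIV (dpartial i f)" and b: "bounded (range (dpartial i f))" for i
    using *[of "[i]"] by (auto simp: derivs_simps)
  have "continuous_on UNIV (grad f)"
    unfolding grad_def[abs_def] by (intro continuous_on_vec_lambda c)
  moreover have "bounded (range (grad f))"
  proof -
    have "\<forall>i. \<exists>B. \<forall>x. \<bar>dpartial i f x\<bar> \<le> B" using b by (auto simp: bounded_iff)
    then obtain B where B: "\<And>i x. \<bar>dpartial i f x\<bar> \<le> B i" by metis
    have "norm (grad f x) \<le> (\<Sum>i\<in>UNIV. B i)" for x
      by (rule order_trans[OF norm_le_l1_cart sum_mono]) (simp add: grad_nth B)
    then show ?thesis by (auto simp: bounded_iff)
  qed
  ultimately show ?R using d *[of "[]"] by (auto simp: derivs_simps)
next
  assume R: ?R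
  have c0: "continuous_on UNIV f"
    using R by (intro continuous_at_imp_continuous_on ballI differentiable_imp_continuous_within) auto
  have c: "continuous_on UNIV (dpartial i f)" for i
    using continuous_on_component[of UNIV "grad f" i] R by (simp add: grad_nth)
  have b: "bounded (range (dpartial i f))" for i
  proof -
    obtain B where B: "\<And>x. norm (grad f x) \<le> B" using R by (auto simp: bounded_iff)
    have "\<bar>dpartial i f x\<bar> \<le> B" for x
      using component_le_norm_cart[of "grad f x" i] B[of x] by (simp add: grad_nth)
    then show ?thesis by (auto simp: bounded_iff)
  qed
  have "is = [] \<or> (\<exists>i. is = [i])" if "length is \<le> 1" for "is" :: "'a list"
    using that by (cases "is") auto
  then show ?L unfolding Cb_def using R c0 c b
    by (auto simp: derivs_simps) (metis derivs_simps)+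
qed

text \<open>The simplifier rewrites the numeral 1 on the naturals to \<open>Suc 0\<close>.\<close>
lemmas Cb_1_simp = Cb_1_iff[unfolded One_nat_def]

lemma sup_norm_upper:
  assumes "bounded (range f)"
  shows "norm (f x) \<le> sup_norm f"
proof -
  obtain B where "\<And>x. norm (f x) \<le> B" using assms by (auto simp: bounded_iff)
  then have "bdd_above (range (\<lambda>x. norm (f x)))" by (intro bdd_aboveI2)
  then show ?thesis unfolding sup_norm_def by (rule cSUP_upper2[where x=x]) auto
qed

lemma sup_norm_least: "(\<And>x. norm (f x) \<le> B) \<Longrightarrow> sup_norm f \<le> B"
  unfolding sup_norm_def by (rule cSUP_least) auto

lemma sup_norm_nonneg: "bounded (range f) \<Longrightarrow> 0 \<le> sup_norm f"
  using sup_norm_upper[of f undefined] norm_ge_zero order_trans by blast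

lemma sup_norm_le_add:
  assumes "bounded (range g)" and "\<And>x. norm (f x - g x) \<le> e"
  shows "sup_norm f \<le> sup_norm g + e"
proof (rule sup_norm_least)
  show "norm (f x) \<le> sup_norm g + e" for x
    using norm_triangle_sub[of "f x" "g x"] sup_norm_upper[OF assms(1), of x] assms(2)[of x] by linarith
qed

lemma Cb_norm_1: "Cb_norm 1 f = sup_norm f + (MAX i. sup_norm (dpartial i f))"
proof -
  have "{..1::nat} = {0, 1}" by auto
  then show ?thesis by (simp add: Cb_norm_def lists_length_1 image_image derivs_simps)
qed

lemmas Cb_norm_1_simp = Cb_norm_1[unfolded One_nat_def]

lemma Cb_norm_1_le:
  assumes "\<And>x. \<bar>f x\<bar> \<le> e" and "\<And>x. norm (grad f x) \<le> e'"
  shows "Cb_norm 1 f \<le> e + e'"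
proof -
  have "sup_norm (dpartial i f) \<le> e'" for i
    using component_le_norm_cart[of "grad f x" i for x] assms(2)
    by (intro sup_norm_least) (auto simp: grad_nth intro: order_trans)
  then have "(MAX i. sup_norm (dpartial i f)) \<le> e'" by (subst Max_le_iff) auto
  moreover have "sup_norm f \<le> e" using assms(1) by (intro sup_norm_least) auto
  ultimately show ?thesis unfolding Cb_norm_1 by linarith
qed

lemma Cb_1_dpartial_bounded: "f \<in> Cb 1 \<Longrightarrow> bounded (range (dpartial i f))"
  by (auto simp: Cb_def dest!: spec[of _ "[i]"] simp: derivs_simps)

lemma Cb_norm_1_bounds:
  fixes f :: "real^'d::finite \<Rightarrow> real"
  assumes f: "f \<in> Cb 1"
  shows "\<bar>f x\<bar> \<le> Cb_norm 1 f" "norm (grad f x) \<le> CARD('d) * Cb_norm 1 f"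
proof -
  have b: "bounded (range f)" using f by (simp add: Cb_1_simp)
  have m: "sup_norm (dpartial i f) \<le> (MAX i. sup_norm (dpartial i f))" for i
    by (rule Max_ge) auto
  have m0: "0 \<le> (MAX i. sup_norm (dpartial i f))"
    using sup_norm_nonneg[OF Cb_1_dpartial_bounded[OF f]] m order_trans by blast
  show "\<bar>f x\<bar> \<le> Cb_norm 1 f"
    using sup_norm_upper[OF b, of x] m0 by (simp add: Cb_norm_1_simp)
  have "\<bar>grad f x $ i\<bar> \<le> Cb_norm 1 f" for i
    using sup_norm_upper[OF Cb_1_dpartial_bounded[OF f], of i x] m[of i] sup_norm_nonneg[OF b]
    unfolding Cb_norm_1 grad_nth real_norm_def by linarith
  then have "(\<Sum>i\<in>UNIV. \<bar>grad f x $ i\<bar>) \<le> (\<Sum>i\<in>(UNIV::'d set). Cb_norm 1 f)" by (intro sum_mono) auto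
  then show "norm (grad f x) \<le> CARD('d) * Cb_norm 1 f"
    using norm_le_l1_cart[of "grad f x"] by simp
qed

lemma grad_diff:
  assumes "f differentiable at x" "g differentiable at x"
  shows "grad (\<lambda>x. f x - g x) x = grad f x - grad g x"
proof (rule grad_eqI)
  show "((\<lambda>x. f x - g x) has_derivative (\<lambda>h. (grad f x - grad g x) \<bullet> h)) (at x)"
    unfolding inner_diff_left by (intro has_derivative_diff has_derivative_grad assms)
qed

lemma Cb_1_diff:
  assumes "f \<in> Cb 1" "g \<in> Cb 1"
  shows "(\<lambda>x. f x - g x) \<in> Cb 1"
proof -
  have d: "f differentiable at x" "g differentiable at x" for x using assms by (auto simp: Cb_1_simp)
  have "grad (\<lambda>x. f x - g x) = (\<lambda>x. grad f x - grad g x)" using d by (auto simp: grad_diff)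
  then show ?thesis using assms d
    by (auto simp: Cb_1_simp intro!: continuous_intros bounded_minus_comp)
qed

lemma joint_continuity_of_uniform_time_continuity:
  fixes g :: "real \<Rightarrow> 'x::metric_space \<Rightarrow> 'b::real_normed_vector"
  assumes c: "\<And>t. t \<in> A \<Longrightarrow> continuous_on UNIV (g t)"
    and u: "\<And>t e. t \<in> A \<Longrightarrow> 0 < e \<Longrightarrow> \<exists>d>0. \<forall>s\<in>A. \<bar>s - t\<bar> < d \<longrightarrow> (\<forall>x. norm (g s x - g t x) \<le> e)"
  shows "continuous_on (A \<times> UNIV) (\<lambda>(t, x). g t x)"
  unfolding continuous_on_iff
proof (intro ballI allI impI)
  fix z and e :: real assume z: "z \<in> A \<times> (UNIV :: 'x set)" and e: "0 < e"
  obtain t x where zt: "z = (t, x)" "t \<in> A" using z by auto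
  obtain d1 where d1: "0 < d1" "\<And>s y. s \<in> A \<Longrightarrow> \<bar>s - t\<bar> < d1 \<Longrightarrow> norm (g s y - g t y) \<le> e / 2"
    using u[OF zt(2), of "e/2"] e by auto
  obtain d2 where d2: "0 < d2" "\<And>y. dist y x < d2 \<Longrightarrow> dist (g t y) (g t x) < e / 2"
    using c[OF zt(2)] e unfolding continuous_on_iff by (meson UNIV_I half_gt_zero)
  show "\<exists>d>0. \<forall>z'\<in>A \<times> UNIV. dist z' z < d \<longrightarrow> dist (case z' of (t, x) \<Rightarrow> g t x) (case z of (t, x) \<Rightarrow> g t x) < e"
  proof (intro exI[of _ "min d1 d2"] conjI ballI impI)
    fix z' assume z': "z' \<in> A \<times> (UNIV :: 'x set)" "dist z' z < min d1 d2"
    obtain s y where sy: "z' = (s, y)" "s \<in> A" using z' by auto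
    have "dist s t < d1" "dist y x < d2"
      using z'(2) dist_fst_le[of z' z] dist_snd_le[of z' z] by (auto simp: sy zt)
    then have "norm (g s y - g t y) \<le> e / 2" "dist (g t y) (g t x) < e / 2"
      using d1(2)[OF sy(2), of y] d2(2)[of y] by (auto simp: dist_real_def)
    then have "dist (g s y) (g t x) < e"
      using dist_triangle[of "g s y" "g t x" "g t y"] by (simp add: dist_norm)
    then show "dist (case z' of (t, x) \<Rightarrow> g t x) (case z of (t, x) \<Rightarrow> g t x) < e" by (simp add: sy zt)
  qed (use d1 d2 in simp)
qed

lemma continuous_into_CbI:
  assumes Cb: "\<And>t. t \<in> {0<..T} \<Longrightarrow> u t \<in> Cb 1"
    and c0: "\<And>t e. t \<in> {0<..T} \<Longrightarrow> 0 < e \<Longrightarrow> \<exists>d>0. \<forall>s\<in>{0<..T}. \<bar>s - t\<bar> < d \<longrightarrow> (\<forall>x. norm (u s x - u t x) \<le> e)"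
    and c1: "\<And>t e. t \<in> {0<..T} \<Longrightarrow> 0 < e \<Longrightarrow> \<exists>d>0. \<forall>s\<in>{0<..T}. \<bar>s - t\<bar> < d \<longrightarrow> (\<forall>x. norm (grad (u s) x - grad (u t) x) \<le> e)"
  shows "continuous_into_Cb 1 T u"
  unfolding continuous_into_Cb_def
proof (intro ballI conjI)
  fix t assume t: "t \<in> {0<..T}"
  show "u t \<in> Cb 1" by (rule Cb[OF t])
  show "((\<lambda>s. Cb_norm 1 (\<lambda>x. u s x - u t x)) \<longlongrightarrow> 0) (at t within {0<..T})"
  proof (rule tendstoI)
    fix e :: real assume e: "0 < e"
    obtain d0 where d0: "0 < d0" "\<And>s x. s \<in> {0<..T} \<Longrightarrow> \<bar>s - t\<bar> < d0 \<Longrightarrow> norm (u s x - u t x) \<le> e / 3"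
      using c0[OF t, of "e/3"] e by auto
    obtain d1 where d1: "0 < d1" "\<And>s x. s \<in> {0<..T} \<Longrightarrow> \<bar>s - t\<bar> < d1 \<Longrightarrow> norm (grad (u s) x - grad (u t) x) \<le> e / 3"
      using c1[OF t, of "e/3"] e by auto
    show "\<forall>\<^sub>F s in at t within {0<..T}. dist (Cb_norm 1 (\<lambda>x. u s x - u t x)) 0 < e"
      unfolding eventually_at
    proof (intro exI[of _ "min d0 d1"] conjI ballI impI)
      fix s assume s: "s \<in> {0<..T}" "s \<noteq> t \<and> dist s t < min d0 d1"
      have df: "u s differentiable at x" "u t differentiable at x" for x
        using Cb[OF s(1)] Cb[OF t] by (auto simp: Cb_1_simp)
      have "Cb_norm 1 (\<lambda>x. u s x - u t x) \<le> e / 3 + e / 3"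
        using d0(2)[OF s(1)] d1(2)[OF s(1)] s(2) df by (intro Cb_norm_1_le) (auto simp: grad_diff dist_real_def)
      moreover have "0 \<le> Cb_norm 1 (\<lambda>x. u s x - u t x)"
        using Cb_norm_1_bounds(1)[OF Cb_1_diff[OF Cb[OF s(1)] Cb[OF t]], of undefined] by linarith
      ultimately show "dist (Cb_norm 1 (\<lambda>x. u s x - u t x)) 0 < e" using e by simp
    qed (use d0 d1 in simp)
  qed
qed

lemma continuous_into_Cb_grad:
  fixes u :: "real \<Rightarrow> real^'d::finite \<Rightarrow> real"
  assumes u: "continuous_into_Cb 1 T u" and t: "t \<in> {0<..T}" and e: "0 < e"
  shows "\<exists>d>0. \<forall>s\<in>{0<..T}. \<bar>s - t\<bar> < d \<longrightarrow> (\<forall>x. norm (grad (u s) x - grad (u t) x) \<le> e)"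
proof -
  have Cb: "u t \<in> Cb 1" if "t \<in> {0<..T}" for t using u that by (simp add: continuous_into_Cb_def)
  have "((\<lambda>s. Cb_norm 1 (\<lambda>x. u s x - u t x)) \<longlongrightarrow> 0) (at t within {0<..T})"
    using u t by (simp add: continuous_into_Cb_def)
  then have "\<forall>\<^sub>F s in at t within {0<..T}. dist (Cb_norm 1 (\<lambda>x. u s x - u t x)) 0 < e / CARD('d)"
    using e by (intro tendstoD) auto
  then obtain d where d: "0 < d" "\<And>s. s \<in> {0<..T} \<Longrightarrow> s \<noteq> t \<Longrightarrow> dist s t < d \<Longrightarrow> dist (Cb_norm 1 (\<lambda>x. u s x - u t x)) 0 < e / CARD('d)"
    unfolding eventually_at by auto
  show ?thesis
  proof (intro exI[of _ d] conjI ballI impI allI d(1))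
    fix s x assume s: "s \<in> {0<..T}" "\<bar>s - t\<bar> < d"
    show "norm (grad (u s) x - grad (u t) x) \<le> e"
    proof (cases "s = t")
      case False
      have df: "u s differentiable at x" "u t differentiable at x" using Cb[OF s(1)] Cb[OF t] by (auto simp: Cb_1_simp)
      have "norm (grad (u s) x - grad (u t) x) = norm (grad (\<lambda>x. u s x - u t x) x)" using df by (simp add: grad_diff)
      also have "\<dots> \<le> CARD('d) * Cb_norm 1 (\<lambda>x. u s x - u t x)"
        by (intro Cb_norm_1_bounds Cb_1_diff Cb s t)
      also have "\<dots> \<le> CARD('d) * (e / CARD('d))"
        using d(2)[OF s(1) False] s(2) by (intro mult_left_mono) (auto simp: dist_real_def)
      finally show ?thesis by simp
    qed (use e in simp)
  qed
qed

text \<open>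
  The growth condition controls the gradient near time 0 only; away from 0 its sup norm is a continuous
  function of time on a compact interval.
\<close>
lemma gradient_blowup_bound:
  fixes v :: "real \<Rightarrow> real^'d::finite \<Rightarrow> real"
  assumes v: "continuous_into_Cb 1 T v" and th: "0 \<le> th" and T: "0 < T"
    and O: "(\<lambda>t. sup_norm (grad (v t))) \<in> O[at_right 0](\<lambda>t. t powr (- th))"
  obtains R where "\<And>t x. t \<in> {0<..T} \<Longrightarrow> norm (grad (v t) x) \<le> R * t powr (- th)"
proof -
  have Cb: "v t \<in> Cb 1" if "t \<in> {0<..T}" for t using v that by (simp add: continuous_into_Cb_def)
  have bg: "bounded (range (grad (v t)))" if "t \<in> {0<..T}" for t using Cb[OF that] by (simp add: Cb_1_simp)
  obtain C where C: "0 < C" "\<forall>\<^sub>F t in at_right 0. norm (sup_norm (grad (v t))) \<le> C * norm (t powr (- th))"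
    using O by (auto elim!: landau_o.bigE)
  then obtain \<epsilon> where \<epsilon>: "0 < \<epsilon>" "\<And>t. 0 < t \<Longrightarrow> t < \<epsilon> \<Longrightarrow> norm (sup_norm (grad (v t))) \<le> C * norm (t powr (- th))"
    by (auto simp: eventually_at_right_field)
  define m where "m = min \<epsilon> T / 2"
  have m: "0 < m" "m < \<epsilon>" "m < T" using \<epsilon> T by (auto simp: m_def)
  define N where "N t = sup_norm (grad (v t))" for t
  have "continuous_on {m..T} N"
    unfolding continuous_on_iff
  proof (intro ballI allI impI)
    fix t e :: real assume t: "t \<in> {m..T}" and e: "0 < e"
    have t': "t \<in> {0<..T}" using t m by auto
    obtain d where d: "0 < d" "\<And>s x. s \<in> {0<..T} \<Longrightarrow> \<bar>s - t\<bar> < d \<Longrightarrow> norm (grad (v s) x - grad (v t) x) \<le> e / 2"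
      using continuous_into_Cb_grad[OF v t', of "e/2"] e by auto
    show "\<exists>d>0. \<forall>s\<in>{m..T}. dist s t < d \<longrightarrow> dist (N s) (N t) < e"
    proof (intro exI[of _ d] conjI ballI impI d(1))
      fix s assume s: "s \<in> {m..T}" "dist s t < d"
      have s': "s \<in> {0<..T}" using s m by auto
      have n: "norm (grad (v s) x - grad (v t) x) \<le> e / 2" for x using d(2)[OF s'] s by (auto simp: dist_real_def)
      have "N s \<le> N t + e / 2" "N t \<le> N s + e / 2"
        unfolding N_def using n by (intro sup_norm_le_add bg t' s'; simp add: norm_minus_commute)+
      then show "dist (N s) (N t) < e" using e by (auto simp: dist_real_def abs_less_iff)
    qed
  qed
  then have "bounded (N ` {m..T})" by (intro compact_imp_bounded compact_continuous_image) auto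
  then obtain B where B: "\<And>t. t \<in> {m..T} \<Longrightarrow> \<bar>N t\<bar> \<le> B"
    unfolding bounded_iff by (metis imageI real_norm_def)
  have B0: "0 \<le> B" using B[of T] m by auto
  show thesis
  proof (rule that[of "C + B * T powr th"])
    fix t x assume t: "t \<in> {0<..T}"
    have p: "1 \<le> T powr th * t powr (- th)"
    proof -
      have "t powr th \<le> T powr th" using t th by (intro powr_mono2) auto
      then show ?thesis using t by (simp add: powr_minus divide_simps)
    qed
    have le: "norm (grad (v t) x) \<le> N t" unfolding N_def by (rule sup_norm_upper[OF bg[OF t]])
    show "norm (grad (v t) x) \<le> (C + B * T powr th) * t powr (- th)"
    proof (cases "t < \<epsilon>")
      case True
      then have "N t \<le> C * t powr (- th)" using \<epsilon>(2)[of t] t by (simp add: N_def)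
      also have "\<dots> \<le> (C + B * T powr th) * t powr (- th)" using B0 by (intro mult_right_mono) auto
      finally show ?thesis using le by simp
    next
      case False
      then have "N t \<le> B" using B[of t] m t by auto
      also have "B \<le> B * (T powr th * t powr (- th))" using mult_left_mono[OF p B0] by simp
      also have "\<dots> \<le> (C + B * T powr th) * t powr (- th)" using C(1) by (simp add: algebra_simps)
      finally show ?thesis using le by simp
    qed
  qed
qed

section \<open>The nonlinear problem\<close>

text \<open>
  Here \<open>th\<close> stands for the blow-up rate \<open>\<theta> = (1 - \<delta>)/\<alpha>\<close>; the regularity of \<open>u0\<close> enters only through the
  bound on \<open>G\<^sub>t u0\<close>, and the relation between \<open>r\<close>, \<open>\<alpha>\<close> and \<open>\<delta>\<close> only through \<open>subcritical\<close> and \<open>r * th < 1\<close>.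
\<close>
locale hamilton_jacobi = smoothing_kernel p \<psi> Tm a c0
  for p :: "real \<Rightarrow> real^'d::finite \<Rightarrow> real" and \<psi> Tm a c0 +
  fixes H :: "real \<Rightarrow> real^'d \<Rightarrow> real^'d \<Rightarrow> real" and u0 :: "real^'d \<Rightarrow> real" and r H0 L th C0 B0 :: real
  assumes H_cont: "continuous_on ({0<..Tm} \<times> UNIV \<times> UNIV) (\<lambda>(t, x, q). H t x q)"
    and r: "1 \<le> r" and H0: "0 < H0" and L: "0 < L"
    and H_bound: "\<And>t x. t \<in> {0<..<Tm} \<Longrightarrow> \<bar>H t x 0\<bar> \<le> H0"
    and H_Lipschitz: "\<And>t x q q'. t \<in> {0<..<Tm} \<Longrightarrow>
      \<bar>H t x q - H t x q'\<bar> \<le> L * (1 + (norm q)\<^sup>2 + (norm q')\<^sup>2) powr ((r - 1) / 2) * norm (q - q')"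
    and th: "0 \<le> th" "r * th < 1" and subcritical: "a + (r - 1) * th < 1"
    and u0: "bounded_by B0 u0"
    and C0: "0 \<le> C0" "\<And>t x. 0 < t \<Longrightarrow> t \<le> Tm \<Longrightarrow> norm (G t u0 x) \<le> C0 * t powr (- th)"
begin

text \<open>
  Candidates for the gradient of a solution. The unknown of the fixed point problem is \<open>w = Du\<close>, since
  the right-hand side of the Duhamel formula depends on \<open>u\<close> through its gradient only.
\<close>
definition gradient_profile :: "real \<Rightarrow> real \<Rightarrow> (real \<Rightarrow> real^'d \<Rightarrow> real^'d) \<Rightarrow> bool" where
  "gradient_profile T R w \<longleftrightarrow> continuous_on ({0<..<T} \<times> UNIV) (\<lambda>(s, y). w s y) \<and>
     (\<forall>s\<in>{0<..<T}. \<forall>y. norm (w s y) \<le> R * s powr (- th))"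

definition nonlinearity :: "(real \<Rightarrow> real^'d \<Rightarrow> real^'d) \<Rightarrow> real \<Rightarrow> real^'d \<Rightarrow> real" where
  "nonlinearity w s y = H s y (w s y)"

definition evolve :: "(real \<Rightarrow> real^'d \<Rightarrow> real^'d) \<Rightarrow> real \<Rightarrow> real^'d \<Rightarrow> real" where
  "evolve w t x = P t u0 x + duhamel P (nonlinearity w) t x"

definition evolve_grad :: "(real \<Rightarrow> real^'d \<Rightarrow> real^'d) \<Rightarrow> real \<Rightarrow> real^'d \<Rightarrow> real^'d" where
  "evolve_grad w t x = G t u0 x + duhamel G (nonlinearity w) t x"

definition lip_const :: "real \<Rightarrow> real" where "lip_const R = L * (3 * R\<^sup>2) powr ((r - 1) / 2)"

definition growth_const :: "real \<Rightarrow> real" where "growth_const R = H0 + lip_const R * R"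

lemma lip_const_nonneg: "0 \<le> lip_const R"
  using L by (simp add: lip_const_def)

lemma growth_const_nonneg: "0 \<le> R \<Longrightarrow> 0 \<le> growth_const R"
  using H0 lip_const_nonneg by (simp add: growth_const_def add_nonneg_nonneg)

lemma rth: "0 \<le> r * th" "r * th < 1"
  using r th by auto

text \<open>
  Since \<open>s \<le> 1 \<le> R\<close>, the number \<open>z = R s powr (- \<theta>)\<close> is at least 1, which absorbs the constant in
  \<open>1 + \<bar>q\<bar>\<^sup>2 + \<bar>q'\<bar>\<^sup>2 \<le> 3 z\<^sup>2\<close>.
\<close>
lemma H_local_Lipschitz:
  assumes s: "0 < s" "s < Tm" "s \<le> 1" and R: "1 \<le> R"
    and q: "norm q \<le> R * s powr (- th)" "norm q' \<le> R * s powr (- th)"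
  shows "\<bar>H s y q - H s y q'\<bar> \<le> lip_const R * s powr (- ((r - 1) * th)) * norm (q - q')"
proof -
  define z where "z = R * s powr (- th)"
  have "1 \<le> s powr (- th)" using s th by (simp add: powr_minus one_le_inverse_iff powr_le1)
  then have z: "1 \<le> z" using mult_mono[OF R, of 1 "s powr (- th)"] R by (simp add: z_def)
  have q2: "(norm q)\<^sup>2 \<le> z\<^sup>2" "(norm q')\<^sup>2 \<le> z\<^sup>2" using q by (auto simp: z_def intro: power_mono)
  have "1 \<le> z\<^sup>2" using z by (simp add: one_le_power)
  then have "1 + (norm q)\<^sup>2 + (norm q')\<^sup>2 \<le> 3 * z\<^sup>2" using q2 by linarith
  then have "(1 + (norm q)\<^sup>2 + (norm q')\<^sup>2) powr ((r - 1) / 2) \<le> (3 * z\<^sup>2) powr ((r - 1) / 2)"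
    using r by (intro powr_mono2) auto
  also have "\<dots> = (3 * R\<^sup>2) powr ((r - 1) / 2) * s powr (- ((r - 1) * th))"
  proof -
    have "(s powr (- th))\<^sup>2 = s powr (- 2 * th)" using s by (simp add: powr_power)
    then have "3 * z\<^sup>2 = (3 * R\<^sup>2) * s powr (- 2 * th)" by (simp add: z_def power_mult_distrib)
    then have "(3 * z\<^sup>2) powr ((r - 1) / 2) = (3 * R\<^sup>2) powr ((r - 1) / 2) * (s powr (- 2 * th)) powr ((r - 1) / 2)"
      by (simp only: powr_mult)
    also have "(s powr (- 2 * th)) powr ((r - 1) / 2) = s powr (- ((r - 1) * th))"
      unfolding powr_powr by (rule arg_cong[where f="\<lambda>x. s powr x"]) (simp add: field_simps)
    finally show ?thesis .
  qed
  finally have *: "(1 + (norm q)\<^sup>2 + (norm q')\<^sup>2) powr ((r - 1) / 2) \<le> (3 * R\<^sup>2) powr ((r - 1) / 2) * s powr (- ((r - 1) * th))" .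
  have "\<bar>H s y q - H s y q'\<bar> \<le> L * (1 + (norm q)\<^sup>2 + (norm q')\<^sup>2) powr ((r - 1) / 2) * norm (q - q')"
    using s by (intro H_Lipschitz) auto
  also have "\<dots> \<le> L * ((3 * R\<^sup>2) powr ((r - 1) / 2) * s powr (- ((r - 1) * th))) * norm (q - q')"
    using L * by (intro mult_right_mono mult_left_mono) auto
  finally show ?thesis by (simp add: lip_const_def mult.assoc)
qed

lemma powr_th_combine: "0 < s \<Longrightarrow> s powr (- ((r - 1) * th)) * s powr (- th) = s powr (- (r * th))"
  by (simp add: powr_add[symmetric] algebra_simps)

lemma nonlinearity_admissible:
  assumes w: "gradient_profile T R w" and T: "0 < T" "T \<le> 1" "T \<le> Tm" and R: "1 \<le> R"
  shows "admissible_forcing T (r * th) (growth_const R) (nonlinearity w)"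
  unfolding admissible_forcing_def
proof (intro conjI ballI allI)
  have c: "continuous_on ({0<..<T} \<times> UNIV) (\<lambda>z. w (fst z) (snd z))"
    using w by (simp add: gradient_profile_def case_prod_beta')
  have cH: "continuous_on ({0<..Tm} \<times> UNIV \<times> UNIV) (\<lambda>z. H (fst z) (fst (snd z)) (snd (snd z)))"
    using H_cont by (simp add: case_prod_beta')
  have "continuous_on ({0<..<T} \<times> UNIV) (\<lambda>z. (\<lambda>z. H (fst z) (fst (snd z)) (snd (snd z))) (fst z, snd z, w (fst z) (snd z)))"
    by (rule continuous_on_compose2[OF cH]) (use T in \<open>auto intro!: continuous_intros c\<close>)
  then show "continuous_on ({0<..<T} \<times> UNIV) (\<lambda>(s, y). nonlinearity w s y)"
    by (simp add: nonlinearity_def case_prod_beta')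
  fix s y assume s: "s \<in> {0<..<T}"
  have n: "norm (w s y) \<le> R * s powr (- th)" using w s by (simp add: gradient_profile_def)
  have "\<bar>H s y (w s y) - H s y 0\<bar> \<le> lip_const R * s powr (- ((r - 1) * th)) * norm (w s y - 0)"
    using s T R n by (intro H_local_Lipschitz) auto
  also have "\<dots> \<le> lip_const R * s powr (- ((r - 1) * th)) * (R * s powr (- th))"
    using n lip_const_nonneg by (intro mult_left_mono) auto
  also have "\<dots> = lip_const R * R * s powr (- (r * th))"
    using powr_th_combine[of s] s by (simp add: mult_ac)
  finally have 1: "\<bar>H s y (w s y) - H s y 0\<bar> \<le> lip_const R * R * s powr (- (r * th))" .
  have "1 \<le> s powr (- (r * th))" using s T rth by (simp add: powr_minus one_le_inverse_iff powr_le1)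
  then have "H0 \<le> H0 * s powr (- (r * th))" using H0 by simp
  moreover have "\<bar>H s y 0\<bar> \<le> H0" using s T by (intro H_bound) auto
  ultimately show "\<bar>nonlinearity w s y\<bar> \<le> growth_const R * s powr (- (r * th))"
    using 1 unfolding nonlinearity_def growth_const_def by (simp add: distrib_right abs_le_iff)
qed

lemma nonlinearity_diff_bound:
  assumes w: "gradient_profile T R w" "gradient_profile T R w'" and T: "0 < T" "T \<le> 1" "T \<le> Tm" and R: "1 \<le> R"
    and s: "0 < s" "s < T" and D: "norm (w s y - w' s y) \<le> D * s powr (- th)"
  shows "\<bar>nonlinearity w s y - nonlinearity w' s y\<bar> \<le> lip_const R * D * s powr (- (r * th))"
proof -
  have "\<bar>nonlinearity w s y - nonlinearity w' s y\<bar> \<le> lip_const R * s powr (- ((r - 1) * th)) * norm (w s y - w' s y)"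
    unfolding nonlinearity_def using w s T R by (intro H_local_Lipschitz) (auto simp: gradient_profile_def)
  also have "\<dots> \<le> lip_const R * s powr (- ((r - 1) * th)) * (D * s powr (- th))"
    using D lip_const_nonneg by (intro mult_left_mono) auto
  also have "\<dots> = lip_const R * D * s powr (- (r * th))"
    using powr_th_combine[of s] s by (simp add: mult_ac)
  finally show ?thesis .
qed

lemma nonlinearity_diff_admissible:
  assumes w: "gradient_profile T R w" "gradient_profile T R w'" and T: "0 < T" "T \<le> 1" "T \<le> Tm" and R: "1 \<le> R"
    and D: "\<And>s y. 0 < s \<Longrightarrow> s < T \<Longrightarrow> norm (w s y - w' s y) \<le> D * s powr (- th)"
  shows "admissible_forcing T (r * th) (lip_const R * D) (\<lambda>s y. nonlinearity w s y - nonlinearity w' s y)"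
  using nonlinearity_admissible[OF w(1) T R] nonlinearity_admissible[OF w(2) T R] nonlinearity_diff_bound[OF w T R _ _ D]
  unfolding admissible_forcing_def case_prod_beta' by (auto intro!: continuous_intros)

definition beta_const :: real where "beta_const = Beta (1 - r * th) (1 - a)"

text \<open>
  The power of \<open>T\<close> that the weighted norm gains in one Duhamel step.
\<close>
definition gain :: real where "gain = 1 - a - (r - 1) * th"

lemma gain_pos: "0 < gain" using subcritical by (simp add: gain_def)

lemma beta_const_nonneg: "0 \<le> beta_const"
  using rth a by (simp add: beta_const_def Beta_def Gamma_real_nonneg)

context
  fixes T R w
  assumes w: "gradient_profile T R w" and T: "0 < T" "T \<le> 1" "T \<le> Tm" and R: "1 \<le> R"
begin

private lemmas adm = nonlinearity_admissible[OF w T R]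

lemma evolve_has_derivative:
  assumes t: "t \<in> {0<..T}"
  shows "(evolve w t has_derivative (\<lambda>h. evolve_grad w t x \<bullet> h)) (at x)"
proof -
  have "((\<lambda>x. P t u0 x + duhamel P (nonlinearity w) t x) has_derivative (\<lambda>h. G t u0 x \<bullet> h + duhamel G (nonlinearity w) t x \<bullet> h)) (at x)"
    using t T by (intro has_derivative_add P_has_derivative[OF _ _ u0] duhamel_has_derivative[OF adm _ _ rth]) auto
  then show ?thesis by (simp add: evolve_def[abs_def] evolve_grad_def inner_add_left)
qed

lemma grad_evolve: "t \<in> {0<..T} \<Longrightarrow> grad (evolve w t) x = evolve_grad w t x"
  by (intro grad_eqI evolve_has_derivative)

lemma evolve_grad_bound:
  assumes t: "t \<in> {0<..T}"
  shows "norm (evolve_grad w t x) \<le> (C0 + growth_const R * c0 * beta_const * T powr gain) * t powr (- th)"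
proof -
  have "norm (duhamel G (nonlinearity w) t x) \<le> growth_const R * c0 * (t powr (1 - a - r * th) * beta_const)"
    unfolding beta_const_def using t T by (intro GS.duhamel_bound[OF adm _ _ rth]) auto
  also have "t powr (1 - a - r * th) = t powr gain * t powr (- th)"
    by (simp add: powr_add[symmetric] gain_def algebra_simps)
  also have "growth_const R * c0 * (t powr gain * t powr (- th) * beta_const) \<le> growth_const R * c0 * (T powr gain * t powr (- th) * beta_const)"
    using t gain_pos growth_const_nonneg[of R] R c0 beta_const_nonneg
    by (intro mult_left_mono mult_right_mono powr_mono2) auto
  finally have "norm (duhamel G (nonlinearity w) t x) \<le> growth_const R * c0 * beta_const * T powr gain * t powr (- th)"
    by (simp add: mult_ac)
  moreover have "norm (G t u0 x) \<le> C0 * t powr (- th)" using t T by (intro C0) auto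
  ultimately show ?thesis
    unfolding evolve_grad_def distrib_right by (intro norm_triangle_le add_mono)
qed

lemma evolve_bound:
  assumes t: "t \<in> {0<..T}"
  shows "\<bar>evolve w t x\<bar> \<le> B0 + growth_const R * 1 * (t powr (1 - 0 - r * th) * Beta (1 - r * th) (1 - 0))"
proof -
  have "norm (duhamel P (nonlinearity w) t x) \<le> growth_const R * 1 * (t powr (1 - 0 - r * th) * Beta (1 - r * th) (1 - 0))"
    using t T by (intro PS.duhamel_bound[OF adm _ _ rth]) auto
  moreover have "\<bar>P t u0 x\<bar> \<le> B0" using t by (intro bounded_byD[OF P_bounded[OF _ u0]]) auto
  ultimately show ?thesis unfolding evolve_def by (intro order_trans[OF abs_triangle_ineq add_mono]) auto
qed

lemma evolve_grad_continuous:
  assumes t: "t \<in> {0<..T}"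
  shows "continuous_on UNIV (evolve_grad w t)"
  unfolding evolve_grad_def[abs_def]
  using t T by (intro continuous_on_add G_continuous[OF _ _ u0] GS.duhamel_continuous[OF adm _ _ rth]) auto

lemma evolve_Cb_1:
  assumes t: "t \<in> {0<..T}"
  shows "evolve w t \<in> Cb 1"
proof -
  have "grad (evolve w t) = evolve_grad w t" using grad_evolve[OF t] by auto
  then show ?thesis
    unfolding Cb_1_iff using evolve_has_derivative[OF t] evolve_bound[OF t] evolve_grad_bound[OF t] evolve_grad_continuous[OF t]
    by (auto simp: differentiable_def bounded_iff)
qed

lemma evolve_time_continuous:
  assumes t0: "t0 \<in> {0<..T}" and e: "0 < e"
  shows "\<exists>d>0. \<forall>t\<in>{0<..T}. \<bar>t - t0\<bar> < d \<longrightarrow> (\<forall>x. norm (evolve w t x - evolve w t0 x) \<le> e)"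
    "\<exists>d>0. \<forall>t\<in>{0<..T}. \<bar>t - t0\<bar> < d \<longrightarrow> (\<forall>x. norm (evolve_grad w t x - evolve_grad w t0 x) \<le> e)"
  unfolding evolve_def evolve_grad_def
  by (rule PS.mild_flow_time_continuous[OF adm T(1,3) rth u0 t0 e] GS.mild_flow_time_continuous[OF adm T(1,3) rth u0 t0 e])+

lemma evolve_grad_jointly_continuous: "continuous_on ({0<..T} \<times> UNIV) (\<lambda>(t, x). evolve_grad w t x)"
  by (intro joint_continuity_of_uniform_time_continuity evolve_grad_continuous evolve_time_continuous(2))

lemma evolve_continuous_into_Cb: "continuous_into_Cb 1 T (evolve w)"
proof (rule continuous_into_CbI)
  show "\<exists>d>0. \<forall>s\<in>{0<..T}. \<bar>s - t\<bar> < d \<longrightarrow> (\<forall>x. norm (grad (evolve w s) x - grad (evolve w t) x) \<le> e)"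
    if "t \<in> {0<..T}" "0 < e" for t e
    using evolve_time_continuous(2)[OF that] grad_evolve that(1) by simp
qed (fact evolve_Cb_1, fact evolve_time_continuous(1))

text \<open>
  A fixed point \<open>w\<close> is the gradient of the function that it generates, so the Duhamel formula defining
  \<open>evolve w\<close> becomes the mild equation.
\<close>
lemma evolve_mild_solution:
  assumes fixpt: "\<And>t x. t \<in> {0<..<T} \<Longrightarrow> w t x = evolve_grad w t x"
  shows "mild_solution p H u0 T (evolve w)"
  unfolding mild_solution_def
proof (intro conjI ballI allI)
  show "continuous_into_Cb 1 T (evolve w)" by (rule evolve_continuous_into_Cb)
  fix t x assume t: "t \<in> {0<..T}"
  have eq: "(\<lambda>y. H s y (grad (evolve w s) y)) = nonlinearity w s" if "s \<in> {0<..<t}" for s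
    using that t grad_evolve[of s] fixpt[of s] by (auto simp: nonlinearity_def)
  have "set_integrable lborel {0<..<t} (\<lambda>s. P (t - s) (nonlinearity w s) x)"
    using t T by (intro PS.integrand_integrable[OF adm _ _ rth]) auto
  then show "set_integrable lborel {0<..<t} (\<lambda>s. P (t - s) (\<lambda>y. H s y (grad (evolve w s) y)) x)"
    by (rule set_integrable_cong[THEN iffD1, rotated -1]) (auto simp: eq)
  show "evolve w t x = P t u0 x + (LINT s:{0<..<t}|lborel. P (t - s) (\<lambda>y. H s y (grad (evolve w s) y)) x)"
    unfolding evolve_def[of w t x] duhamel_def
    by (intro arg_cong2[where f="(+)"] refl set_lebesgue_integral_cong) (auto simp: eq)
qed

end

end

section \<open>Existence and uniqueness\<close>

context hamilton_jacobi
begin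

text \<open>
  Bounded continuous functions form a complete metric space as a type over a whole topological space.
  Logarithmic time, frozen at \<open>T\<close> for positive arguments, maps the line onto \<open>(0,T]\<close>, so a profile
  times \<open>t powr \<theta>\<close> becomes such a function and no condition at \<open>t = 0\<close> has to be imposed.
\<close>
definition clock :: "real \<Rightarrow> real \<Rightarrow> real" where "clock T \<sigma> = T * exp (min \<sigma> 0)"

definition unscale :: "real \<Rightarrow> ((real \<times> (real^'d)) \<Rightarrow>\<^sub>C (real^'d)) \<Rightarrow> real \<Rightarrow> real^'d \<Rightarrow> real^'d" where
  "unscale T w s y = s powr (- th) *\<^sub>R apply_bcontfun w (ln (s / T), y)"

definition picard_fun :: "real \<Rightarrow> ((real \<times> (real^'d)) \<Rightarrow>\<^sub>C (real^'d)) \<Rightarrow> real \<times> (real^'d) \<Rightarrow> real^'d" where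
  "picard_fun T w = (\<lambda>(\<sigma>, x). clock T \<sigma> powr th *\<^sub>R evolve_grad (unscale T w) (clock T \<sigma>) x)"

lemma clock_range: "0 < T \<Longrightarrow> clock T \<sigma> \<in> {0<..T}"
  by (auto simp: clock_def mult_le_cancel_left1)

lemma clock_ln: "0 < t \<Longrightarrow> t \<le> T \<Longrightarrow> clock T (ln (t / T)) = t"
  by (simp add: clock_def min_def)

lemma unscale_profile:
  assumes T: "0 < T" and w: "norm w \<le> R"
  shows "gradient_profile T R (unscale T w)"
  unfolding gradient_profile_def
proof (intro conjI ballI allI)
  have "continuous_on ({0<..<T} \<times> UNIV) (\<lambda>z. apply_bcontfun w (ln (fst z / T), snd z))"
    by (rule continuous_on_compose2[OF continuous_on_apply_bcontfun[of UNIV]])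
      (use T in \<open>auto intro!: continuous_intros\<close>)
  then have "continuous_on ({0<..<T} \<times> UNIV) (\<lambda>z. fst z powr (- th) *\<^sub>R apply_bcontfun w (ln (fst z / T), snd z))"
    by (intro continuous_intros) auto
  then show "continuous_on ({0<..<T} \<times> UNIV) (\<lambda>(s, y). unscale T w s y)"
    by (simp add: unscale_def case_prod_beta')
  fix s y
  show "norm (unscale T w s y) \<le> R * s powr (- th)"
    using norm_bounded[of w "(ln (s / T), y)"] w
    by (simp add: unscale_def mult.commute[of R] mult_left_mono)
qed

lemma evolve_grad_diff:
  assumes w: "gradient_profile T R w" "gradient_profile T R w'" and T: "0 < T" "T \<le> 1" "T \<le> Tm" and R: "1 \<le> R"
    and t: "t \<in> {0<..T}"
  shows "evolve_grad w t x - evolve_grad w' t x = duhamel G (\<lambda>s y. nonlinearity w s y - nonlinearity w' s y) t x"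
  using GS.duhamel_diff[OF nonlinearity_admissible[OF w(1) T R] nonlinearity_admissible[OF w(2) T R] T(1,3) rth, of t x] t
  by (simp add: evolve_grad_def)

lemma evolve_grad_diff_bound:
  assumes w: "gradient_profile T R w" "gradient_profile T R w'" and T: "0 < T" "T \<le> 1" "T \<le> Tm" and R: "1 \<le> R"
    and D: "\<And>s y. 0 < s \<Longrightarrow> s < T \<Longrightarrow> norm (w s y - w' s y) \<le> D * s powr (- th)" "0 \<le> D" and t: "t \<in> {0<..T}"
  shows "norm (evolve_grad w t x - evolve_grad w' t x) \<le> (lip_const R * c0 * beta_const * T powr gain) * D * t powr (- th)"
proof -
  have "norm (evolve_grad w t x - evolve_grad w' t x) \<le> lip_const R * D * c0 * (t powr (1 - a - r * th) * beta_const)"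
    unfolding beta_const_def evolve_grad_diff[OF w T R t]
    using t T by (intro GS.duhamel_bound[OF nonlinearity_diff_admissible[OF w T R D(1)] _ _ rth]) auto
  also have "t powr (1 - a - r * th) = t powr gain * t powr (- th)"
    by (simp add: powr_add[symmetric] gain_def algebra_simps)
  also have "lip_const R * D * c0 * (t powr gain * t powr (- th) * beta_const) \<le> lip_const R * D * c0 * (T powr gain * t powr (- th) * beta_const)"
    using t gain_pos lip_const_nonneg c0 beta_const_nonneg D(2)
    by (intro mult_left_mono mult_right_mono powr_mono2) auto
  finally show ?thesis by (simp add: mult_ac)
qed

lemma picard_bcontfun:
  assumes T: "0 < T" "T \<le> 1" "T \<le> Tm" and w: "norm w \<le> R" and R: "1 \<le> R"
  shows "picard_fun T w \<in> bcontfun"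
    "norm (picard_fun T w z) \<le> C0 + growth_const R * c0 * beta_const * T powr gain"
proof -
  note prof = unscale_profile[OF T(1) w]
  have bd: "norm (picard_fun T w z) \<le> C0 + growth_const R * c0 * beta_const * T powr gain" for z
  proof -
    obtain \<sigma> x where z: "z = (\<sigma>, x)" by (cases z)
    define t where "t = clock T \<sigma>"
    have t: "t \<in> {0<..T}" unfolding t_def by (rule clock_range[OF T(1)])
    have "norm (picard_fun T w z) = t powr th * norm (evolve_grad (unscale T w) t x)"
      by (simp add: picard_fun_def z t_def)
    also have "\<dots> \<le> t powr th * ((C0 + growth_const R * c0 * beta_const * T powr gain) * t powr (- th))"
      by (intro mult_left_mono evolve_grad_bound[OF prof T R t]) simp
    also have "\<dots> = C0 + growth_const R * c0 * beta_const * T powr gain"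
      using t by (simp add: powr_minus field_simps)
    finally show ?thesis .
  qed
  then show "norm (picard_fun T w z) \<le> C0 + growth_const R * c0 * beta_const * T powr gain" .
  have c: "continuous_on ({0<..T} \<times> UNIV) (\<lambda>z. evolve_grad (unscale T w) (fst z) (snd z))"
    using evolve_grad_jointly_continuous[OF prof T R] by (simp add: case_prod_beta')
  have "continuous_on UNIV (\<lambda>z. evolve_grad (unscale T w) (clock T (fst z)) (snd z))"
    by (rule continuous_on_compose2[OF c, of UNIV "\<lambda>z. (clock T (fst z), snd z)", simplified])
      (use clock_range[OF T(1)] in \<open>auto simp: clock_def intro!: continuous_intros\<close>)
  then have "continuous_on UNIV (\<lambda>z. clock T (fst z) powr th *\<^sub>R evolve_grad (unscale T w) (clock T (fst z)) (snd z))"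
    using T(1) by (intro continuous_intros) (auto simp: clock_def intro!: continuous_intros)
  then have "continuous_on UNIV (picard_fun T w)"
    by (simp add: picard_fun_def case_prod_beta')
  then show "picard_fun T w \<in> bcontfun" using bd by (rule bcontfun_normI)
qed

lemma small_time:
  assumes K: "0 \<le> K"
  obtains T where "0 < T" "T \<le> 1" "T \<le> Tm" "K * T powr gain \<le> 1 / 2"
proof -
  have "((\<lambda>T. K * T powr gain) \<longlongrightarrow> 0) (at_right 0)"
    using gain_pos by (intro tendsto_mult_right_zero tendsto_zero_powrI[where b=gain] tendsto_eq_intros)
      (auto intro: eventually_mono[OF eventually_at_right_less[of 0]])
  then have "\<forall>\<^sub>F T in at_right 0. K * T powr gain < 1 / 2" by (rule order_tendstoD) simp
  then obtain e where e: "0 < e" "\<And>T. 0 < T \<Longrightarrow> T < e \<Longrightarrow> K * T powr gain < 1 / 2"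
    by (auto simp: eventually_at_right_field)
  define T where "T = min (e / 2) (min 1 Tm)"
  have T: "0 < T" "T < e" "T \<le> 1" "T \<le> Tm" using e Tm by (auto simp: T_def)
  show thesis using e(2)[OF T(1,2)] by (intro that[OF T(1,3,4)]) simp
qed

text \<open>
  The radius exceeds the constant of the free evolution by 1. Then \<open>T\<close> is chosen so small that the
  Duhamel term contributes at most 1 and that the map contracts distances by at least a factor 2.
\<close>
lemma fixed_profile_exists:
  obtains T R w where "0 < T" "T \<le> 1" "T \<le> Tm" "1 \<le> R" "gradient_profile T R w"
    "\<And>t x. t \<in> {0<..T} \<Longrightarrow> w t x = evolve_grad w t x"
proof -
  define R where "R = C0 + 1"
  have R: "1 \<le> R" using C0 by (simp add: R_def)
  define K1 where "K1 = growth_const R * c0 * beta_const"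
  define K2 where "K2 = lip_const R * c0 * beta_const"
  have K: "0 \<le> K1" "0 \<le> K2"
    using growth_const_nonneg[of R] lip_const_nonneg[of R] c0 beta_const_nonneg R by (auto simp: K1_def K2_def)
  obtain T where T: "0 < T" "T \<le> 1" "T \<le> Tm" and Ts: "(K1 + K2) * T powr gain \<le> 1 / 2"
    using small_time[of "K1 + K2"] K by auto
  have Tk: "K1 * T powr gain \<le> 1" "K2 * T powr gain \<le> 1 / 2"
  proof -
    have "0 \<le> K1 * T powr gain" "0 \<le> K2 * T powr gain" using K by auto
    then show "K1 * T powr gain \<le> 1" "K2 * T powr gain \<le> 1 / 2" using Ts by (auto simp: distrib_right)
  qed
  define F where "F w = Bcontfun (picard_fun T w)" for w
  have F: "apply_bcontfun (F w) = picard_fun T w" if "norm w \<le> R" for w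
    unfolding F_def using picard_bcontfun(1)[OF T that R] by (rule Bcontfun_inverse)
  have inball: "norm (F w) \<le> R" if "norm w \<le> R" for w
  proof (rule norm_bound)
    fix z
    have "norm (picard_fun T w z) \<le> C0 + K1 * T powr gain"
      using picard_bcontfun(2)[OF T that R] by (simp add: K1_def)
    then show "norm (apply_bcontfun (F w) z) \<le> R" using Tk unfolding F[OF that] R_def by linarith
  qed
  have contr: "dist (F w) (F w') \<le> 1 / 2 * dist w w'" if w: "norm w \<le> R" "norm w' \<le> R" for w w'
  proof (rule dist_bound)
    fix z :: "real \<times> (real^'d)"
    obtain \<sigma> x where z: "z = (\<sigma>, x)" by (cases z)
    define t where "t = clock T \<sigma>"
    have t: "t \<in> {0<..T}" unfolding t_def by (rule clock_range[OF T(1)])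
    have D: "norm (unscale T w s y - unscale T w' s y) \<le> dist w w' * s powr (- th)" for s y
    proof -
      have "norm (unscale T w s y - unscale T w' s y) = s powr (- th) * dist (apply_bcontfun w (ln (s / T), y)) (apply_bcontfun w' (ln (s / T), y))"
        by (simp add: unscale_def scaleR_diff_right[symmetric] dist_norm)
      also have "\<dots> \<le> s powr (- th) * dist w w'" by (intro mult_left_mono dist_bounded) simp
      finally show ?thesis by (simp add: mult.commute)
    qed
    have "dist (apply_bcontfun (F w) z) (apply_bcontfun (F w') z) =
        t powr th * norm (evolve_grad (unscale T w) t x - evolve_grad (unscale T w') t x)"
      by (simp add: F w picard_fun_def z t_def dist_norm scaleR_diff_right[symmetric])
    also have "\<dots> \<le> t powr th * ((K2 * T powr gain) * dist w w' * t powr (- th))"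
      unfolding K2_def
      by (intro mult_left_mono evolve_grad_diff_bound[OF unscale_profile[OF T(1) w(1)] unscale_profile[OF T(1) w(2)] T R D _ t]) auto
    also have "\<dots> = (K2 * T powr gain) * dist w w'"
      using t by (simp add: powr_minus field_simps)
    also have "\<dots> \<le> 1 / 2 * dist w w'" using Tk by (intro mult_right_mono) auto
    finally show "dist (apply_bcontfun (F w) z) (apply_bcontfun (F w') z) \<le> 1 / 2 * dist w w'" .
  qed
  have "\<exists>!w. w \<in> cball 0 R \<and> F w = w"
    by (rule Banach_fix[OF complete_eq_closed[THEN iffD2, OF closed_cball], where c="1/2"])
      (use R inball contr in auto)
  then obtain w where w: "norm w \<le> R" "F w = w" by auto
  show thesis
  proof (rule that[OF T R unscale_profile[OF T(1) w(1)]])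
    fix t x assume t: "t \<in> {0<..T}"
    have "unscale T w t x = t powr (- th) *\<^sub>R apply_bcontfun (F w) (ln (t / T), x)"
      by (simp add: unscale_def w(2))
    also have "\<dots> = evolve_grad (unscale T w) t x"
      using t by (simp add: F w(1) picard_fun_def clock_ln powr_minus)
    finally show "unscale T w t x = evolve_grad (unscale T w) t x" .
  qed
qed

text \<open>
  Let \<open>M\<close> be the supremum of \<open>exp (- \<lambda> t) t powr \<theta> \<bar>w - w'\<bar>\<close>. Giving away half of the gain in the
  exponent, \<open>\<nu> = gain / 2\<close>, leaves integrable singularities and produces \<open>\<lambda> powr (- \<nu>)\<close>, so that \<open>M \<le> M / 2\<close>
  for large \<open>\<lambda>\<close>, however large \<open>R\<close> is.
\<close>
lemma fixed_profile_unique: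
  assumes w: "gradient_profile T R w" "gradient_profile T R w'" and T: "0 < T" "T \<le> 1" "T \<le> Tm" and R: "1 \<le> R"
    and eq: "\<And>t x. t \<in> {0<..T} \<Longrightarrow> w t x = evolve_grad w t x" "\<And>t x. t \<in> {0<..T} \<Longrightarrow> w' t x = evolve_grad w' t x"
    and t: "t \<in> {0<..T}"
  shows "w t x = w' t x"
proof -
  define nu where "nu = gain / 2"
  have gain_le: "gain \<le> 1 - a" using r th by (simp add: gain_def)
  have nu: "0 < nu" "nu \<le> 1" "a + nu < 1" using gain_pos gain_le a by (auto simp: nu_def)
  define Bt where "Bt = Beta (1 - r * th) (1 - (a + nu))"
  have Bt: "0 \<le> Bt" using rth nu by (simp add: Bt_def Beta_def Gamma_real_nonneg)
  define A where "A = lip_const R * c0 * Bt"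
  have A: "0 \<le> A" using lip_const_nonneg c0 Bt by (simp add: A_def)
  have "((\<lambda>lam. A * lam powr (- nu)) \<longlongrightarrow> 0) at_top"
    using nu by (intro tendsto_mult_right_zero tendsto_neg_powr filterlim_ident) auto
  then have "\<forall>\<^sub>F lam in at_top. A * lam powr (- nu) < 1 / 2" by (rule order_tendstoD) simp
  then have "\<forall>\<^sub>F lam in at_top. 0 < lam \<and> A * lam powr (- nu) < 1 / 2"
    using eventually_gt_at_top[of "0::real"] by eventually_elim simp
  then obtain lam where lam: "0 < lam" "A * lam powr (- nu) < 1 / 2"
    using eventually_happens trivial_limit_at_top_linorder by blast
  define W where "W = (\<lambda>(s, y). exp (- lam * s) * s powr th * norm (w s y - w' s y))"
  define M where "M = (SUP z\<in>{0<..<T} \<times> UNIV. W z)"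
  have diff: "norm (w s y - w' s y) \<le> 2 * R * s powr (- th)" if "0 < s" "s < T" for s y
  proof -
    have "norm (w s y) \<le> R * s powr (- th)" "norm (w' s y) \<le> R * s powr (- th)"
      using w that by (auto simp: gradient_profile_def)
    then show ?thesis using norm_triangle_ineq4[of "w s y" "w' s y"] by linarith
  qed
  have W_le: "W (s, y) \<le> 2 * R" if s: "0 < s" "s < T" for s y
  proof -
    have "W (s, y) \<le> 1 * s powr th * (2 * R * s powr (- th))"
      unfolding W_def prod.case using s lam by (intro mult_mono diff) auto
    also have "\<dots> = 2 * R" using s by (simp add: powr_minus field_simps)
    finally show ?thesis .
  qed
  have bdd: "bdd_above (W ` ({0<..<T} \<times> UNIV))"
    by (intro bdd_aboveI2[of _ _ "2 * R"]) (use W_le in auto)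
  have W_M: "W (s, y) \<le> M" if "0 < s" "s < T" for s y
    unfolding M_def using that bdd by (intro cSUP_upper) auto
  have M_diff: "norm (w s y - w' s y) \<le> M * exp (lam * s) * s powr (- th)" if s: "0 < s" "s < T" for s y
  proof -
    have "norm (w s y - w' s y) = W (s, y) * exp (lam * s) * s powr (- th)"
      using s by (simp add: W_def powr_minus exp_minus field_simps)
    also have "\<dots> \<le> M * exp (lam * s) * s powr (- th)" by (intro mult_right_mono W_M s) auto
    finally show ?thesis .
  qed
  have M0: "0 \<le> M" using W_M[of "T/2" 0] T by (auto simp: W_def intro: order_trans[rotated])
  have main: "norm (w t x - w' t x) \<le> 1 / 2 * M * exp (lam * t) * t powr (- th)" if t: "t \<in> {0<..T}" for t x
  proof -
    have "w t x - w' t x = duhamel G (\<lambda>s y. nonlinearity w s y - nonlinearity w' s y) t x"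
      unfolding eq[OF t] by (rule evolve_grad_diff[OF w T R t])
    also have "norm \<dots> \<le> (lip_const R * M) * c0 * exp (lam * t) * lam powr (- nu) * (t powr (1 - (a + nu) - r * th) * Bt)"
      unfolding Bt_def
    proof (rule GS.duhamel_exponential_bound[OF nonlinearity_diff_admissible[OF w T R diff] T(1,3) rth])
      fix s y assume s: "0 < s" "s < T"
      show "\<bar>nonlinearity w s y - nonlinearity w' s y\<bar> \<le> lip_const R * M * (exp (lam * s) * s powr - (r * th))"
        using nonlinearity_diff_bound[OF w T R s M_diff[OF s]] by (simp add: mult_ac)
    qed (use t lam nu in auto)
    also have "t powr (1 - (a + nu) - r * th) = t powr nu * t powr (- th)"
      by (simp add: powr_add[symmetric] nu_def gain_def field_simps)
    also have "(lip_const R * M) * c0 * exp (lam * t) * lam powr (- nu) * (t powr nu * t powr (- th) * Bt) =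
        (A * lam powr (- nu)) * t powr nu * (M * exp (lam * t) * t powr (- th))"
      by (simp add: A_def mult_ac)
    also have "\<dots> \<le> (1 / 2) * 1 * (M * exp (lam * t) * t powr (- th))"
      using lam A M0 t T nu by (intro mult_right_mono mult_mono powr_le1) auto
    finally show ?thesis by simp
  qed
  have "M \<le> 1 / 2 * M"
    unfolding M_def
  proof (rule cSUP_least)
    show "{0<..<T} \<times> (UNIV :: (real^'d) set) \<noteq> {}" using T by auto
    fix z assume "z \<in> {0<..<T} \<times> (UNIV :: (real^'d) set)"
    then obtain s y where z: "z = (s, y)" "0 < s" "s < T" by auto
    have "W z \<le> exp (- lam * s) * s powr th * (1 / 2 * M * exp (lam * s) * s powr (- th))"
      unfolding z W_def prod.case using z by (intro mult_left_mono main) auto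
    also have "\<dots> = 1 / 2 * M" using z by (simp add: powr_minus exp_minus field_simps)
    finally show "W z \<le> 1 / 2 * (SUP z\<in>{0<..<T} \<times> UNIV. W z)" by (simp add: M_def)
  qed
  then have "M = 0" using M0 by simp
  then show ?thesis using main[OF t, of x] by simp
qed

lemma evolve_cong:
  assumes eq: "\<And>s x. s \<in> {0<..<T} \<Longrightarrow> w s x = w' s x" and t: "t \<in> {0<..T}"
  shows "evolve w t = evolve w' t"
proof
  fix x
  have "nonlinearity w s = nonlinearity w' s" if "s \<in> {0<..<t}" for s
    using that t eq[of s] by (auto simp: nonlinearity_def fun_eq_iff)
  then show "evolve w t x = evolve w' t x"
    unfolding evolve_def duhamel_def by (intro arg_cong2[where f="(+)"] refl set_lebesgue_integral_cong) auto
qed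

text \<open>
  Differentiating the mild equation shows that the gradient of every mild solution with the prescribed
  growth solves the fixed point problem, so that \<open>fixed_profile_unique\<close> applies to it.
\<close>
lemma mild_solution_profile:
  assumes v: "mild_solution p H u0 T v" and T: "0 < T" "T \<le> 1" "T \<le> Tm"
    and O: "(\<lambda>t. sup_norm (grad (v t))) \<in> O[at_right 0](\<lambda>t. t powr (- th))"
  obtains R where "\<And>R'. R \<le> R' \<Longrightarrow> gradient_profile T R' (\<lambda>t. grad (v t))"
    "\<And>t. t \<in> {0<..T} \<Longrightarrow> v t = evolve (\<lambda>t. grad (v t)) t"
    "\<And>t x. t \<in> {0<..T} \<Longrightarrow> grad (v t) x = evolve_grad (\<lambda>t. grad (v t)) t x"
proof -
  have cont: "continuous_into_Cb 1 T v" using v by (simp add: mild_solution_def)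
  have Cb: "v t \<in> Cb 1" if "t \<in> {0<..T}" for t using cont that by (simp add: continuous_into_Cb_def)
  obtain R where R: "\<And>t x. t \<in> {0<..T} \<Longrightarrow> norm (grad (v t) x) \<le> R * t powr (- th)"
    using gradient_blowup_bound[OF cont th(1) T(1) O] by metis
  have "continuous_on ({0<..T} \<times> UNIV) (\<lambda>(t, x). grad (v t) x)"
    using Cb continuous_into_Cb_grad[OF cont]
    by (intro joint_continuity_of_uniform_time_continuity) (auto simp: Cb_1_simp)
  then have c: "continuous_on ({0<..<T} \<times> UNIV) (\<lambda>(t, x). grad (v t) x)"
    by (rule continuous_on_subset) auto
  have prof: "gradient_profile T R' (\<lambda>t. grad (v t))" if "R \<le> R'" for R'
  proof -
    have "norm (grad (v t) x) \<le> R' * t powr (- th)" if "t \<in> {0<..<T}" for t x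
    proof -
      have "R * t powr (- th) \<le> R' * t powr (- th)" using \<open>R \<le> R'\<close> by (rule mult_right_mono) simp
      moreover have "norm (grad (v t) x) \<le> R * t powr (- th)" using that by (intro R) auto
      ultimately show ?thesis by (rule order_trans[rotated])
    qed
    then show ?thesis using c by (simp add: gradient_profile_def)
  qed
  have ev: "v t = evolve (\<lambda>t. grad (v t)) t" if "t \<in> {0<..T}" for t
  proof
    fix x
    have "nonlinearity (\<lambda>t. grad (v t)) = (\<lambda>s y. H s y (grad (v s) y))"
      by (intro ext) (rule nonlinearity_def)
    moreover have "v t x = P t u0 x + (LINT s:{0<..<t}|lborel. P (t - s) (\<lambda>y. H s y (grad (v s) y)) x)"
      using v that unfolding mild_solution_def by blast
    ultimately show "v t x = evolve (\<lambda>t. grad (v t)) t x"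
      unfolding evolve_def duhamel_def by (simp only:)
  qed
  have "grad (v t) x = evolve_grad (\<lambda>t. grad (v t)) t x" if t: "t \<in> {0<..T}" for t x
    by (subst ev[OF t]) (rule grad_evolve[OF prof[of "max R 1"] T _ t]; simp)
  with prof ev show thesis by (rule that)
qed

theorem local_well_posedness:
  "\<exists>T\<in>{0<..Tm}. \<exists>u.
    (mild_solution p H u0 T u \<and> (\<lambda>t. sup_norm (grad (u t))) \<in> O[at_right 0](\<lambda>t. t powr (- th))) \<and>
    (\<forall>v. mild_solution p H u0 T v \<and> (\<lambda>t. sup_norm (grad (v t))) \<in> O[at_right 0](\<lambda>t. t powr (- th))
      \<longrightarrow> (\<forall>t\<in>{0<..T}. v t = u t))"
proof -
  obtain T R w where T: "0 < T" "T \<le> 1" "T \<le> Tm" and R: "1 \<le> R" and w: "gradient_profile T R w"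
    and eq: "\<And>t x. t \<in> {0<..T} \<Longrightarrow> w t x = evolve_grad w t x"
    by (rule fixed_profile_exists) (rule that)
  have mild: "mild_solution p H u0 T (evolve w)"
    by (rule evolve_mild_solution[OF w T R]) (simp add: eq)
  define C where "C = C0 + growth_const R * c0 * beta_const * T powr gain"
  have g: "norm (grad (evolve w t) x) \<le> C * t powr (- th)" if "t \<in> {0<..T}" for t x
    using evolve_grad_bound[OF w T R that, of x] grad_evolve[OF w T R that] by (simp add: C_def)
  have "\<forall>\<^sub>F t in at_right 0. norm (sup_norm (grad (evolve w t))) \<le> C * norm (t powr (- th))"
    unfolding eventually_at_right_field
  proof (intro exI[of _ T] conjI allI impI T(1))
    fix t assume t: "0 < t" "t < T"
    have "bounded (range (grad (evolve w t)))" using g[of t] t by (auto simp: bounded_iff)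
    then have "0 \<le> sup_norm (grad (evolve w t))" by (rule sup_norm_nonneg)
    moreover have "sup_norm (grad (evolve w t)) \<le> C * t powr (- th)" using g[of t] t by (intro sup_norm_least) auto
    ultimately show "norm (sup_norm (grad (evolve w t))) \<le> C * norm (t powr (- th))" by simp
  qed
  then have O: "(\<lambda>t. sup_norm (grad (evolve w t))) \<in> O[at_right 0](\<lambda>t. t powr (- th))" by (rule bigoI)
  have uniq: "v t = evolve w t"
    if v: "mild_solution p H u0 T v" "(\<lambda>t. sup_norm (grad (v t))) \<in> O[at_right 0](\<lambda>t. t powr (- th))" and t: "t \<in> {0<..T}" for v t
  proof -
    obtain R' where R': "\<And>R''. R' \<le> R'' \<Longrightarrow> gradient_profile T R'' (\<lambda>t. grad (v t))"
      "\<And>t. t \<in> {0<..T} \<Longrightarrow> v t = evolve (\<lambda>t. grad (v t)) t"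
      "\<And>t x. t \<in> {0<..T} \<Longrightarrow> grad (v t) x = evolve_grad (\<lambda>t. grad (v t)) t x"
      by (rule mild_solution_profile[OF v(1) T v(2)]) (rule that)
    define S where "S = max R R'"
    have S: "1 \<le> S" using R by (simp add: S_def)
    have pv: "gradient_profile T S (\<lambda>t. grad (v t))" by (rule R'(1)) (simp add: S_def)
    have pw: "gradient_profile T S w"
      unfolding gradient_profile_def
    proof (intro conjI ballI allI)
      show "continuous_on ({0<..<T} \<times> UNIV) (\<lambda>(s, y). w s y)" using w by (simp add: gradient_profile_def)
      fix s y assume "s \<in> {0<..<T}"
      then have "norm (w s y) \<le> R * s powr (- th)" using w by (simp add: gradient_profile_def)
      also have "\<dots> \<le> S * s powr (- th)" by (intro mult_right_mono) (auto simp: S_def)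
      finally show "norm (w s y) \<le> S * s powr (- th)" .
    qed
    have "grad (v s) x = w s x" if "s \<in> {0<..T}" for s x
      using fixed_profile_unique[OF pv pw T S R'(3) eq that] .
    then have "evolve (\<lambda>t. grad (v t)) t = evolve w t" using t by (intro evolve_cong[of T]) auto
    then show ?thesis using R'(2)[OF t] by simp
  qed
  show ?thesis
  proof (intro bexI[of _ T] exI[of _ "evolve w"] conjI allI impI ballI mild O)
    show "v t = evolve w t"
      if "mild_solution p H u0 T v \<and> (\<lambda>t. sup_norm (grad (v t))) \<in> O[at_right 0](\<lambda>t. t powr (- th))" "t \<in> {0<..T}" for v t
      using that by (intro uniq) auto
  qed (use T in simp)
qed

end

text \<open>
  In all three cases the hypotheses on \<open>\<delta>\<close> give \<open>(r - 1) (1 - \<delta>) < \<alpha> - 1\<close>, which is the subcritical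
  condition; adding \<open>1 - \<delta> \<le> 1\<close> gives \<open>r (1 - \<delta>) < \<alpha>\<close>.
\<close>
theorem theorem3p8:
  fixes A :: "real^'d^'d::finite"
    and \<mu> :: "(real^'d) measure"
    and p :: "real \<Rightarrow> real^'d \<Rightarrow> real"
    and H :: "real \<Rightarrow> real^'d \<Rightarrow> real^'d \<Rightarrow> real"
    and u0 :: "real^'d \<Rightarrow> real"
    and Tstar \<alpha> c0 r H0 L \<delta> :: real
  assumes Tstar: "Tstar > 0"
    and triplet: "levy_triplet A \<mu>"
    and kernel: "heat_kernel A \<mu> p"
    and smooth: "\<And>t. t > 0 \<Longrightarrow> p t \<in> Cb_infinity"
    and alpha: "\<alpha> \<in> {1<..2}"
    and c0: "c0 > 0"
    and grad_kernel: "\<And>t. t \<in> {0<..Tstar} \<Longrightarrow>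
      (\<integral>\<^sup>+ y. ennreal (norm (grad (p t) y)) \<partial>lborel) \<le> ennreal (c0 * t powr (- 1 / \<alpha>))"
    and H_cont: "continuous_on ({0<..Tstar} \<times> UNIV \<times> UNIV) (\<lambda>(t, x, q). H t x q)"
    and r: "r \<ge> 1"
    and H0: "H0 > 0"
    and L: "L > 0"
    and H_bound: "\<And>t x. t \<in> {0<..<Tstar} \<Longrightarrow> \<bar>H t x 0\<bar> \<le> H0"
    and H_Lipschitz: "\<And>t x q q'. t \<in> {0<..<Tstar} \<Longrightarrow>
      \<bar>H t x q - H t x q'\<bar>
        \<le> L * (1 + (norm q)\<^sup>2 + (norm q')\<^sup>2) powr ((r - 1) / 2) * norm (q - q')"
    and delta: "\<delta> \<in> {0..<1}"
    and delta_sub: "r < \<alpha> \<Longrightarrow> \<delta> = 0"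
    and delta_crit: "r = \<alpha> \<Longrightarrow> \<delta> \<in> {0<..<1}"
    and delta_super: "r > \<alpha> \<Longrightarrow> \<delta> \<in> {(r - \<alpha>) / (r - 1)<..<1}"
    and u0: "u0 \<in> Cb_Hoelder \<delta>"
  shows "\<exists>T\<in>{0<..Tstar}. \<exists>u.
    (mild_solution p H u0 T u \<and>
      (\<lambda>t. sup_norm (grad (u t))) \<in> O[at_right 0](\<lambda>t. t powr (- (1 - \<delta>) / \<alpha>))) \<and>
    (\<forall>v. mild_solution p H u0 T v \<and>
      (\<lambda>t. sup_norm (grad (v t))) \<in> O[at_right 0](\<lambda>t. t powr (- (1 - \<delta>) / \<alpha>))
      \<longrightarrow> (\<forall>t\<in>{0<..T}. v t = u t))"
proof -
  have pt1: "p t \<in> Cb 1" if "t > 0" for t using smooth[OF that] by (auto simp: Cb_infinity_def)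
  interpret smoothing_kernel p "levy_symbol A \<mu>" Tstar "1 / \<alpha>" c0
  proof (rule smoothing_kernel.intro)
    show "p t \<in> borel_measurable borel" if "t > 0" for t using kernel that by (simp add: heat_kernel_def)
    show "0 \<le> p t x" if "t > 0" for t x using kernel that by (simp add: heat_kernel_def)
    show "prob_space (density lborel (\<lambda>x. ennreal (p t x)))" if "t > 0" for t
      using kernel that by (simp add: heat_kernel_def)
    show "(LINT x|density lborel (\<lambda>x. ennreal (p t x)). exp (- \<i> * of_real (\<xi> \<bullet> x))) = exp (- of_real t * levy_symbol A \<mu> \<xi>)"
      if "t > 0" for t \<xi> using kernel that unfolding heat_kernel_def by blast
    show "p t differentiable at x" if "t > 0" for t x using pt1[OF that] by (simp add: Cb_1_simp)
    show "continuous_on UNIV (grad (p t))" if "t > 0" for t using pt1[OF that] by (simp add: Cb_1_simp)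
    show "(\<integral>\<^sup>+ y. ennreal (norm (grad (p t) y)) \<partial>lborel) \<le> ennreal (c0 * t powr (- (1 / \<alpha>)))"
      if "0 < t" "t \<le> Tstar" for t using grad_kernel[of t] that by simp
  qed (use alpha c0 Tstar in auto)
  have \<delta>: "0 \<le> \<delta>" "\<delta> < 1" using delta by auto
  obtain C0 where C0: "0 \<le> C0" "\<And>t x. 0 < t \<Longrightarrow> t \<le> Tstar \<Longrightarrow> norm (G t u0 x) \<le> C0 * t powr (- ((1 - \<delta>) * (1 / \<alpha>)))"
    using G_bound_Hoelder[OF \<delta> u0] by metis
  obtain B0 where B0: "bounded_by B0 u0" using Cb_Hoelder_borel_bounded[OF \<delta>(1) u0] .
  have sub: "(r - 1) * (1 - \<delta>) < \<alpha> - 1"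
  proof -
    consider "r < \<alpha>" | "r = \<alpha>" | "r > \<alpha>" by linarith
    then show ?thesis
    proof cases
      case 1 then show ?thesis using delta_sub by simp
    next
      case 2
      then have "(r - 1) * (1 - \<delta>) < (r - 1) * 1" using delta_crit alpha by (intro mult_strict_left_mono) auto
      then show ?thesis using 2 by simp
    next
      case 3
      then have "(r - \<alpha>) / (r - 1) < \<delta>" using delta_super by simp
      then have "r - \<alpha> < \<delta> * (r - 1)" using 3 alpha by (simp add: divide_less_eq)
      then show ?thesis by (simp add: algebra_simps)
    qed
  qed
  interpret hamilton_jacobi p "levy_symbol A \<mu>" Tstar "1 / \<alpha>" c0 H u0 r H0 L "(1 - \<delta>) / \<alpha>" C0 B0
  proof
    show "0 \<le> (1 - \<delta>) / \<alpha>" using \<delta> alpha by simp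
    show "r * ((1 - \<delta>) / \<alpha>) < 1" using sub \<delta> alpha by (simp add: field_simps)
    show "1 / \<alpha> + (r - 1) * ((1 - \<delta>) / \<alpha>) < 1" using sub alpha by (simp add: field_simps)
  qed (use H_cont r H0 L H_bound H_Lipschitz B0 C0 in auto)
  have "- (1 - \<delta>) / \<alpha> = - ((1 - \<delta>) / \<alpha>)" by (rule minus_divide_left[symmetric])
  then show ?thesis using local_well_posedness by (simp only:)
qed

end
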